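(* Let $\mu$ be a probability measure on $\mathbb{R}$ with compact support and suppose that there is a sequence of polynomials $(p_d)_{d= 1}^\infty$, such that $\kappa_n^d(p_d)$ coincides with the $n$-th free cumulant of $\mu$ for all $n\leq d$. Then, the empirical root distribution of $(p_d)_{d=1}^\infty$ has an infinitesimal asymptotic distribution $(\mu,\mu')$ with infinitesimal Cauchy transform given by \[ G_{inf}(z)=\frac{G_{\mu}''(z)}{2G_{\mu}'(z)}-\frac{G_\mu'(z)}{G_{\mu}(z)}. \] Consequently, \[ \mu'=\frac{1}{2}\left(M(\mu)-M(M(\mu))\right). \]
   Context: For a monic polynomial $p(x)=\sum_{i=0}^d x^{d-i}(-1)^i a_i^p$ of degree $d$ with roots $\lambda_1(p),\dots,\lambda_d(p)$, its moments are $m_n(p)=\frac{1}{d}\sum_{i=1}^d\lambda_i(p)^n$ (the moments of its empirical root distribution $\frac1d\sum_i\delta_{\lambda_i(p)}$). Its finite free cumulants $\kappa_n^d(p)$, $n=1,\dots,d$, are defined by \[ \kappa_n^d(p) = \frac{(-d)^n}{d(n-1)!} \sum_{\pi \in P(n)} (-1)^{|\pi|} \frac{\prod_{V\in\pi}|V|!\, \prod_{V\in\pi}a^p_{|V|}\, (|\pi|-1)!}{\prod_{V\in\pi}(d)_{|V|}}, \] where $P(n)$ is the set of partitions of $\{1,\dots,n\}$, $|\pi|$ is the number of blocks and $(d)_k=d(d-1)\cdots(d-k+1)$. The free cumulants $\kappa_n(\mu)$ of $\mu$ are defined by $m_n(\mu)=\sum_{\pi\in NC(n)}\prod_{V\in\pi}\kappa_{|V|}(\mu)$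 (sum over non-crossing partitions). A sequence $(p_d)$ has infinitesimal asymptotic distribution $(\mu,\mu')$ if $m_n:=\lim_{d\to\infty}m_n(p_d)$ are the moments of $\mu$ and the limits $m_n':=\lim_{d\to\infty} d(m_n(p_d)-m_n)$ exist and are the moments of the signed measure $\mu'$. Here $G_\mu(z)=\sum_{n\ge0}m_n(\mu)z^{-n-1}$ is the Cauchy transform, $G_{inf}(z)=\sum_{n\ge1}m_n'z^{-n-1}$, and $M(\mu)$ is the inverse Markov transform: the unique signed measure with $G_{M(\mu)}(z)=-G_\mu'(z)/G_\mu(z)$.
   Formalization: M(μ), M(M(μ)) and μ' are not unique as signed measures (only their moments are fixed), so the last identity is stated for every choice as equality of all moments, with half the difference itself a valid μ', and as equality of measures when all three are compactly supported. *)

theory Defs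
  imports
    "HOL-Probability.Probability"
    "HOL-Computational_Algebra.Computational_Algebra"
    "HOL-Library.Disjoint_Sets"
begin

definition root_moment :: "complex poly \<Rightarrow> nat \<Rightarrow> complex" where
  "root_moment p n = (\<Sum>z\<in>#proots p. z ^ n) / of_nat (degree p)"

text \<open>For monic \<open>p\<close> of degree \<open>d\<close>: \<open>p(x) = \<Sum>i\<le>d. x^(d-i) * (-1)^i * signed_coeff p i\<close>.\<close>

definition signed_coeff :: "complex poly \<Rightarrow> nat \<Rightarrow> complex" where
  "signed_coeff p i = (-1) ^ i * coeff p (degree p - i)"

definition falling_factorial :: "nat \<Rightarrow> nat \<Rightarrow> complex" where
  "falling_factorial d k = (\<Prod>i<k. of_nat d - of_nat i)"

text \<open>Only meaningful for \<open>1 \<le> n \<le> degree p\<close>.\<close>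

definition finite_free_cumulant :: "complex poly \<Rightarrow> nat \<Rightarrow> complex" where
  "finite_free_cumulant p n =
     (let d = degree p in
       (- of_nat d) ^ n / (of_nat d * fact (n - 1)) *
       (\<Sum>\<pi> | partition_on {1..n} \<pi>.
          (-1) ^ card \<pi> *
          ((\<Prod>V\<in>\<pi>. fact (card V)) * (\<Prod>V\<in>\<pi>. signed_coeff p (card V)) * fact (card \<pi> - 1)) /
          (\<Prod>V\<in>\<pi>. falling_factorial d (card V))))"

definition noncrossing :: "nat set set \<Rightarrow> bool" where
  "noncrossing \<pi> \<longleftrightarrow>
     (\<forall>V\<in>\<pi>. \<forall>W\<in>\<pi>. V \<noteq> W \<longrightarrow>
        \<not> (\<exists>i\<in>V. \<exists>j\<in>W. \<exists>k\<in>V. \<exists>l\<in>W. i < j \<and> j < k \<and> k < l))"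

text \<open>The moment-cumulant relations determine \<open>\<kappa> n\<close> for all \<open>n \<ge> 1\<close>, since the
  one-block partition contributes \<open>\<kappa> n\<close> and all other blocks are smaller; \<open>\<kappa> 0\<close> is irrelevant.\<close>

definition free_cumulants :: "real measure \<Rightarrow> (nat \<Rightarrow> real) \<Rightarrow> bool" where
  "free_cumulants \<mu> \<kappa> \<longleftrightarrow>
     (\<forall>n\<ge>1. (\<integral>x. x ^ n \<partial>\<mu>) =
        (\<Sum>\<pi> | partition_on {1..n} \<pi> \<and> noncrossing \<pi>. \<Prod>V\<in>\<pi>. \<kappa> (card V)))"

text \<open>A signed measure on the real line is represented by its set function. By the Jordan
  decomposition it is a difference of finite Borel measures; since \<open>measure M A = 0\<close> for
  non-measurable \<open>A\<close>, equality of set functions is equality on the Borel sets. All signed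
  measures considered here have moments of all orders. A finite positive measure \<open>\<mu>\<close> is
  regarded as the signed measure \<open>measure \<mu>\<close>.\<close>

definition is_difference_of ::
  "(real set \<Rightarrow> real) \<Rightarrow> real measure \<Rightarrow> real measure \<Rightarrow> bool" where
  "is_difference_of \<sigma> P N \<longleftrightarrow>
     finite_measure P \<and> finite_measure N \<and> sets P = sets borel \<and> sets N = sets borel \<and>
     (\<forall>n::nat. integrable P (\<lambda>x. x ^ n)) \<and> (\<forall>n::nat. integrable N (\<lambda>x. x ^ n)) \<and>
     \<sigma> = (\<lambda>A. measure P A - measure N A)"

definition signed_measure :: "(real set \<Rightarrow> real) \<Rightarrow> bool" where
  "signed_measure \<sigma> \<longleftrightarrow> (\<exists>P N. is_difference_of \<sigma> P N)"

definition signed_moment :: "(real set \<Rightarrow> real) \<Rightarrow> nat \<Rightarrow> real" where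
  "signed_moment \<sigma> n =
     (THE m. \<exists>P N. is_difference_of \<sigma> P N \<and> m = (\<integral>x. x ^ n \<partial>P) - (\<integral>x. x ^ n \<partial>N))"

definition compactly_supported :: "(real set \<Rightarrow> real) \<Rightarrow> bool" where
  "compactly_supported \<sigma> \<longleftrightarrow>
     (\<exists>K. compact K \<and> (\<forall>A\<in>sets borel. A \<inter> K = {} \<longrightarrow> \<sigma> A = 0))"

text \<open>The moments do not depend on the decomposition.\<close>

lemma difference_nn_integral:
  fixes P N P' N' :: "real measure"
  assumes s: "sets P = sets borel" "sets N = sets borel" "sets P' = sets borel" "sets N' = sets borel"
    and fin: "finite_measure P" "finite_measure N" "finite_measure P'" "finite_measure N'"
    and eq: "\<And>A. A \<in> sets borel \<Longrightarrow> measure P A - measure N A = measure P' A - measure N' A"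
    and f: "f \<in> borel_measurable borel"
  shows "(\<integral>\<^sup>+x. f x \<partial>P) + (\<integral>\<^sup>+x. f x \<partial>N') = (\<integral>\<^sup>+x. f x \<partial>P') + (\<integral>\<^sup>+x. f x \<partial>N)"
  using f
proof (induction f rule: borel_measurable_induct)
  case (cong f g)
  then have "f = g" by (auto simp: fun_eq_iff)
  with cong show ?case by simp
next
  case (set A)
  have "emeasure P A + emeasure N' A = ennreal (measure P A + measure N' A)"
    by (simp add: finite_measure.emeasure_eq_measure[OF fin(1)]
        finite_measure.emeasure_eq_measure[OF fin(4)])
  also have "\<dots> = ennreal (measure P' A + measure N A)"
    using eq[OF set] by (simp add: algebra_simps)
  also have "\<dots> = emeasure P' A + emeasure N A"
    by (simp add: finite_measure.emeasure_eq_measure[OF fin(2)]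
        finite_measure.emeasure_eq_measure[OF fin(3)])
  finally show ?case using set s by simp
next
  case (mult u c)
  have m: "u \<in> borel_measurable P" "u \<in> borel_measurable N"
    "u \<in> borel_measurable P'" "u \<in> borel_measurable N'"
    using mult s by (simp_all add: measurable_def sets_eq_imp_space_eq[OF s(1)]
        sets_eq_imp_space_eq[OF s(2)] sets_eq_imp_space_eq[OF s(3)] sets_eq_imp_space_eq[OF s(4)])
  show ?case using mult.IH by (simp add: nn_integral_cmult m distrib_left[symmetric])
next
  case (add u v)
  have m: "u \<in> borel_measurable P" "u \<in> borel_measurable N"
    "u \<in> borel_measurable P'" "u \<in> borel_measurable N'"
    "v \<in> borel_measurable P" "v \<in> borel_measurable N"
    "v \<in> borel_measurable P'" "v \<in> borel_measurable N'"
    using add s by (simp_all add: measurable_def sets_eq_imp_space_eq[OF s(1)]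
        sets_eq_imp_space_eq[OF s(2)] sets_eq_imp_space_eq[OF s(3)] sets_eq_imp_space_eq[OF s(4)])
  have "(\<integral>\<^sup>+x. v x + u x \<partial>P) + (\<integral>\<^sup>+x. v x + u x \<partial>N') =
      ((\<integral>\<^sup>+x. v x \<partial>P) + (\<integral>\<^sup>+x. v x \<partial>N')) + ((\<integral>\<^sup>+x. u x \<partial>P) + (\<integral>\<^sup>+x. u x \<partial>N'))"
    by (simp add: nn_integral_add m ac_simps)
  also have "\<dots> = (\<integral>\<^sup>+x. v x + u x \<partial>P') + (\<integral>\<^sup>+x. v x + u x \<partial>N)"
    using add.IH by (simp add: nn_integral_add m ac_simps)
  finally show ?case .
next
  case (seq U)
  have m: "U i \<in> borel_measurable P" "U i \<in> borel_measurable N"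
    "U i \<in> borel_measurable P'" "U i \<in> borel_measurable N'" for i
    using seq s by (simp_all add: measurable_def sets_eq_imp_space_eq[OF s(1)]
        sets_eq_imp_space_eq[OF s(2)] sets_eq_imp_space_eq[OF s(3)] sets_eq_imp_space_eq[OF s(4)])
  have *: "(\<integral>\<^sup>+x. (SUP i. U i) x \<partial>Q) + (\<integral>\<^sup>+x. (SUP i. U i) x \<partial>R) =
      (SUP i. (\<integral>\<^sup>+x. U i x \<partial>Q) + (\<integral>\<^sup>+x. U i x \<partial>R))"
    if "\<And>i. U i \<in> borel_measurable Q" "\<And>i. U i \<in> borel_measurable R" for Q R :: "real measure"
  proof -
    have mono: "incseq (\<lambda>i. \<integral>\<^sup>+x. U i x \<partial>Q')" for Q' :: "real measure"
      using seq(3) by (auto intro!: monoI nn_integral_mono dest: monoD simp: le_fun_def)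
    have "(\<integral>\<^sup>+x. (SUP i. U i) x \<partial>Q') = (SUP i. \<integral>\<^sup>+x. U i x \<partial>Q')"
      if "\<And>i. U i \<in> borel_measurable Q'" for Q' :: "real measure"
    proof -
      have "(SUP i. U i) = (\<lambda>x. SUP i. U i x)" by (rule ext) (rule SUP_apply)
      then show ?thesis
        using nn_integral_monotone_convergence_SUP[OF seq(3), of Q'] that by simp
    qed
    then show ?thesis
      using that ennreal_SUP_add[OF mono mono, of Q R] by simp
  qed
  show ?case
    unfolding *[OF m(1) m(4)] *[OF m(3) m(2)] by (simp only: seq.IH)
qed

lemma signed_moment_eq:
  assumes "is_difference_of \<sigma> P N"
  shows "signed_moment \<sigma> n = (\<integral>x. x ^ n \<partial>P) - (\<integral>x. x ^ n \<partial>N)"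
  unfolding signed_moment_def
proof (rule the_equality)
  show "\<exists>P' N'. is_difference_of \<sigma> P' N' \<and>
      (\<integral>x. x ^ n \<partial>P) - (\<integral>x. x ^ n \<partial>N) = (\<integral>x. x ^ n \<partial>P') - (\<integral>x. x ^ n \<partial>N')"
    using assms by blast
next
  fix m
  assume "\<exists>P N. is_difference_of \<sigma> P N \<and> m = (\<integral>x. x ^ n \<partial>P) - (\<integral>x. x ^ n \<partial>N)"
  then obtain P' N' where D: "is_difference_of \<sigma> P' N'"
    and m: "m = (\<integral>x. x ^ n \<partial>P') - (\<integral>x. x ^ n \<partial>N')" by blast
  note d = assms[unfolded is_difference_of_def] D[unfolded is_difference_of_def]
  have eq: "measure P A - measure N A = measure P' A - measure N' A" for A
    using d by (metis (no_types, lifting))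
  have int: "integrable P (\<lambda>x. x ^ n)" "integrable N (\<lambda>x. x ^ n)"
    "integrable P' (\<lambda>x. x ^ n)" "integrable N' (\<lambda>x. x ^ n)"
    using d by auto
  have nn: "(\<integral>\<^sup>+x. f x \<partial>P) + (\<integral>\<^sup>+x. f x \<partial>N') = (\<integral>\<^sup>+x. f x \<partial>P') + (\<integral>\<^sup>+x. f x \<partial>N)"
    if "f \<in> borel_measurable borel" for f
    by (rule difference_nn_integral) (use d eq that in auto)
  have fin: "(\<integral>\<^sup>+x. ennreal (x ^ n) \<partial>Q) < \<infinity>" "(\<integral>\<^sup>+x. ennreal (- (x ^ n)) \<partial>Q) < \<infinity>"
    if "integrable Q (\<lambda>x. x ^ n)" for Q :: "real measure"
    using that by (auto simp: real_integrable_def top.not_eq_extremum)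
  have split: "(\<integral>x. x ^ n \<partial>Q) =
      enn2real (\<integral>\<^sup>+x. ennreal (x ^ n) \<partial>Q) - enn2real (\<integral>\<^sup>+x. ennreal (- (x ^ n)) \<partial>Q)"
    if "integrable Q (\<lambda>x. x ^ n)" for Q :: "real measure"
    using real_lebesgue_integral_def[OF that] .
  have meas: "(\<lambda>x::real. ennreal (x ^ n)) \<in> borel_measurable borel"
    "(\<lambda>x::real. ennreal (- (x ^ n))) \<in> borel_measurable borel" by measurable
  have e: "enn2real (\<integral>\<^sup>+x. f x \<partial>P) + enn2real (\<integral>\<^sup>+x. f x \<partial>N') =
      enn2real (\<integral>\<^sup>+x. f x \<partial>P') + enn2real (\<integral>\<^sup>+x. f x \<partial>N)"
    if "f \<in> borel_measurable borel" "(\<integral>\<^sup>+x. f x \<partial>P) < \<infinity>" "(\<integral>\<^sup>+x. f x \<partial>N') < \<infinity>"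
      "(\<integral>\<^sup>+x. f x \<partial>P') < \<infinity>" "(\<integral>\<^sup>+x. f x \<partial>N) < \<infinity>" for f
    using arg_cong[OF nn[OF that(1)], of enn2real] that by (simp add: enn2real_plus)
  show "m = (\<integral>x. x ^ n \<partial>P) - (\<integral>x. x ^ n \<partial>N)"
    using e[OF meas(1) fin(1)[OF int(1)] fin(1)[OF int(4)] fin(1)[OF int(3)] fin(1)[OF int(2)]]
      e[OF meas(2) fin(2)[OF int(1)] fin(2)[OF int(4)] fin(2)[OF int(3)] fin(2)[OF int(2)]]
    unfolding m split[OF int(1)] split[OF int(2)] split[OF int(3)] split[OF int(4)] by linarith
qed

lemma signed_moment_measure:
  assumes "finite_measure \<mu>" "sets \<mu> = sets borel" "\<And>n::nat. integrable \<mu> (\<lambda>x. x ^ n)"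
  shows "signed_moment (measure \<mu>) n = (\<integral>x. x ^ n \<partial>\<mu>)"
proof -
  let ?Z = "null_measure borel :: real measure"
  have "finite_measure ?Z" by (intro finite_measureI) simp
  moreover have "integrable ?Z (\<lambda>x. x ^ k)" for k :: nat
  proof (rule integrableI_bounded)
    show "(\<lambda>x. x ^ k) \<in> borel_measurable ?Z"
      by (subst measurable_cong_sets[of _ borel _ borel]) auto
  qed simp
  ultimately have "is_difference_of (measure \<mu>) \<mu> ?Z"
    using assms by (simp add: is_difference_of_def measure_def fun_eq_iff)
  from signed_moment_eq[OF this] show ?thesis by (simp add: integral_null_measure)
qed

text \<open>The Cauchy transform is the moment series at infinity; it only carries information
  where it converges, and all identities between Cauchy transforms are
  stated for all sufficiently large \<open>norm z\<close>.\<close>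

definition cauchy_transform :: "(real set \<Rightarrow> real) \<Rightarrow> complex \<Rightarrow> complex" where
  "cauchy_transform \<sigma> z = (\<Sum>n. of_real (signed_moment \<sigma> n) / z ^ (n + 1))"

text \<open>\<open>is_inverse_markov \<sigma> \<tau>\<close> expresses \<open>\<tau> = M(\<sigma>)\<close>, i.e. \<open>G\<^sub>\<tau> = - G\<^sub>\<sigma>' / G\<^sub>\<sigma>\<close>.
  It is a relation: \<open>M(\<sigma>)\<close> is unique up to equality of all moments, hence unique among
  compactly supported signed measures, but it need not have compact support on the real
  line.\<close>

definition is_inverse_markov :: "(real set \<Rightarrow> real) \<Rightarrow> (real set \<Rightarrow> real) \<Rightarrow> bool" where
  "is_inverse_markov \<sigma> \<tau> \<longleftrightarrow>
     signed_measure \<sigma> \<and> signed_measure \<tau> \<and>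
     (\<forall>\<^sub>F z in at_infinity.
        summable (\<lambda>n. of_real (signed_moment \<sigma> n) / z ^ (n + 1)) \<and>
        summable (\<lambda>n. of_real (signed_moment \<tau> n) / z ^ (n + 1)) \<and>
        cauchy_transform \<sigma> z \<noteq> 0 \<and>
        cauchy_transform \<tau> z = - deriv (cauchy_transform \<sigma>) z / cauchy_transform \<sigma> z)"

text \<open>The index \<open>n = 0\<close> is included: it says that \<open>\<mu>\<close> has mass \<open>1\<close> and \<open>\<mu>'\<close> has mass \<open>0\<close>.\<close>

definition infinitesimal_distribution ::
  "(nat \<Rightarrow> complex poly) \<Rightarrow> real measure \<Rightarrow> (real set \<Rightarrow> real) \<Rightarrow> bool" where
  "infinitesimal_distribution p \<mu> \<mu>' \<longleftrightarrow>
     signed_measure \<mu>' \<and>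
     (\<forall>n. integrable \<mu> (\<lambda>x. x ^ n) \<and>
        (\<lambda>d. root_moment (p d) n) \<longlonglongrightarrow> of_real (\<integral>x. x ^ n \<partial>\<mu>) \<and>
        (\<lambda>d. of_nat d * (root_moment (p d) n - of_real (\<integral>x. x ^ n \<partial>\<mu>)))
          \<longlonglongrightarrow> of_real (signed_moment \<mu>' n))"

definition inf_moment :: "(nat \<Rightarrow> complex poly) \<Rightarrow> nat \<Rightarrow> complex" where
  "inf_moment p n =
     lim (\<lambda>d. of_nat d * (root_moment (p d) n - lim (\<lambda>e. root_moment (p e) n)))"

text \<open>The sum defining the infinitesimal Cauchy transform starts at \<open>n = 1\<close>.\<close>

definition inf_cauchy_term :: "(nat \<Rightarrow> complex poly) \<Rightarrow> complex \<Rightarrow> nat \<Rightarrow> complex" where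
  "inf_cauchy_term p z n = inf_moment p (Suc n) / z ^ (Suc n + 1)"

definition inf_cauchy_transform :: "(nat \<Rightarrow> complex poly) \<Rightarrow> complex \<Rightarrow> complex" where
  "inf_cauchy_transform p z = (\<Sum>n. inf_cauchy_term p z n)"

end

theory Submission
  imports Defs
begin

text \<open>With \<open>K(s) = \<Sum>\<kappa>\<^sub>n s\<^sup>n/n\<close>, prescribing the finite free cumulants means
  \<open>p\<^sub>d = exp(- d K(D/d)) x\<^sup>d\<close>. Commuting \<open>x\<close> with this operator gives
  \<open>x p' - d p = \<Sum>\<kappa>\<^sub>n d\<^sup>1\<^sup>-\<^sup>n p\<^sup>(\<^sup>n\<^sup>)\<close>. Divided by \<open>d p\<close>, this is an equation for \<open>F = p'/(d p)\<close>, the Cauchy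
  transform of the root distribution, in which \<open>p\<^sup>(\<^sup>n\<^sup>)/(d\<^sup>n p) = F\<^sup>n + (n choose 2) F\<^sup>n\<^sup>-\<^sup>2 F' / d + O(1/d\<^sup>2)\<close>.
  At order 0 it is the relation \<open>x G = 1 + W(G)\<close>, \<open>W(s) = \<Sum>\<kappa>\<^sub>n s\<^sup>n\<close>, between the Cauchy transform and the
  free cumulants of the limit; at order \<open>1/d\<close> it is a linear equation, whose solution
  \<open>G''/(2G') - G'/G\<close> is found by differentiating the first relation twice. Since signed measures are
  not restricted in their support, \<open>M(\<mu>)\<close> and \<open>\<mu>'\<close> exist by Boas' theorem that every real sequence is the
  moment sequence of a signed measure.\<close>

unbundle no vec_syntax

section \<open>Sums over set partitions\<close>

text \<open>The finite free cumulants of \<open>p d\<close> are prescribed only up to index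
  \<open>d\<close>, so the differential equation for \<open>p d\<close> is available only modulo
  \<open>X^(d+1)\<close> in \<open>X = 1/x\<close>. This is why the argument runs through
  coefficients of formal power series. For a fixed coefficient the truncation disappears once
  \<open>d\<close> is large, because the expansion of
  \<open>p\<^sup>(\<^sup>n\<^sup>) / (d\<^sup>n p)\<close> starts at order \<open>n\<close>. Each
  coefficient of \<open>F\<close> is then a polynomial in \<open>1/d\<close> and the coefficients of
  lower order, so limits and first-order corrections propagate by induction on the order, without
  any control of the individual roots, which may be complex.

  Analysis enters only when the resulting series are read as functions near infinity. The moments of
  \<open>M(\<mu>)\<close> form a real sequence with a convergent generating series, but nothing
  confines \<open>M(\<mu>)\<close> to a compact part of the real line. Hence the half difference is
  shown to be one admissible \<open>\<mu>'\<close>, all others have the same moments, and equality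
  of set functions is concluded under compact support.\<close>

lemma sum_partition_on_insert:
  assumes "finite A" "a \<notin> A"
  shows "(\<Sum>\<pi> | partition_on (insert a A) \<pi>. f \<pi>) =
    (\<Sum>S\<in>Pow A. \<Sum>\<pi> | partition_on (A - S) \<pi>. f (insert (insert a S) \<pi>))"
proof -
  \<comment> \<open>\<open>S\<close> is the block of \<open>a\<close> without \<open>a\<close>
    itself; the other blocks partition \<open>A - S\<close>.\<close>
  let ?T = "SIGMA S:Pow A. {\<pi>. partition_on (A - S) \<pi>}"
  let ?h = "\<lambda>(S, \<pi>). insert (insert a S) \<pi>"
  have fresh: "a \<notin> V" if "(S, \<pi>) \<in> ?T" "V \<in> \<pi>" for S \<pi> V
    using that assms(2) by (auto simp: partition_on_def)
  have inj: "inj_on ?h ?T"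
  proof (rule inj_onI, clarify)
    fix S \<pi> S' \<pi>'
    assume T: "S \<subseteq> A" "S' \<subseteq> A" "partition_on (A - S) \<pi>" "partition_on (A - S') \<pi>'"
      and eq: "insert (insert a S) \<pi> = insert (insert a S') \<pi>'"
    have n: "a \<notin> V" if "V \<in> \<pi> \<union> \<pi>'" for V
      using fresh[of S \<pi>] fresh[of S' \<pi>'] T that by auto
    have "insert a S = insert a S'"
      using eq n by blast
    moreover have "a \<notin> S" "a \<notin> S'" using T assms(2) by auto
    ultimately have S: "S = S'" by (simp add: insert_ident)
    have "insert a S' \<notin> \<pi>" "insert a S' \<notin> \<pi>'" using n by auto
    then have "\<pi> = \<pi>'" using eq unfolding S by (simp add: insert_ident)
    with S show "S = S' \<and> \<pi> = \<pi>'" by simp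
  qed
  have img: "?h ` ?T = {\<pi>. partition_on (insert a A) \<pi>}"
  proof (intro equalityI subsetI)
    fix \<rho> assume "\<rho> \<in> ?h ` ?T"
    then obtain S \<pi> where "S \<subseteq> A" "partition_on (A - S) \<pi>" "\<rho> = insert (insert a S) \<pi>"
      by auto
    moreover have "partition_on (insert a S \<union> (A - S)) (insert (insert a S) \<pi>)"
      using calculation assms(2)
      by (subst Un_commute) (auto simp: partition_on_def disjoint_def)
    moreover have "insert a S \<union> (A - S) = insert a A" using calculation(1) by auto
    ultimately show "\<rho> \<in> {\<pi>. partition_on (insert a A) \<pi>}" by auto
  next
    fix \<rho> assume "\<rho> \<in> {\<pi>. partition_on (insert a A) \<pi>}"
    then have \<rho>: "partition_on (insert a A) \<rho>" by simp
    then obtain V where V: "V \<in> \<rho>" "a \<in> V" by (auto simp: partition_on_def)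
    have "partition_on (A - (V - {a})) (\<rho> - {V})"
    proof -
      have "W \<inter> V = {}" if "W \<in> \<rho> - {V}" for W
        using disjointD[OF partition_onD2[OF \<rho>]] V that by auto
      then have "\<Union>(\<rho> - {V}) = \<Union>\<rho> - V" using V by fastforce
      then have "\<Union>(\<rho> - {V}) = insert a A - V" using partition_onD1[OF \<rho>] by simp
      moreover have "insert a A - V = A - (V - {a})" using V assms(2) by auto
      ultimately show ?thesis
        using \<rho> V by (auto simp: partition_on_def disjoint_def)
    qed
    moreover have "V - {a} \<subseteq> A" using \<rho> V by (auto simp: partition_on_def)
    moreover have "insert (insert a (V - {a})) (\<rho> - {V}) = \<rho>" using V by (simp add: insert_absorb)
    ultimately show "\<rho> \<in> ?h ` ?T"
      by (intro image_eqI[where x = "(V - {a}, \<rho> - {V})"]) auto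
  qed
  have "(\<Sum>\<pi> | partition_on (insert a A) \<pi>. f \<pi>) = (\<Sum>x\<in>?T. f (?h x))"
    unfolding img[symmetric] sum.reindex[OF inj] o_def ..
  also have "\<dots> = (\<Sum>S\<in>Pow A. \<Sum>\<pi> | partition_on (A - S) \<pi>. f (insert (insert a S) \<pi>))"
    using assms(1) by (subst sum.Sigma) (auto intro!: finitely_many_partition_on simp: case_prod_unfold)
  finally show ?thesis .
qed

lemma sum_Pow_card:
  assumes "finite A"
  shows "(\<Sum>S\<in>Pow A. g (card S)) = (\<Sum>k\<le>card A. of_nat (card A choose k) * (g k :: complex))"
proof -
  have "(\<Sum>S\<in>Pow A. g (card S)) = (\<Sum>k\<le>card A. \<Sum>S | S \<in> Pow A \<and> card S = k. g (card S))"
    using assms by (intro sum.group[symmetric]) (auto intro: card_mono)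
  also have "\<dots> = (\<Sum>k\<le>card A. of_nat (card A choose k) * g k)"
    using assms by (intro sum.cong) (auto simp: n_subsets)
  finally show ?thesis .
qed

text \<open>The exponential formula for partitions into \<open>m\<close> blocks. Splitting off the
  block of one distinguished element turns the step from \<open>m\<close> to \<open>Suc m\<close>
  into the identity that \<open>\<beta>' \<beta>^m\<close> is the derivative of
  \<open>\<beta>^(m+1) / (m+1)\<close>.\<close>

lemma sum_partition_on_prod_card:
  fixes b :: "nat \<Rightarrow> complex"
  defines "\<beta> \<equiv> Abs_fps (\<lambda>k. if k = 0 then 0 else b k / fact k)"
  assumes "finite A"
  shows "(\<Sum>\<pi> | partition_on A \<pi>. if card \<pi> = m then \<Prod>V\<in>\<pi>. b (card V) else 0) =
    fact (card A) * fps_nth (\<beta> ^ m) (card A) / fact m"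
  using assms(2)
proof (induction m arbitrary: A)
  case 0
  have "(if card \<pi> = 0 then \<Prod>V\<in>\<pi>. b (card V) else 0) = (if \<pi> = {} then 1 else 0)"
    if "partition_on A \<pi>" for \<pi>
    using finite_elements[OF 0 that] by auto
  then have "(\<Sum>\<pi> | partition_on A \<pi>. if card \<pi> = 0 then \<Prod>V\<in>\<pi>. b (card V) else 0) =
      (\<Sum>\<pi> | partition_on A \<pi>. if \<pi> = {} then 1 else 0)"
    by (intro sum.cong) auto
  also have "\<dots> = (if A = {} then 1 else 0)"
    using finitely_many_partition_on[OF 0] by (auto simp: sum.delta partition_on_def)
  finally show ?case using 0 by simp
next
  case (Suc m)
  show ?case
  proof (cases "A = {}")
    case True
    have "\<beta> $ 0 = 0" by (simp add: \<beta>_def)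
    moreover have "{\<pi>. partition_on {} \<pi>} = {{} :: 'a set set}" by (auto simp: partition_on_def)
    ultimately show ?thesis using True by simp
  next
    case False
    then obtain a B where A: "A = insert a B" "a \<notin> B" by (meson Set.set_insert all_not_in_conv)
    have finB: "finite B" using Suc.prems A by simp
    define n where "n = card B"
    have "(\<Sum>\<pi> | partition_on A \<pi>. if card \<pi> = Suc m then \<Prod>V\<in>\<pi>. b (card V) else 0) =
        (\<Sum>S\<in>Pow B. \<Sum>\<pi> | partition_on (B - S) \<pi>.
          if card (insert (insert a S) \<pi>) = Suc m
          then \<Prod>V\<in>insert (insert a S) \<pi>. b (card V) else 0)"
      unfolding A(1) by (rule sum_partition_on_insert[OF finB A(2)])
    also have "\<dots> = (\<Sum>S\<in>Pow B. b (Suc (card S)) *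
        (\<Sum>\<pi> | partition_on (B - S) \<pi>. if card \<pi> = m then \<Prod>V\<in>\<pi>. b (card V) else 0))"
      unfolding sum_distrib_left
    proof (intro sum.cong refl)
      fix S \<pi> assume S: "S \<in> Pow B" and "\<pi> \<in> {\<pi>. partition_on (B - S) \<pi>}"
      then have \<pi>: "partition_on (B - S) \<pi>" by simp
      have "finite \<pi>" using \<pi> finB finite_elements by blast
      moreover have "insert a S \<notin> \<pi>" using \<pi> A(2) by (auto simp: partition_on_def)
      moreover have "card (insert a S) = Suc (card S)"
        using S A(2) finB by (subst card_insert_disjoint) (auto intro: finite_subset)
      ultimately show "(if card (insert (insert a S) \<pi>) = Suc m
          then \<Prod>V\<in>insert (insert a S) \<pi>. b (card V) else 0) =
          b (Suc (card S)) * (if card \<pi> = m then \<Prod>V\<in>\<pi>. b (card V) else 0)" by simp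
    qed
    also have "\<dots> = (\<Sum>S\<in>Pow B. b (Suc (card S)) *
        (fact (n - card S) * fps_nth (\<beta> ^ m) (n - card S) / fact m))"
    proof (intro sum.cong refl)
      fix S assume "S \<in> Pow B"
      then have "finite S" "card (B - S) = n - card S"
        using finB by (auto intro: finite_subset simp: n_def intro!: card_Diff_subset)
      then show "b (Suc (card S)) *
        (\<Sum>\<pi> | partition_on (B - S) \<pi>. if card \<pi> = m then \<Prod>V\<in>\<pi>. b (card V) else 0) =
        b (Suc (card S)) * (fact (n - card S) * fps_nth (\<beta> ^ m) (n - card S) / fact m)"
        using Suc.IH[of "B - S"] finB by simp
    qed
    also have "\<dots> = (\<Sum>k\<le>n. of_nat (n choose k) * (b (Suc k) *
        (fact (n - k) * fps_nth (\<beta> ^ m) (n - k) / fact m)))"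
      unfolding n_def by (rule sum_Pow_card[OF finB])
    also have "\<dots> = (\<Sum>k\<le>n. fact n / fact m * (fps_nth (fps_deriv \<beta>) k * fps_nth (\<beta> ^ m) (n - k)))"
    proof (intro sum.cong refl)
      fix k assume "k \<in> {..n}"
      moreover have "of_nat (k + 1) * (b (k + 1) / fact (k + 1)) = b (Suc k) / fact k"
        by (simp add: divide_simps del: of_nat_Suc)
      ultimately show "of_nat (n choose k) * (b (Suc k) *
          (fact (n - k) * fps_nth (\<beta> ^ m) (n - k) / fact m)) =
          fact n / fact m * (fps_nth (fps_deriv \<beta>) k * fps_nth (\<beta> ^ m) (n - k))"
        by (simp add: binomial_fact \<beta>_def del: of_nat_Suc fact_Suc)
    qed
    also have "\<dots> = fact n / fact m * fps_nth (fps_deriv \<beta> * \<beta> ^ m) n"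
      by (simp add: sum_distrib_left fps_mult_nth atLeast0AtMost)
    also have "fps_deriv \<beta> * \<beta> ^ m = fps_const (1 / of_nat (Suc m)) * fps_deriv (\<beta> ^ Suc m)"
      unfolding fps_deriv_power diff_Suc_1
      by (simp only: mult.assoc[symmetric] fps_of_nat[symmetric] fps_const_mult) (simp del: of_nat_Suc)
    also have "fact n / fact m * fps_nth (fps_const (1 / of_nat (Suc m)) * fps_deriv (\<beta> ^ Suc m)) n =
        fact (card A) * fps_nth (\<beta> ^ Suc m) (card A) / fact (Suc m)"
      using A finB by (simp add: n_def mult_ac del: power_Suc of_nat_Suc)
    finally show ?thesis .
  qed
qed

lemma card_partition_on_le:
  assumes "finite A" "partition_on A \<pi>"
  shows "card \<pi> \<le> card A"
proof -
  have fin: "finite V" "V \<noteq> {}" if "V \<in> \<pi>" for V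
    using assms that by (auto simp: partition_on_def intro: finite_subset)
  have "card \<pi> = (\<Sum>V\<in>\<pi>. 1)" by simp
  also have "\<dots> \<le> (\<Sum>V\<in>\<pi>. card V)"
    using fin by (intro sum_mono) (simp add: Suc_le_eq card_gt_0_iff)
  also have "\<dots> = card (\<Union>\<pi>)"
    using fin partition_onD2[OF assms(2)]
    by (intro card_Union_disjoint[symmetric]) (auto simp: disjoint_def pairwise_def disjnt_def)
  finally show ?thesis using partition_onD1[OF assms(2)] by simp
qed

text \<open>The weighted partition sums are the Taylor coefficients of \<open>- ln (1 + \<beta>)\<close>.\<close>

lemma partition_cumulant_recursion:
  fixes b :: "nat \<Rightarrow> complex" and n :: nat
  defines "B \<equiv> \<lambda>k. if k = 0 then 1 else b k / fact k"
  assumes "n \<ge> 1"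
  shows "of_nat n * B n = - (\<Sum>j=1..n.
    (\<Sum>\<pi> | partition_on {1..j} \<pi>. (-1) ^ card \<pi> * fact (card \<pi> - 1) * (\<Prod>V\<in>\<pi>. b (card V)))
      / fact (j - 1) * B (n - j))"
proof -
  define \<beta> where "\<beta> = Abs_fps (\<lambda>k. if k = 0 then 0 else b k / fact k)"
  define S where "S = (\<lambda>j::nat. \<Sum>\<pi> | partition_on {1..j} \<pi>.
    (-1) ^ card \<pi> * fact (card \<pi> - 1) * (\<Prod>V\<in>\<pi>. b (card V)))"
  define L where "L = fps_ln 1 oo \<beta>"
  have \<beta>0: "\<beta> $ 0 = 0" by (simp add: \<beta>_def)
  have S: "S j = - fact j * L $ j" if "j \<ge> 1" for j
  proof -
    let ?P = "{\<pi>. partition_on {1..j} \<pi>}"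
    have "S j = (\<Sum>\<pi>\<in>?P. \<Sum>m\<le>j. if card \<pi> = m then
        (-1) ^ m * fact (m - 1) * (\<Prod>V\<in>\<pi>. b (card V)) else 0)"
      unfolding S_def
      using card_partition_on_le[of "{1..j}"] by (intro sum.cong) auto
    also have "\<dots> = (\<Sum>m\<le>j. \<Sum>\<pi>\<in>?P. if card \<pi> = m then
        (-1) ^ m * fact (m - 1) * (\<Prod>V\<in>\<pi>. b (card V)) else 0)"
      by (rule sum.swap)
    also have "\<dots> = (\<Sum>m\<le>j. (-1) ^ m * fact (m - 1) *
        (\<Sum>\<pi>\<in>?P. if card \<pi> = m then \<Prod>V\<in>\<pi>. b (card V) else 0))"
      unfolding sum_distrib_left by (intro sum.cong) auto
    also have "\<dots> = (\<Sum>m\<le>j. (-1) ^ m * fact (m - 1) * (fact j * fps_nth (\<beta> ^ m) j / fact m))"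
      using sum_partition_on_prod_card[of "{1..j}" _ b] unfolding \<beta>_def by simp
    \<comment> \<open>The factors \<open>fact (m - 1) / fact m\<close> with alternating sign are the
      coefficients of \<open>ln (1 + X)\<close>. At \<open>m = 0\<close> the left side is
      \<open>fact j\<close> times the \<open>j\<close>-th coefficient of 1, which vanishes because
      \<open>j \<ge> 1\<close>.\<close>
    also have "\<dots> = (\<Sum>m\<le>j. - fact j * (fps_ln 1 $ m * fps_nth (\<beta> ^ m) j))"
    proof (intro sum.cong refl)
      fix m
      show "(-1) ^ m * fact (m - 1) * (fact j * fps_nth (\<beta> ^ m) j / fact m) =
        - fact j * (fps_ln 1 $ m * fps_nth (\<beta> ^ m) j)"
        using that by (cases m) (simp_all add: fps_ln_nth fact_Suc divide_simps del: of_nat_Suc power_Suc0_right)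
    qed
    also have "\<dots> = - fact j * L $ j"
      by (simp add: L_def fps_compose_nth sum_distrib_left atLeast0AtMost)
    finally show ?thesis .
  qed
  \<comment> \<open>The logarithmic derivative multiplied out; comparing coefficients on both sides
    is the claimed recursion.\<close>
  have L': "fps_deriv L * (1 + \<beta>) = fps_deriv \<beta>"
  proof -
    have "fps_deriv L = (inverse (1 + fps_X) oo \<beta>) * fps_deriv \<beta>"
      by (simp add: L_def fps_compose_deriv[OF \<beta>0] fps_ln_deriv)
    moreover have "(inverse (1 + fps_X) oo \<beta>) * (1 + \<beta>) = (inverse (1 + fps_X) * (1 + fps_X)) oo \<beta>"
      by (simp add: fps_compose_mult_distrib[OF \<beta>0] fps_compose_add_distrib \<beta>0)
    moreover have "inverse (1 + fps_X) * (1 + fps_X) = (1 :: complex fps)"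
      by (rule inverse_mult_eq_1) simp
    ultimately show ?thesis by (simp add: mult_ac)
  qed
  obtain m where n: "n = Suc m" using assms(2) by (cases n) auto
  have B: "B k = (1 + \<beta>) $ k" for k by (simp add: B_def \<beta>_def)
  have "of_nat n * B n = fps_deriv \<beta> $ m"
    unfolding B n by simp
  also have "\<dots> = (fps_deriv L * (1 + \<beta>)) $ m" unfolding L' ..
  also have "\<dots> = (\<Sum>i=0..m. of_nat (Suc i) * L $ Suc i * B (m - i))"
    by (simp only: fps_mult_nth B fps_deriv_nth Suc_eq_plus1)
  also have "\<dots> = (\<Sum>j=1..n. of_nat j * L $ j * B (n - j))"
    unfolding n by (rule sum.reindex_bij_witness[of _ "\<lambda>j. j - 1" Suc]) auto
  also have "\<dots> = (\<Sum>j=1..n. - (S j / fact (j - 1) * B (n - j)))"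
  proof (intro sum.cong refl)
    fix j assume "j \<in> {1..n}"
    then obtain i where "j = Suc i" by (cases j) auto
    then show "of_nat j * L $ j * B (n - j) = - (S j / fact (j - 1) * B (n - j))"
      using S[of j] by (simp add: fact_Suc del: of_nat_Suc)
  qed
  finally show ?thesis unfolding S_def by (simp add: sum_negf)
qed

lemma falling_factorial_nonzero: "k \<le> d \<Longrightarrow> falling_factorial d k \<noteq> 0"
  by (auto simp: falling_factorial_def)

section \<open>Finite free cumulants as the exponent of a differential operator\<close>

text \<open>The \<open>c k\<close> are the coefficients of the series \<open>C\<close> with
  \<open>p = C(D/d) x^d\<close>. The recursion is \<open>C' = - d K' C\<close> read off
  coefficientwise, that is, \<open>C = exp(- d K)\<close> up to the order where the cumulants are
  defined.\<close>

lemma finite_free_cumulant_recursion: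
  fixes p :: "complex poly" and d :: nat
  defines "c \<equiv> \<lambda>k. (- of_nat d) ^ k * signed_coeff p k / falling_factorial d k"
  assumes deg: "degree p = d" and monic: "lead_coeff p = 1" and k: "k \<le> d"
  shows "of_nat k * c k = - of_nat d * (\<Sum>j=1..k. finite_free_cumulant p j * c (k - j))"
proof (cases "k = 0")
  case False
  define b where "b = (\<lambda>i. fact i * signed_coeff p i / falling_factorial d i)"
  define B where "B = (\<lambda>i. if i = 0 then 1 else b i / fact i)"
  define S where "S = (\<lambda>j::nat. \<Sum>\<pi> | partition_on {1..j} \<pi>.
    (-1) ^ card \<pi> * fact (card \<pi> - 1) * (\<Prod>V\<in>\<pi>. b (card V)))"
  have d: "of_nat d \<noteq> (0::complex)" using False k by simp
  \<comment> \<open>At \<open>i = 0\<close> this says that \<open>p\<close> is monic.\<close>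
  have c: "c i = (- of_nat d) ^ i * B i" for i
    using deg monic by (simp add: c_def B_def b_def signed_coeff_def falling_factorial_def)
  have \<kappa>: "finite_free_cumulant p j = (- of_nat d) ^ j / of_nat d * (S j / fact (j - 1))" for j
    unfolding finite_free_cumulant_def S_def b_def Let_def deg
    by (simp add: prod.distrib prod_dividef mult_ac)
  have "of_nat k * c k = (- of_nat d) ^ k * (of_nat k * B k)" by (simp add: c)
  also have "\<dots> = - (\<Sum>j=1..k. (- of_nat d) ^ k * (S j / fact (j - 1) * B (k - j)))"
    using partition_cumulant_recursion[of k b] False
    unfolding B_def S_def by (simp add: sum_distrib_left)
  also have "\<dots> = - (\<Sum>j=1..k. of_nat d * (finite_free_cumulant p j * c (k - j)))"
  proof (intro arg_cong[of _ _ uminus] sum.cong refl)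
    fix j assume "j \<in> {1..k}"
    then have "(- of_nat d :: complex) ^ k = (- of_nat d) ^ j * (- of_nat d) ^ (k - j)"
      by (simp flip: power_add)
    then show "(- of_nat d) ^ k * (S j / fact (j - 1) * B (k - j)) =
        of_nat d * (finite_free_cumulant p j * c (k - j))"
      using d by (simp add: \<kappa> c)
  qed
  finally show ?thesis by (simp only: mult_minus_left sum_distrib_left sum_negf)
qed simp

section \<open>Moments of the empirical root distribution\<close>

text \<open>The derivation \<open>d/dx\<close> in the variable \<open>X = 1/x\<close>.\<close>

definition fps_deriv_inv :: "complex fps \<Rightarrow> complex fps" where
  "fps_deriv_inv f = - (fps_X ^ 2 * fps_deriv f)"

lemma fps_deriv_inv_nth: "fps_deriv_inv f $ n = - of_nat (n - 1) * f $ (n - 1)"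
proof (cases n)
  case (Suc m)
  then show ?thesis
    by (cases m) (simp_all add: fps_deriv_inv_def power2_eq_square algebra_simps)
qed (simp add: fps_deriv_inv_def)

lemma fps_deriv_inv_mult:
  "fps_deriv_inv (f * g) = fps_deriv_inv f * g + f * fps_deriv_inv g"
  by (simp add: fps_deriv_inv_def algebra_simps)

lemma fps_deriv_inv_compose:
  "g $ 0 = 0 \<Longrightarrow> fps_deriv_inv (f oo g) = (fps_deriv f oo g) * fps_deriv_inv g"
  by (simp add: fps_deriv_inv_def fps_compose_deriv mult_ac)

text \<open>With \<open>e = 1/d\<close> and \<open>F\<close> the expansion of \<open>p'/(d p)\<close> in \<open>X = 1/x\<close>, the \<open>n\<close>-th twisted power
  is the expansion of \<open>p\<^sup>(\<^sup>n\<^sup>) / (d\<^sup>n p)\<close>.\<close>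

primrec twisted_power :: "complex \<Rightarrow> complex fps \<Rightarrow> nat \<Rightarrow> complex fps" where
  "twisted_power e F 0 = 1"
| "twisted_power e F (Suc n) =
    F * twisted_power e F n + fps_const e * fps_deriv_inv (twisted_power e F n)"

text \<open>Multiplication by \<open>F\<close> and the derivation \<open>fps_deriv_inv\<close> both
  raise the order by at least one. This cuts the cumulant sum at the order of the coefficient,
  independently of \<open>d\<close>.\<close>

lemma twisted_power_nth_eq_0:
  "F $ 0 = 0 \<Longrightarrow> j < n \<Longrightarrow> twisted_power e F n $ j = 0"
proof (induction n arbitrary: j)
  case (Suc n)
  have "(F * twisted_power e F n) $ j = 0"
    unfolding fps_mult_nth
  proof (intro sum.neutral ballI)
    fix i assume "i \<in> {0..j}"
    then show "F $ i * twisted_power e F n $ (j - i) = 0"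
      using Suc by (cases "i = 0") auto
  qed
  moreover have "of_nat (j - 1) * twisted_power e F n $ (j - 1) = 0"
    using Suc by (cases j) auto
  ultimately show ?case by (simp add: fps_deriv_inv_nth)
qed simp

section \<open>Power sums of the roots and the equation for the moments at finite
  \<open>d\<close>\<close>

text \<open>Newton's identities: \<open>1/(1 - zX) = 1 + zX/(1 - zX)\<close>, and the sum of
  \<open>zX/(1 - zX)\<close> over the roots is \<open>- X P'/P\<close>. The form multiplied by
  \<open>P\<close> keeps division out of the induction.\<close>

lemma prod_mset_power_sums:
  fixes A :: "complex multiset"
  defines "P \<equiv> \<Prod>z\<in>#A. 1 - fps_const z * fps_X"
  shows "Abs_fps (\<lambda>k. \<Sum>z\<in>#A. z ^ k) * P = of_nat (size A) * P - fps_X * fps_deriv P"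
  unfolding P_def
proof (induction A)
  case empty
  show ?case by (simp add: fps_eq_iff)
next
  case (add z A)
  define P where "P = (\<Prod>z\<in>#A. 1 - fps_const z * fps_X)"
  define N where "N = Abs_fps (\<lambda>k. \<Sum>z\<in>#A. z ^ k)"
  define g where "g = Abs_fps (\<lambda>k. z ^ k)"
  have g: "g * (1 - fps_const z * fps_X) = 1"
  proof (rule fps_ext)
    fix n
    show "(g * (1 - fps_const z * fps_X)) $ n = 1 $ n"
      by (cases n) (simp_all add: g_def algebra_simps)
  qed
  have N: "Abs_fps (\<lambda>k. \<Sum>z\<in>#add_mset z A. z ^ k) = N + g"
    by (simp add: fps_eq_iff N_def g_def add.commute)
  have IH: "N * P = of_nat (size A) * P - fps_X * fps_deriv P"
    using add.IH by (simp add: N_def P_def)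
  have "(N + g) * ((1 - fps_const z * fps_X) * P) =
      (1 - fps_const z * fps_X) * (N * P) + (g * (1 - fps_const z * fps_X)) * P"
    by (simp add: algebra_simps)
  also have "\<dots> = of_nat (size (add_mset z A)) * ((1 - fps_const z * fps_X) * P) -
      fps_X * fps_deriv ((1 - fps_const z * fps_X) * P)"
    unfolding g IH by (simp add: algebra_simps)
  finally show ?case unfolding N by (simp add: P_def)
qed

lemma reflect_poly_proots:
  fixes p :: "complex poly"
  assumes "lead_coeff p = 1"
  shows "fps_of_poly (reflect_poly p) = (\<Prod>z\<in>#proots p. 1 - fps_const z * fps_X)"
proof -
  have "fps_of_poly (reflect_poly (\<Prod>z\<in>#A. [:-z, 1:])) = (\<Prod>z\<in>#A. 1 - fps_const z * fps_X)"
    for A :: "complex multiset"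
  proof (induction A)
    case (add z A)
    have "reflect_poly [:-z, 1:] = [:1, -z:]" by (simp add: reflect_poly_def)
    moreover have "fps_of_poly [:1, -z:] = 1 - fps_const z * fps_X"
      by (simp add: fps_of_poly_pCons)
    ultimately show ?case using add
      by (simp only: image_mset_add_mset prod_mset.add_mset reflect_poly_mult fps_of_poly_mult)
  qed simp
  moreover have "p = (\<Prod>z\<in>#proots p. [:-z, 1:])"
    using complex_poly_decompose_multiset[of p] assms by simp
  ultimately show ?thesis by metis
qed

text \<open>Cancellation of a unit modulo \<open>X^(d+1)\<close>, for identities that are known only
  up to order \<open>d\<close>.\<close>

lemma fps_mult_nth_eq_0_cancel:
  fixes f g :: "complex fps"
  assumes "g $ 0 = 1" "\<And>j. j \<le> d \<Longrightarrow> (f * g) $ j = 0" "j \<le> d"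
  shows "f $ j = 0"
  using assms(3)
proof (induction j rule: less_induct)
  case (less j)
  have "(f * g) $ j = (\<Sum>i\<in>{0..j} - {j}. f $ i * g $ (j - i)) + f $ j * g $ 0"
    unfolding fps_mult_nth by (simp add: sum.remove[of _ j])
  also have "(\<Sum>i\<in>{0..j} - {j}. f $ i * g $ (j - i)) = 0"
    using less by (intro sum.neutral) auto
  finally show ?case using assms(1,2) less.prems by simp
qed

text \<open>The coefficients of \<open>x p' - d p = \<Sum>\<kappa>\<^sub>n d\<^sup>1\<^sup>-\<^sup>n
  p\<^sup>(\<^sup>n\<^sup>)\<close>, written for the reversed polynomials and divided by
  \<open>d p\<close>. On the left, \<open>x p' / (d p)\<close> is the moment series.\<close>

lemma finite_free_moment_equation:
  fixes p :: "complex poly" and d :: nat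
  defines "M \<equiv> Abs_fps (root_moment p)"
  assumes deg: "degree p = d" and monic: "lead_coeff p = 1" and d: "d \<ge> 1" and j: "j \<le> d"
  shows "root_moment p j = (if j = 0 then 1 else 0) +
    (\<Sum>n=1..d. finite_free_cumulant p n * twisted_power (1 / of_nat d) (fps_X * M) n $ j)"
proof -
  define E where "E = fps_of_poly (reflect_poly p)"
  define c where "c = (\<lambda>k. (- of_nat d) ^ k * signed_coeff p k / falling_factorial d k)"
  define t :: "nat \<Rightarrow> complex" where "t = (\<lambda>j. falling_factorial d j / of_nat d ^ j)"
  define e where "e = 1 / (of_nat d :: complex)"
  \<comment> \<open>\<open>r n\<close> is the reversal of \<open>p\<^sup>(\<^sup>n\<^sup>) / d\<^sup>n\<close>\<close>
  define r where "r = (\<lambda>n. Abs_fps (\<lambda>j. if n \<le> j then t j * c (j - n) else 0))"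
  have d0: "of_nat d \<noteq> (0::complex)" using d by simp
  have c0: "c 0 = 1" using deg monic by (simp add: c_def signed_coeff_def falling_factorial_def)
  have t_Suc: "t (Suc i) = (1 - of_nat i / of_nat d) * t i" for i
    using d0 by (simp add: t_def falling_factorial_def field_simps)
  have r0: "r 0 = E"
  proof (rule fps_ext)
    fix j
    have "t j * c j = coeff (reflect_poly p) j"
    proof (cases "j \<le> d")
      case True
      have "(- of_nat d :: complex) ^ j = (-1) ^ j * of_nat d ^ j"
        by (metis mult_minus1 power_mult_distrib)
      then have "t j * c j = (-1) ^ j * signed_coeff p j"
        using falling_factorial_nonzero[OF True] d0 by (simp add: t_def c_def)
      also have "\<dots> = coeff p (d - j)"
        by (simp add: signed_coeff_def deg flip: mult.assoc power_mult_distrib)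
      finally show ?thesis using True by (simp add: coeff_reflect_poly deg)
    next
      case False
      \<comment> \<open>Beyond \<open>d\<close> the factor \<open>t j\<close> vanishes, so the value
        that division by zero gives to \<open>c j\<close> is irrelevant.\<close>
      then have "falling_factorial d j = 0" by (auto simp: falling_factorial_def)
      then show ?thesis using False by (simp add: t_def coeff_reflect_poly deg)
    qed
    then show "r 0 $ j = E $ j" by (simp add: r_def E_def)
  qed
  have E0: "E $ 0 = 1" using monic by (simp add: E_def)
  \<comment> \<open>Differentiating \<open>x^d r(1/x)\<close>: the power \<open>x^d\<close>
    contributes \<open>d X r\<close>, the chain rule contributes \<open>fps_deriv_inv r\<close>, and
    the result is divided by \<open>d\<close>.\<close>
  have r_Suc: "r (Suc n) = fps_X * r n + fps_const e * fps_deriv_inv (r n)" for n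
  proof (rule fps_ext)
    fix j
    show "r (Suc n) $ j = (fps_X * r n + fps_const e * fps_deriv_inv (r n)) $ j"
      by (cases j) (simp_all add: r_def fps_deriv_inv_nth t_Suc e_def algebra_simps)
  qed
  have ME: "M * E = E - fps_const e * (fps_X * fps_deriv E)"
  proof -
    define N where "N = Abs_fps (\<lambda>k. \<Sum>z\<in>#proots p. z ^ k)"
    have "M = fps_const e * N"
      by (simp add: N_def M_def fps_eq_iff root_moment_def e_def deg)
    moreover have "N * E = of_nat d * E - fps_X * fps_deriv E"
      unfolding N_def E_def reflect_poly_proots[OF monic]
      using prod_mset_power_sums[of "proots p"] deg by (simp add: size_proots_complex)
    ultimately have "M * E = (fps_const e * of_nat d) * E - fps_const e * (fps_X * fps_deriv E)"
      by (simp add: mult.assoc right_diff_distrib)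
    also have "fps_const e * of_nat d = 1"
      using d0 by (simp add: e_def flip: fps_of_nat)
    finally show ?thesis by simp
  qed
  let ?F = "fps_X * M"
  have FE: "?F * E = fps_X * E + fps_const e * fps_deriv_inv E"
    unfolding mult.assoc ME by (simp add: fps_deriv_inv_def algebra_simps power2_eq_square)
  \<comment> \<open>Product rule for \<open>Q E\<close>: the derivative of \<open>E\<close> is
    absorbed by \<open>FE\<close>, and what remains is the recursion defining
    \<open>twisted_power\<close>.\<close>
  have rQ: "r n = twisted_power e ?F n * E" for n
  proof (induction n)
    case (Suc n)
    let ?Q = "twisted_power e ?F n"
    have "r (Suc n) = ?Q * (fps_X * E + fps_const e * fps_deriv_inv E) +
        fps_const e * fps_deriv_inv ?Q * E"
      unfolding r_Suc Suc fps_deriv_inv_mult by (simp add: algebra_simps)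
    also have "\<dots> = twisted_power e ?F (Suc n) * E"
      unfolding FE[symmetric] by (simp add: algebra_simps)
    finally show ?case .
  qed (simp add: r0)
  define V where "V = (\<Sum>n=1..d. fps_const (finite_free_cumulant p n) * twisted_power e ?F n)"
  \<comment> \<open>The recursion for \<open>c\<close> multiplied by \<open>t j\<close>. By
    \<open>ME\<close> the series \<open>M - 1\<close> times \<open>E\<close> has the same
    coefficients; agreement is known for \<open>j \<le> d\<close>, whence the truncated cancellation
    below.\<close>
  have VE: "(V * E) $ j = - (of_nat j / of_nat d) * E $ j" if "j \<le> d" for j
  proof -
    have "V * E = (\<Sum>n=1..d. fps_const (finite_free_cumulant p n) * r n)"
      by (simp add: V_def sum_distrib_right rQ mult.assoc)
    then have "(V * E) $ j = (\<Sum>n=1..d. finite_free_cumulant p n * r n $ j)"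
      by (simp add: fps_sum_nth)
    also have "\<dots> = (\<Sum>n=1..j. finite_free_cumulant p n * r n $ j)"
      using that by (intro sum.mono_neutral_right) (auto simp: r_def)
    also have "\<dots> = t j * (\<Sum>n=1..j. finite_free_cumulant p n * c (j - n))"
      by (simp add: sum_distrib_left r_def mult_ac)
    also have "(\<Sum>n=1..j. finite_free_cumulant p n * c (j - n)) = - (of_nat j * c j / of_nat d)"
      using finite_free_cumulant_recursion[OF deg monic that] d0 by (simp add: c_def field_simps)
    finally show ?thesis by (simp add: r_def flip: r0)
  qed
  have "((M - 1 - V) * E) $ j = 0" if "j \<le> d" for j
    using VE[OF that] by (cases j) (simp_all add: left_diff_distrib ME e_def)
  then have "(M - 1 - V) $ j = 0"
    using fps_mult_nth_eq_0_cancel[OF E0] j by blast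
  then show ?thesis
    by (cases "j = 0") (simp_all add: V_def fps_sum_nth M_def e_def diff_eq_eq add.commute)
qed

section \<open>Non-crossing partitions\<close>

text \<open>General intervals, because cutting at an element of the first block leaves two shorter
  intervals with other starting points.\<close>

definition nc_partitions :: "nat \<Rightarrow> nat \<Rightarrow> nat set set set" where
  "nc_partitions a b = {\<pi>. partition_on {a..<b} \<pi> \<and> noncrossing \<pi>}"

text \<open>Returns \<open>a\<close> to the block that contains \<open>c\<close> and fixes every
  other block, so that it can be applied to a whole partition.\<close>

definition extend_block :: "nat \<Rightarrow> nat \<Rightarrow> nat set \<Rightarrow> nat set" where
  "extend_block a c W = (if c \<in> W then insert a W else W)"

lemma finite_nc_partitions: "finite (nc_partitions a b)"
  using finitely_many_partition_on[of "{a..<b}"] by (simp add: nc_partitions_def)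

lemma nc_partitions_block: "\<pi> \<in> nc_partitions a b \<Longrightarrow> W \<in> \<pi> \<Longrightarrow> W \<subseteq> {a..<b} \<and> W \<noteq> {}"
  by (auto simp: nc_partitions_def partition_on_def)

lemma nc_partitions_disjoint:
  "\<pi> \<in> nc_partitions a b \<Longrightarrow> V \<in> \<pi> \<Longrightarrow> W \<in> \<pi> \<Longrightarrow> x \<in> V \<Longrightarrow> x \<in> W \<Longrightarrow> V = W"
  by (auto simp: nc_partitions_def partition_on_def disjoint_def)

lemma noncrossingD:
  "noncrossing \<pi> \<Longrightarrow> V \<in> \<pi> \<Longrightarrow> W \<in> \<pi> \<Longrightarrow> V \<noteq> W \<Longrightarrow> i \<in> V \<Longrightarrow> j \<in> W \<Longrightarrow> k \<in> V \<Longrightarrow> l \<in> W \<Longrightarrow>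
    i < j \<Longrightarrow> j < k \<Longrightarrow> k < l \<Longrightarrow> False"
  unfolding noncrossing_def by blast

lemma insert_singleton_nc_partitions:
  assumes "a < b" "\<pi> \<in> nc_partitions (Suc a) b"
  shows "insert {a} \<pi> \<in> nc_partitions a b"
proof -
  have "partition_on ({Suc a..<b} \<union> {a}) (insert {a} \<pi>)"
    using assms(2) nc_partitions_block[OF assms(2)]
    by (fastforce simp: nc_partitions_def partition_on_def disjoint_def)
  moreover have "{Suc a..<b} \<union> {a} = {a..<b}" using assms(1) by auto
  moreover have "noncrossing (insert {a} \<pi>)"
    unfolding noncrossing_def
  proof (intro ballI impI notI)
    fix V W assume VW: "V \<in> insert {a} \<pi>" "W \<in> insert {a} \<pi>" "V \<noteq> W"
      "\<exists>i\<in>V. \<exists>j\<in>W. \<exists>k\<in>V. \<exists>l\<in>W. i < j \<and> j < k \<and> k < l"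
    then obtain i j k l where ijkl: "i \<in> V" "j \<in> W" "k \<in> V" "l \<in> W" "i < j" "j < k" "k < l"
      by blast
    then have "V \<noteq> {a}" "W \<noteq> {a}" by auto
    then have "V \<in> \<pi>" "W \<in> \<pi>" using VW by auto
    then show False
      using noncrossingD[of \<pi> V W i j k l] VW(3) assms(2) ijkl by (simp add: nc_partitions_def)
  qed
  ultimately show ?thesis by (simp add: nc_partitions_def)
qed

text \<open>The blocks of \<open>\<pi>\<^sub>1\<close> lie strictly between \<open>a\<close> and
  \<open>c\<close> and all others avoid that gap, so blocks from different sides cannot cross. A
  crossing through the added \<open>a\<close> yields one through \<open>c\<close> inside
  \<open>\<pi>\<^sub>2\<close>.\<close>

lemma join_nc_partitions:
  assumes c: "a < c" "c < b" and \<pi>: "\<pi>\<^sub>1 \<in> nc_partitions (Suc a) c" "\<pi>\<^sub>2 \<in> nc_partitions c b"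
  shows "\<pi>\<^sub>1 \<union> extend_block a c ` \<pi>\<^sub>2 \<in> nc_partitions a b"
proof -
  let ?\<tau> = "extend_block a c"
  have lo: "a < x \<and> x < c" if "W \<in> \<pi>\<^sub>1" "x \<in> W" for W x
    using nc_partitions_block[OF \<pi>(1) that(1)] that(2) by auto
  have hi: "c \<le> x \<and> x < b" if "W \<in> \<pi>\<^sub>2" "x \<in> W" for W x
    using nc_partitions_block[OF \<pi>(2) that(1)] that(2) by auto
  have ext: "x = a \<and> c \<in> W \<or> c \<le> x \<and> x \<in> W" if "W \<in> \<pi>\<^sub>2" "x \<in> ?\<tau> W" for W x
    using that hi by (auto simp: extend_block_def split: if_splits)
  have U1: "\<Union>\<pi>\<^sub>1 = {Suc a..<c}" and U2: "\<Union>\<pi>\<^sub>2 = {c..<b}"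
    using \<pi> by (auto simp: nc_partitions_def partition_on_def)
  have "\<Union>(?\<tau> ` \<pi>\<^sub>2) = insert a (\<Union>\<pi>\<^sub>2)"
  proof -
    have "c \<in> \<Union>\<pi>\<^sub>2" using U2 c by simp
    then obtain W where "W \<in> \<pi>\<^sub>2" "c \<in> W" by auto
    then have a: "a \<in> \<Union>(?\<tau> ` \<pi>\<^sub>2)" by (auto simp: extend_block_def)
    have sub: "W' \<subseteq> ?\<tau> W'" "?\<tau> W' \<subseteq> insert a W'" for W'
      by (auto simp: extend_block_def)
    show ?thesis
    proof (rule equalityI)
      show "\<Union>(?\<tau> ` \<pi>\<^sub>2) \<subseteq> insert a (\<Union>\<pi>\<^sub>2)"
        using sub(2) by (intro Union_least) blast
      have "\<Union>\<pi>\<^sub>2 \<subseteq> \<Union>(?\<tau> ` \<pi>\<^sub>2)"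
        using sub(1) by (intro Union_least) blast
      with a show "insert a (\<Union>\<pi>\<^sub>2) \<subseteq> \<Union>(?\<tau> ` \<pi>\<^sub>2)" by simp
    qed
  qed
  then have "\<Union>(\<pi>\<^sub>1 \<union> ?\<tau> ` \<pi>\<^sub>2) = {a..<b}" using U1 U2 c by auto
  moreover have "{} \<notin> \<pi>\<^sub>1 \<union> ?\<tau> ` \<pi>\<^sub>2"
    using nc_partitions_block[OF \<pi>(1)] nc_partitions_block[OF \<pi>(2)]
    by (auto simp: extend_block_def split: if_splits)
  moreover have same: "V = W" if VW: "V \<in> \<pi>\<^sub>1 \<union> ?\<tau> ` \<pi>\<^sub>2" "W \<in> \<pi>\<^sub>1 \<union> ?\<tau> ` \<pi>\<^sub>2" "x \<in> V" "x \<in> W" for V W x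
  proof -
    consider "V \<in> \<pi>\<^sub>1" "W \<in> \<pi>\<^sub>1" | V' where "V = ?\<tau> V'" "V' \<in> \<pi>\<^sub>2" "W \<in> \<pi>\<^sub>1"
      | W' where "W = ?\<tau> W'" "W' \<in> \<pi>\<^sub>2" "V \<in> \<pi>\<^sub>1"
      | V' W' where "V = ?\<tau> V'" "V' \<in> \<pi>\<^sub>2" "W = ?\<tau> W'" "W' \<in> \<pi>\<^sub>2"
      using VW(1,2) by blast
    then show ?thesis
    proof cases
      case 1
      then show ?thesis using nc_partitions_disjoint[OF \<pi>(1)] VW by blast
    next
      case 2
      then show ?thesis using ext[of V' x] lo[of W x] VW by auto
    next
      case 3
      then show ?thesis using ext[of W' x] lo[of V x] VW by auto
    next
      case 4
      then have "V' = W'"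
        using ext[of V' x] ext[of W' x] VW c nc_partitions_disjoint[OF \<pi>(2), of V' W'] by auto
      then show ?thesis using 4 by simp
    qed
  qed
  then have "disjoint (\<pi>\<^sub>1 \<union> ?\<tau> ` \<pi>\<^sub>2)" unfolding disjoint_def by blast
  ultimately have "partition_on {a..<b} (\<pi>\<^sub>1 \<union> ?\<tau> ` \<pi>\<^sub>2)" by (simp add: partition_on_def)
  moreover have "noncrossing (\<pi>\<^sub>1 \<union> ?\<tau> ` \<pi>\<^sub>2)"
    unfolding noncrossing_def
  proof (intro ballI impI notI)
    fix V W assume VW: "V \<in> \<pi>\<^sub>1 \<union> ?\<tau> ` \<pi>\<^sub>2" "W \<in> \<pi>\<^sub>1 \<union> ?\<tau> ` \<pi>\<^sub>2" "V \<noteq> W"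
      "\<exists>i\<in>V. \<exists>j\<in>W. \<exists>k\<in>V. \<exists>l\<in>W. i < j \<and> j < k \<and> k < l"
    then obtain i j k l where ijkl: "i \<in> V" "j \<in> W" "k \<in> V" "l \<in> W" "i < j" "j < k" "k < l"
      by blast
    consider "V \<in> \<pi>\<^sub>1" "W \<in> \<pi>\<^sub>1" | V' where "V = ?\<tau> V'" "V' \<in> \<pi>\<^sub>2" "W \<in> \<pi>\<^sub>1"
      | W' where "W = ?\<tau> W'" "W' \<in> \<pi>\<^sub>2" "V \<in> \<pi>\<^sub>1"
      | V' W' where "V = ?\<tau> V'" "V' \<in> \<pi>\<^sub>2" "W = ?\<tau> W'" "W' \<in> \<pi>\<^sub>2"
      using VW(1,2) by blast
    then show False
    proof cases
      case 1
      then show ?thesis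
        using noncrossingD[of \<pi>\<^sub>1 V W i j k l] \<pi>(1) VW(3) ijkl by (auto simp: nc_partitions_def)
    next
      case 2
      then show ?thesis using ext[of V' k] lo[of W j] lo[of W l] ijkl by auto
    next
      case 3
      then show ?thesis using ext[of W' j] lo[of V i] lo[of V k] ijkl by auto
    next
      case 4
      then have ne: "V' \<noteq> W'" using VW(3) by auto
      have ai: "a \<le> i" using ext[of V' i] 4 ijkl c by auto
      have j: "j \<in> W'" "c \<le> j" and k: "k \<in> V'" and l: "l \<in> W'"
        using ext[of W' j] ext[of V' k] ext[of W' l] 4 ijkl ai by auto
      \<comment> \<open>If the crossing starts at the added \<open>a\<close>, then \<open>c\<close>
        takes its place; \<open>c < j\<close> holds because \<open>c\<close> and \<open>j\<close>
        lie in different blocks.\<close>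
      obtain i' where "i' \<in> V'" "i' < j"
      proof (cases "i = a \<and> c \<in> V'")
        case True
        moreover have "j \<noteq> c"
          using nc_partitions_disjoint[OF \<pi>(2), of V' W' c] 4 True j ne by auto
        ultimately show ?thesis using that[of c] j by auto
      next
        case False
        then show ?thesis using that[of i] ext[of V' i] 4 ijkl by auto
      qed
      then show ?thesis
        using noncrossingD[of \<pi>\<^sub>2 V' W' i' j k l] \<pi>(2) ne 4 j k l ijkl
        by (auto simp: nc_partitions_def)
    qed
  qed
  ultimately show ?thesis by (simp add: nc_partitions_def)
qed

text \<open>In the second case \<open>c\<close> is the second smallest element of the block of
  \<open>a\<close>. That block contains \<open>a\<close> and \<open>c\<close>, so no other block can
  meet both the gap between them and the part from \<open>c\<close> on.\<close>

lemma nc_partitions_cases: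
  assumes "a < b" "\<pi> \<in> nc_partitions a b"
  obtains (singleton) \<pi>' where "\<pi>' \<in> nc_partitions (Suc a) b" "\<pi> = insert {a} \<pi>'"
  | (join) c \<pi>\<^sub>1 \<pi>\<^sub>2 where "a < c" "c < b" "\<pi>\<^sub>1 \<in> nc_partitions (Suc a) c" "\<pi>\<^sub>2 \<in> nc_partitions c b"
      "\<pi> = \<pi>\<^sub>1 \<union> extend_block a c ` \<pi>\<^sub>2"
proof -
  have U: "\<Union>\<pi> = {a..<b}" and nc: "noncrossing \<pi>" and ne: "{} \<notin> \<pi>"
    using assms(2) by (auto simp: nc_partitions_def partition_on_def)
  note disj = nc_partitions_disjoint[OF assms(2)]
  have "disjoint \<pi>" using assms(2) by (simp add: nc_partitions_def partition_on_def)
  then have disj_sub: "disjoint \<rho>" if "\<rho> \<subseteq> \<pi>" for \<rho>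
    using that by (auto simp: disjoint_def)
  have bd: "a \<le> x \<and> x < b" if "W \<in> \<pi>" "x \<in> W" for W x
    using nc_partitions_block[OF assms(2) that(1)] that(2) by auto
  have "a \<in> \<Union>\<pi>" using U assms(1) by simp
  then obtain V where V: "V \<in> \<pi>" "a \<in> V" by auto
  have ncsub: "noncrossing (f ` \<rho>)" if "\<rho> \<subseteq> \<pi>" "\<And>W. f W \<subseteq> W" for f \<rho>
    unfolding noncrossing_def
  proof (intro ballI impI notI)
    fix A B assume "A \<in> f ` \<rho>" "B \<in> f ` \<rho>" "A \<noteq> B"
      "\<exists>i\<in>A. \<exists>j\<in>B. \<exists>k\<in>A. \<exists>l\<in>B. i < j \<and> j < k \<and> k < l"
    then obtain A' B' i j k l where "A' \<in> \<rho>" "B' \<in> \<rho>" "A' \<noteq> B'" "i \<in> f A'" "j \<in> f B'" "k \<in> f A'"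
      "l \<in> f B'" "i < j" "j < k" "k < l" by blast
    then show False
      using noncrossingD[OF nc, of A' B' i j k l] that by blast
  qed
  show ?thesis
  proof (cases "V = {a}")
    case True
    have "\<Union>(\<pi> - {V}) = {Suc a..<b}"
    proof (intro equalityI subsetI)
      fix x assume "x \<in> \<Union>(\<pi> - {V})"
      then obtain W where W: "W \<in> \<pi>" "W \<noteq> V" "x \<in> W" by auto
      then have "x \<noteq> a" using disj V by blast
      then show "x \<in> {Suc a..<b}" using bd[OF W(1,3)] by auto
    next
      fix x assume x: "x \<in> {Suc a..<b}"
      then have "x \<in> \<Union>\<pi>" using U by simp
      then obtain W where "W \<in> \<pi>" "x \<in> W" by auto
      moreover have "x \<notin> V" using x True by simp
      ultimately show "x \<in> \<Union>(\<pi> - {V})" by auto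
    qed
    then have "\<pi> - {V} \<in> nc_partitions (Suc a) b"
      using ne ncsub[of "\<pi> - {V}" "\<lambda>W. W"] disj_sub[of "\<pi> - {V}"]
      by (auto simp: nc_partitions_def partition_on_def)
    moreover have "\<pi> = insert {a} (\<pi> - {V})" using True V by auto
    ultimately show ?thesis by (rule singleton)
  next
    case False
    define c where "c = Min (V - {a})"
    have "finite V" using bd[OF V(1)] by (meson bounded_nat_set_is_finite)
    moreover have "V - {a} \<noteq> {}" using False V by auto
    ultimately have cV: "c \<in> V - {a}" and cmin: "\<And>x. x \<in> V - {a} \<Longrightarrow> c \<le> x"
      unfolding c_def using Min_in[of "V - {a}"] Min_le[of "V - {a}"] by auto
    have c: "a < c" "c < b" using bd[OF V(1), of c] cV by auto
    define \<pi>\<^sub>1 where "\<pi>\<^sub>1 = {W \<in> \<pi>. W \<subseteq> {a<..<c}}"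
    define \<pi>\<^sub>2 where "\<pi>\<^sub>2 = (\<lambda>W. W - {a}) ` (\<pi> - \<pi>\<^sub>1)"
    \<comment> \<open>With \<open>x < c < y\<close> in \<open>W\<close>, the points
      \<open>a < x < c < y\<close> would be a crossing of \<open>V\<close> and
      \<open>W\<close>.\<close>
    have split: "W \<in> \<pi>\<^sub>1 \<or> (\<forall>x\<in>W. c \<le> x)" if W: "W \<in> \<pi>" "W \<noteq> V" for W
    proof (rule disjCI)
      assume "\<not> (\<forall>x\<in>W. c \<le> x)"
      then obtain x where x: "x \<in> W" "x < c" by auto
      have aW: "a \<notin> W" and cW: "c \<notin> W" using disj W V cV by blast+
      have "y < c" if "y \<in> W" for y
      proof (rule ccontr)
        assume "\<not> y < c"
        moreover have "y \<noteq> c" using that cW by auto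
        moreover have "a < x" using bd[OF W(1) x(1)] aW x(1) by (cases "x = a") auto
        ultimately show False
          using noncrossingD[OF nc V(1) W(1) W(2)[symmetric] V(2) x(1), of c y] cV x that by auto
      qed
      moreover have "a < y" if "y \<in> W" for y
        using bd[OF W(1) that] aW that by (cases "y = a") auto
      ultimately show "W \<in> \<pi>\<^sub>1" using W(1) by (auto simp: \<pi>\<^sub>1_def)
    qed
    have V1: "V \<notin> \<pi>\<^sub>1" using V by (auto simp: \<pi>\<^sub>1_def)
    have rest: "(\<lambda>W. W - {a}) W = W \<and> c \<notin> W \<and> a \<notin> W" if "W \<in> \<pi> - \<pi>\<^sub>1" "W \<noteq> V" for W
      using disj[of W V] that V cV by auto
    have ge: "c \<le> x" if "W \<in> \<pi> - \<pi>\<^sub>1" "x \<in> W" "x \<noteq> a" for W x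
      using split[of W] cmin[of x] that by (cases "W = V") auto
    have \<pi>\<^sub>1: "\<pi>\<^sub>1 \<in> nc_partitions (Suc a) c"
    proof -
      have "\<Union>\<pi>\<^sub>1 = {Suc a..<c}"
      proof (intro equalityI subsetI)
        fix x assume x: "x \<in> {Suc a..<c}"
        then have "x \<in> \<Union>\<pi>" using U c by simp
        then obtain W where "W \<in> \<pi>" "x \<in> W" by auto
        then show "x \<in> \<Union>\<pi>\<^sub>1" using ge[of W x] x by (cases "W \<in> \<pi>\<^sub>1") auto
      qed (auto simp: \<pi>\<^sub>1_def)
      moreover have "\<pi>\<^sub>1 \<subseteq> \<pi>" by (auto simp: \<pi>\<^sub>1_def)
      ultimately show ?thesis
        using ne ncsub[of \<pi>\<^sub>1 "\<lambda>W. W"] disj_sub[of \<pi>\<^sub>1]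
        by (auto simp: nc_partitions_def partition_on_def)
    qed
    have \<pi>\<^sub>2: "\<pi>\<^sub>2 \<in> nc_partitions c b"
    proof -
      have "\<Union>\<pi>\<^sub>2 = {c..<b}"
      proof (intro equalityI subsetI)
        fix x assume "x \<in> \<Union>\<pi>\<^sub>2"
        then obtain W where "W \<in> \<pi> - \<pi>\<^sub>1" "x \<in> W" "x \<noteq> a" by (auto simp: \<pi>\<^sub>2_def)
        then show "x \<in> {c..<b}" using ge[of W x] bd[of W x] by auto
      next
        fix x assume x: "x \<in> {c..<b}"
        then have "x \<in> \<Union>\<pi>" using U c by simp
        then obtain W where "W \<in> \<pi>" "x \<in> W" by auto
        moreover have "W \<notin> \<pi>\<^sub>1" using calculation x by (auto simp: \<pi>\<^sub>1_def)
        ultimately show "x \<in> \<Union>\<pi>\<^sub>2" using x c by (auto simp: \<pi>\<^sub>2_def)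
      qed
      moreover have "{} \<notin> \<pi>\<^sub>2"
      proof
        assume "{} \<in> \<pi>\<^sub>2"
        then obtain W where W: "W \<in> \<pi> - \<pi>\<^sub>1" "W - {a} = {}" by (auto simp: \<pi>\<^sub>2_def)
        then show False using rest[of W] ne cV by (cases "W = V") auto
      qed
      moreover have "noncrossing \<pi>\<^sub>2"
        unfolding \<pi>\<^sub>2_def by (rule ncsub) auto
      moreover have "disjoint \<pi>\<^sub>2"
        unfolding disjoint_def
      proof (intro ballI impI)
        fix A B assume "A \<in> \<pi>\<^sub>2" "B \<in> \<pi>\<^sub>2" "A \<noteq> B"
        then obtain A' B' where "A' \<in> \<pi>" "B' \<in> \<pi>" "A' \<noteq> B'" "A = A' - {a}" "B = B' - {a}"
          by (auto simp: \<pi>\<^sub>2_def)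
        then show "A \<inter> B = {}" using disj by blast
      qed
      ultimately show ?thesis by (simp add: nc_partitions_def partition_on_def)
    qed
    have id: "extend_block a c (W - {a}) = W" if "W \<in> \<pi> - \<pi>\<^sub>1" for W
    proof (cases "W = V")
      case True
      then show ?thesis using cV V by (auto simp: extend_block_def)
    next
      case False
      then show ?thesis using rest[OF that] by (auto simp: extend_block_def)
    qed
    then have "extend_block a c ` \<pi>\<^sub>2 = \<pi> - \<pi>\<^sub>1"
      unfolding \<pi>\<^sub>2_def image_image by simp
    then have "\<pi> = \<pi>\<^sub>1 \<union> extend_block a c ` \<pi>\<^sub>2" by (auto simp: \<pi>\<^sub>1_def)
    from join[OF c \<pi>\<^sub>1 \<pi>\<^sub>2 this] show ?thesis .
  qed
qed

section \<open>The recursion for free cumulants and its generating series\<close>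

text \<open>The number \<open>j\<close> counts elements already removed from the first block.
  Without this memory, removing the first element of a block would lose its size and the recursion
  would not close.\<close>

definition nc_sum :: "(nat \<Rightarrow> complex) \<Rightarrow> nat \<Rightarrow> nat \<Rightarrow> nat \<Rightarrow> complex" where
  "nc_sum \<kappa> j a b = (\<Sum>\<pi>\<in>nc_partitions a b. \<Prod>V\<in>\<pi>. \<kappa> (card V + (if a \<in> V then j else 0)))"

lemma nc_partitions_finite: "\<pi> \<in> nc_partitions a b \<Longrightarrow> finite \<pi>"
  using finite_elements[of "{a..<b}"] by (simp add: nc_partitions_def)

lemma nc_partitions_block_finite: "\<pi> \<in> nc_partitions a b \<Longrightarrow> W \<in> \<pi> \<Longrightarrow> finite W"
  using nc_partitions_block[of \<pi> a b W] finite_subset[of W "{a..<b}"] by simp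

text \<open>The pieces can be recovered from the joined partition: \<open>c\<close> is the second
  element of the block of \<open>a\<close>, \<open>\<pi>\<^sub>1\<close> consists of the blocks
  inside the gap, and \<open>\<pi>\<^sub>2\<close> is the rest with \<open>a\<close> erased.\<close>

lemma join_nc_partitions_inject:
  assumes "a < c" "a < c'"
    and "\<pi>\<^sub>1 \<in> nc_partitions (Suc a) c" "\<pi>\<^sub>2 \<in> nc_partitions c b"
    and "\<pi>\<^sub>1' \<in> nc_partitions (Suc a) c'" "\<pi>\<^sub>2' \<in> nc_partitions c' b" "c < b"
    and eq: "\<pi>\<^sub>1 \<union> extend_block a c ` \<pi>\<^sub>2 = \<pi>\<^sub>1' \<union> extend_block a c' ` \<pi>\<^sub>2'"
  shows "c = c' \<and> \<pi>\<^sub>1 = \<pi>\<^sub>1' \<and> \<pi>\<^sub>2 = \<pi>\<^sub>2'"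
proof -
  have rec: "\<pi>\<^sub>1 = {W \<in> \<pi>. W \<subseteq> {a<..<c}} \<and> \<pi>\<^sub>2 = (\<lambda>W. W - {a}) ` (\<pi> - \<pi>\<^sub>1) \<and>
      (\<forall>V\<in>\<pi>. a \<in> V \<longrightarrow> c \<in> V \<and> V \<subseteq> {a} \<union> {c..})"
    if c: "a < c" and \<pi>: "\<pi>\<^sub>1 \<in> nc_partitions (Suc a) c" "\<pi>\<^sub>2 \<in> nc_partitions c b"
      "\<pi> = \<pi>\<^sub>1 \<union> extend_block a c ` \<pi>\<^sub>2" for c \<pi>\<^sub>1 \<pi>\<^sub>2 \<pi>
  proof -
    have lo: "W \<subseteq> {a<..<c}" if "W \<in> \<pi>\<^sub>1" for W
      using nc_partitions_block[OF \<pi>(1) that] by auto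
    have hi: "W \<subseteq> {c..}" "W \<noteq> {}" if "W \<in> \<pi>\<^sub>2" for W
      using nc_partitions_block[OF \<pi>(2) that] by auto
    have not_lo: "\<not> extend_block a c W \<subseteq> {a<..<c}" if "W \<in> \<pi>\<^sub>2" for W
      using hi[OF that] by (fastforce simp: extend_block_def split: if_splits)
    then have notin: "extend_block a c W \<notin> \<pi>\<^sub>1" if "W \<in> \<pi>\<^sub>2" for W
      using lo that by blast
    have 1: "\<pi>\<^sub>1 = {W \<in> \<pi>. W \<subseteq> {a<..<c}}"
      unfolding \<pi>(3) using lo not_lo by auto
    have "\<pi> - \<pi>\<^sub>1 = extend_block a c ` \<pi>\<^sub>2"
      unfolding \<pi>(3) using notin by auto
    moreover have "extend_block a c W - {a} = W" if "W \<in> \<pi>\<^sub>2" for W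
      using hi[OF that] c by (auto simp: extend_block_def)
    ultimately have 2: "\<pi>\<^sub>2 = (\<lambda>W. W - {a}) ` (\<pi> - \<pi>\<^sub>1)"
      by (simp add: image_image)
    have 3: "c \<in> V \<and> V \<subseteq> {a} \<union> {c..}" if V: "V \<in> \<pi>" "a \<in> V" for V
    proof -
      have "a \<notin> {a<..<c}" by simp
      then have "V \<notin> \<pi>\<^sub>1" using lo[of V] V by blast
      then obtain W where "W \<in> \<pi>\<^sub>2" "V = extend_block a c W" using V \<pi>(3) by auto
      then show ?thesis using hi[of W] V c by (auto simp: extend_block_def split: if_splits)
    qed
    show ?thesis using 1 2 3 by simp
  qed
  define \<pi> where "\<pi> = \<pi>\<^sub>1 \<union> extend_block a c ` \<pi>\<^sub>2"
  have r: "\<pi>\<^sub>1 = {W \<in> \<pi>. W \<subseteq> {a<..<c}}" "\<pi>\<^sub>2 = (\<lambda>W. W - {a}) ` (\<pi> - \<pi>\<^sub>1)"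
    "\<And>V. V \<in> \<pi> \<Longrightarrow> a \<in> V \<Longrightarrow> c \<in> V \<and> V \<subseteq> {a} \<union> {c..}"
    using rec[OF assms(1,3,4) \<pi>_def] by auto
  have r': "\<pi>\<^sub>1' = {W \<in> \<pi>. W \<subseteq> {a<..<c'}}" "\<pi>\<^sub>2' = (\<lambda>W. W - {a}) ` (\<pi> - \<pi>\<^sub>1')"
    "\<And>V. V \<in> \<pi> \<Longrightarrow> a \<in> V \<Longrightarrow> c' \<in> V \<and> V \<subseteq> {a} \<union> {c'..}"
    using rec[OF assms(2,5,6) \<pi>_def[unfolded eq]] by auto
  have "\<Union>\<pi> = {a..<b}"
    using join_nc_partitions[OF assms(1,7,3,4)]
    unfolding \<pi>_def nc_partitions_def partition_on_def by simp
  then have "a \<in> \<Union>\<pi>" using assms(1,7) by simp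
  then obtain V where V: "V \<in> \<pi>" "a \<in> V" by auto
  have "c = c'" using r(3)[OF V] r'(3)[OF V] assms(1,2) by fastforce
  then show ?thesis using r(1,2) r'(1,2) by simp
qed

text \<open>Either \<open>a\<close> is a singleton, of weight \<open>\<kappa> (Suc j)\<close>, or
  \<open>c\<close> is the next element of its block. Then the gap is partitioned independently, and
  erasing \<open>a\<close> is paid for by raising \<open>j\<close> for the block of
  \<open>c\<close>.\<close>

lemma nc_sum_recursion:
  assumes "a < b"
  shows "nc_sum \<kappa> j a b = \<kappa> (Suc j) * nc_sum \<kappa> 0 (Suc a) b +
    (\<Sum>c\<in>{a<..<b}. nc_sum \<kappa> 0 (Suc a) c * nc_sum \<kappa> (Suc j) c b)"
proof -
  define w where "w = (\<lambda>V. \<kappa> (card V + (if a \<in> V then j else 0)))"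
  let ?T = "SIGMA c:{a<..<b}. nc_partitions (Suc a) c \<times> nc_partitions c b"
  let ?h = "\<lambda>(c, \<pi>\<^sub>1, \<pi>\<^sub>2). \<pi>\<^sub>1 \<union> extend_block a c ` \<pi>\<^sub>2"
  have inj1: "inj_on (insert {a}) (nc_partitions (Suc a) b)"
  proof (rule inj_onI)
    fix \<pi> \<pi>' assume \<pi>: "\<pi> \<in> nc_partitions (Suc a) b" "\<pi>' \<in> nc_partitions (Suc a) b"
      and eq: "insert {a} \<pi> = insert {a} \<pi>'"
    have "{a} \<notin> \<pi>" "{a} \<notin> \<pi>'"
      using nc_partitions_block[OF \<pi>(1)] nc_partitions_block[OF \<pi>(2)] by force+
    then show "\<pi> = \<pi>'" using eq by (simp add: insert_ident)
  qed
  have inj2: "inj_on ?h ?T"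
  proof (rule inj_onI)
    fix x y assume x: "x \<in> ?T" and y: "y \<in> ?T" and eq: "?h x = ?h y"
    obtain c \<pi>\<^sub>1 \<pi>\<^sub>2 c' \<pi>\<^sub>1' \<pi>\<^sub>2' where xy: "x = (c, \<pi>\<^sub>1, \<pi>\<^sub>2)" "y = (c', \<pi>\<^sub>1', \<pi>\<^sub>2')" by (metis prod_cases3)
    show "x = y"
      using join_nc_partitions_inject[of a c c' \<pi>\<^sub>1 \<pi>\<^sub>2 b \<pi>\<^sub>1' \<pi>\<^sub>2'] x y eq unfolding xy by simp
  qed
  have split: "nc_partitions a b = insert {a} ` nc_partitions (Suc a) b \<union> ?h ` ?T"
  proof (intro equalityI subsetI)
    fix \<pi> assume "\<pi> \<in> nc_partitions a b"
    with assms show "\<pi> \<in> insert {a} ` nc_partitions (Suc a) b \<union> ?h ` ?T"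
    proof (cases rule: nc_partitions_cases)
      case (join c \<pi>\<^sub>1 \<pi>\<^sub>2)
      then have "\<pi> = ?h (c, \<pi>\<^sub>1, \<pi>\<^sub>2)" "(c, \<pi>\<^sub>1, \<pi>\<^sub>2) \<in> ?T" by auto
      then show ?thesis by blast
    qed simp
  next
    fix \<pi> assume "\<pi> \<in> insert {a} ` nc_partitions (Suc a) b \<union> ?h ` ?T"
    then show "\<pi> \<in> nc_partitions a b"
      using insert_singleton_nc_partitions[OF assms] join_nc_partitions by auto
  qed
  have "insert {a} ` nc_partitions (Suc a) b \<inter> ?h ` ?T = {}"
  proof -
    have "{a} \<notin> ?h x" if "x \<in> ?T" for x
    proof -
      obtain c \<pi>\<^sub>1 \<pi>\<^sub>2 where x: "x = (c, \<pi>\<^sub>1, \<pi>\<^sub>2)" by (metis prod_cases3)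
      have "{a} \<notin> \<pi>\<^sub>1" using nc_partitions_block[of \<pi>\<^sub>1 "Suc a" c "{a}"] that x by auto
      moreover have "{a} \<noteq> extend_block a c W" if "W \<in> \<pi>\<^sub>2" for W
        using nc_partitions_block[of \<pi>\<^sub>2 c b W] that \<open>x \<in> ?T\<close> x
        by (auto simp: extend_block_def split: if_splits)
      ultimately show ?thesis unfolding x by auto
    qed
    then have "\<pi> \<notin> ?h ` ?T" if "{a} \<in> \<pi>" for \<pi>
      using that by (metis (no_types, lifting) imageE)
    moreover have "{a} \<in> \<pi>" if "\<pi> \<in> insert {a} ` nc_partitions (Suc a) b" for \<pi>
      using that by (elim imageE) simp
    ultimately show ?thesis by (simp only: disjoint_iff) simp
  qed
  note disj = this
  have "nc_sum \<kappa> j a b = (\<Sum>\<pi>\<in>nc_partitions a b. \<Prod>V\<in>\<pi>. w V)"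
    by (simp only: nc_sum_def w_def)
  also have "\<dots> = (\<Sum>\<pi>\<in>insert {a} ` nc_partitions (Suc a) b. \<Prod>V\<in>\<pi>. w V) +
      (\<Sum>\<pi>\<in>?h ` ?T. \<Prod>V\<in>\<pi>. w V)"
    unfolding split
    by (intro sum.union_disjoint finite_imageI finite_SigmaI finite_cartesian_product disj finite_nc_partitions) simp
  also have "\<dots> = (\<Sum>\<pi>\<in>nc_partitions (Suc a) b. \<Prod>V\<in>insert {a} \<pi>. w V) +
      (\<Sum>x\<in>?T. \<Prod>V\<in>?h x. w V)"
    by (simp only: sum.reindex[OF inj1] sum.reindex[OF inj2] o_def)
  also have "(\<Sum>\<pi>\<in>nc_partitions (Suc a) b. \<Prod>V\<in>insert {a} \<pi>. w V) =
      \<kappa> (Suc j) * nc_sum \<kappa> 0 (Suc a) b"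
    unfolding nc_sum_def sum_distrib_left
  proof (intro sum.cong refl)
    fix \<pi> assume \<pi>: "\<pi> \<in> nc_partitions (Suc a) b"
    have a: "a \<notin> V" if "V \<in> \<pi>" for V using nc_partitions_block[OF \<pi> that] by auto
    then have "{a} \<notin> \<pi>" by auto
    then have "(\<Prod>V\<in>insert {a} \<pi>. w V) = w {a} * (\<Prod>V\<in>\<pi>. w V)"
      using nc_partitions_finite[OF \<pi>] by simp
    \<comment> \<open>The vacuous conditional is the summand of \<open>nc_sum\<close> at
      \<open>j = 0\<close>.\<close>
    also have "(\<Prod>V\<in>\<pi>. w V) = (\<Prod>V\<in>\<pi>. \<kappa> (card V + (if Suc a \<in> V then 0 else 0)))"
      using a by (intro prod.cong) (auto simp: w_def)
    finally show "(\<Prod>V\<in>insert {a} \<pi>. w V) =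
        \<kappa> (Suc j) * (\<Prod>V\<in>\<pi>. \<kappa> (card V + (if Suc a \<in> V then 0 else 0)))"
      by (simp add: w_def)
  qed
  also have "(\<Sum>x\<in>?T. \<Prod>V\<in>?h x. w V) = (\<Sum>c\<in>{a<..<b}. \<Sum>(\<pi>\<^sub>1, \<pi>\<^sub>2)\<in>nc_partitions (Suc a) c \<times> nc_partitions c b.
      \<Prod>V\<in>\<pi>\<^sub>1 \<union> extend_block a c ` \<pi>\<^sub>2. w V)"
    by (subst sum.Sigma) (auto simp: finite_nc_partitions case_prod_unfold)
  also have "\<dots> = (\<Sum>c\<in>{a<..<b}. nc_sum \<kappa> 0 (Suc a) c * nc_sum \<kappa> (Suc j) c b)"
  proof (intro sum.cong refl)
    fix c assume c: "c \<in> {a<..<b}"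
    have "(\<Prod>V\<in>\<pi>\<^sub>1 \<union> extend_block a c ` \<pi>\<^sub>2. w V) =
        (\<Prod>V\<in>\<pi>\<^sub>1. \<kappa> (card V + (if Suc a \<in> V then 0 else 0))) *
        (\<Prod>V\<in>\<pi>\<^sub>2. \<kappa> (card V + (if c \<in> V then Suc j else 0)))"
      if \<pi>: "\<pi>\<^sub>1 \<in> nc_partitions (Suc a) c" "\<pi>\<^sub>2 \<in> nc_partitions c b" for \<pi>\<^sub>1 \<pi>\<^sub>2
    proof -
      have lo: "V \<subseteq> {a<..<c}" "V \<noteq> {}" if "V \<in> \<pi>\<^sub>1" for V
        using nc_partitions_block[OF \<pi>(1) that] by auto
      have hi: "V \<subseteq> {c..}" "V \<noteq> {}" "finite V" if "V \<in> \<pi>\<^sub>2" for V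
        using nc_partitions_block[OF \<pi>(2) that] nc_partitions_block_finite[OF \<pi>(2) that] by auto
      have aV: "a \<notin> V" if "V \<in> \<pi>\<^sub>2" for V using hi[OF that] c by auto
      have inj: "inj_on (extend_block a c) \<pi>\<^sub>2"
      proof (rule inj_onI)
        fix V W assume VW: "V \<in> \<pi>\<^sub>2" "W \<in> \<pi>\<^sub>2" "extend_block a c V = extend_block a c W"
        then have "extend_block a c V - {a} = extend_block a c W - {a}" by simp
        moreover have "extend_block a c V - {a} = V" "extend_block a c W - {a} = W"
          using aV[OF VW(1)] aV[OF VW(2)] by (simp_all add: extend_block_def)
        ultimately show "V = W" by simp
      qed
      have "\<pi>\<^sub>1 \<inter> extend_block a c ` \<pi>\<^sub>2 = {}"
      proof -
        have "\<not> extend_block a c V \<subseteq> {a<..<c}" if "V \<in> \<pi>\<^sub>2" for V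
          using hi[OF that] by (fastforce simp: extend_block_def split: if_splits)
        then show ?thesis using lo by blast
      qed
      then have "(\<Prod>V\<in>\<pi>\<^sub>1 \<union> extend_block a c ` \<pi>\<^sub>2. w V) =
          (\<Prod>V\<in>\<pi>\<^sub>1. w V) * (\<Prod>V\<in>\<pi>\<^sub>2. w (extend_block a c V))"
        using nc_partitions_finite[OF \<pi>(1)] nc_partitions_finite[OF \<pi>(2)]
        by (subst prod.union_disjoint) (auto simp: prod.reindex[OF inj] o_def)
      also have "(\<Prod>V\<in>\<pi>\<^sub>1. w V) = (\<Prod>V\<in>\<pi>\<^sub>1. \<kappa> (card V + (if Suc a \<in> V then 0 else 0)))"
      proof (intro prod.cong refl)
        fix V assume "V \<in> \<pi>\<^sub>1"
        then have "a \<notin> V" using lo(1)[of V] by auto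
        then show "w V = \<kappa> (card V + (if Suc a \<in> V then 0 else 0))" by (simp add: w_def)
      qed
      also have "(\<Prod>V\<in>\<pi>\<^sub>2. w (extend_block a c V)) =
          (\<Prod>V\<in>\<pi>\<^sub>2. \<kappa> (card V + (if c \<in> V then Suc j else 0)))"
        using aV hi(3) by (intro prod.cong) (auto simp: w_def extend_block_def)
      finally show ?thesis .
    qed
    then have "(\<Sum>(\<pi>\<^sub>1, \<pi>\<^sub>2)\<in>nc_partitions (Suc a) c \<times> nc_partitions c b.
        \<Prod>V\<in>\<pi>\<^sub>1 \<union> extend_block a c ` \<pi>\<^sub>2. w V) =
        (\<Sum>(\<pi>\<^sub>1, \<pi>\<^sub>2)\<in>nc_partitions (Suc a) c \<times> nc_partitions c b.
        (\<Prod>V\<in>\<pi>\<^sub>1. \<kappa> (card V + (if Suc a \<in> V then 0 else 0))) *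
        (\<Prod>V\<in>\<pi>\<^sub>2. \<kappa> (card V + (if c \<in> V then Suc j else 0))))"
      by (intro sum.cong) auto
    also have "\<dots> = nc_sum \<kappa> 0 (Suc a) c * nc_sum \<kappa> (Suc j) c b"
      unfolding nc_sum_def sum_product sum.cartesian_product ..
    finally show "(\<Sum>(\<pi>\<^sub>1, \<pi>\<^sub>2)\<in>nc_partitions (Suc a) c \<times> nc_partitions c b.
        \<Prod>V\<in>\<pi>\<^sub>1 \<union> extend_block a c ` \<pi>\<^sub>2. w V) = nc_sum \<kappa> 0 (Suc a) c * nc_sum \<kappa> (Suc j) c b" .
  qed
  finally show ?thesis .
qed

lemma nc_sum_empty: "nc_sum \<kappa> j a a = 1"
proof -
  have "nc_partitions a a = {{}}"
    by (auto simp: nc_partitions_def partition_on_empty noncrossing_def)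
  then show ?thesis by (simp add: nc_sum_def)
qed

text \<open>The recursion involves only shorter intervals and sees only their lengths, so
  translation invariance follows by induction, with no transport of partitions along the
  shift.\<close>

lemma nc_sum_shift: "nc_sum \<kappa> j a (a + n) = nc_sum \<kappa> j 0 n"
proof (induction n arbitrary: j a rule: less_induct)
  case (less n)
  show ?case
  proof (cases n)
    case 0
    then show ?thesis by (simp add: nc_sum_empty)
  next
    case (Suc m)
    have 1: "nc_sum \<kappa> 0 (Suc a) (a + n) = nc_sum \<kappa> 0 0 m" for a
      using less[of m 0 "Suc a"] by (simp add: Suc)
    have 2: "(\<Sum>c\<in>{a<..<a + n}. nc_sum \<kappa> 0 (Suc a) c * nc_sum \<kappa> (Suc j) c (a + n)) =
        (\<Sum>i\<in>{0<..<n}. nc_sum \<kappa> 0 0 (i - 1) * nc_sum \<kappa> (Suc j) 0 (n - i))" for a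
    proof (rule sum.reindex_bij_witness[of _ "\<lambda>i. a + i" "\<lambda>c. c - a"])
      fix c assume c: "c \<in> {a<..<a + n}"
      have "nc_sum \<kappa> 0 (Suc a) c = nc_sum \<kappa> 0 0 (c - a - 1)"
      proof -
        have "c - a - 1 < n" "Suc a + (c - a - 1) = c" using c by auto
        then show ?thesis using less[of "c - a - 1" 0 "Suc a"] by simp
      qed
      moreover have "nc_sum \<kappa> (Suc j) c (a + n) = nc_sum \<kappa> (Suc j) 0 (n - (c - a))"
      proof -
        have "n - (c - a) < n" "c + (n - (c - a)) = a + n" using c by auto
        then show ?thesis using less[of "n - (c - a)" "Suc j" c] by simp
      qed
      ultimately show "nc_sum \<kappa> 0 0 (c - a - 1) * nc_sum \<kappa> (Suc j) 0 (n - (c - a)) =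
          nc_sum \<kappa> 0 (Suc a) c * nc_sum \<kappa> (Suc j) c (a + n)" by simp
    qed auto
    show ?thesis
      using nc_sum_recursion[of a "a + n" \<kappa> j] nc_sum_recursion[of 0 n \<kappa> j]
        1[of a] 1[of 0] 2[of a] 2[of 0] Suc by simp
  qed
qed

text \<open>\<open>K j\<close> is the series of partitions in which the first block already has \<open>j\<close> further
  elements; unfolding \<open>K j = \<kappa> (j + 1) M + X M K (j + 1)\<close> produces the geometric series
  in \<open>X M\<close>.\<close>

lemma free_moment_series:
  fixes \<kappa> :: "nat \<Rightarrow> complex"
  defines "M \<equiv> Abs_fps (\<lambda>n. nc_sum \<kappa> 0 0 n)"
  shows "M = 1 + (Abs_fps (\<lambda>n. if n = 0 then 0 else \<kappa> n) oo (fps_X * M))"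
proof -
  define W where "W = Abs_fps (\<lambda>n. if n = 0 then 0 else \<kappa> n)"
  define K where "K = (\<lambda>j. Abs_fps (\<lambda>m. nc_sum \<kappa> j 0 (Suc m)))"
  have K: "K j = fps_const (\<kappa> (Suc j)) * M + fps_X * M * K (Suc j)" for j
  proof (rule fps_ext)
    fix m
    have s: "nc_sum \<kappa> 0 (Suc 0) c = nc_sum \<kappa> 0 0 (c - 1)" if "0 < c" for c
      using nc_sum_shift[of \<kappa> 0 1 "c - 1"] that by simp
    have "K j $ m = \<kappa> (Suc j) * M $ m +
        (\<Sum>c\<in>{0<..<Suc m}. nc_sum \<kappa> 0 (Suc 0) c * nc_sum \<kappa> (Suc j) c (Suc m))"
      unfolding K_def M_def using nc_sum_recursion[of 0 "Suc m" \<kappa> j] s[of "Suc m"] by simp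
    also have "(\<Sum>c\<in>{0<..<Suc m}. nc_sum \<kappa> 0 (Suc 0) c * nc_sum \<kappa> (Suc j) c (Suc m)) =
        (fps_X * (M * K (Suc j))) $ m"
    proof (cases m)
      case (Suc k)
      have "(\<Sum>c\<in>{0<..<Suc m}. nc_sum \<kappa> 0 (Suc 0) c * nc_sum \<kappa> (Suc j) c (Suc m)) =
          (\<Sum>i=0..k. nc_sum \<kappa> 0 0 i * nc_sum \<kappa> (Suc j) 0 (Suc (k - i)))"
      proof (rule sum.reindex_bij_witness[of _ Suc "\<lambda>c. c - 1"])
        fix c assume c: "c \<in> {0<..<Suc m}"
        have "nc_sum \<kappa> (Suc j) c (Suc m) = nc_sum \<kappa> (Suc j) 0 (Suc (k - (c - 1)))"
          using nc_sum_shift[of \<kappa> "Suc j" c "Suc (k - (c - 1))"] c Suc by simp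
        then show "nc_sum \<kappa> 0 0 (c - 1) * nc_sum \<kappa> (Suc j) 0 (Suc (k - (c - 1))) =
            nc_sum \<kappa> 0 (Suc 0) c * nc_sum \<kappa> (Suc j) c (Suc m)"
          using s c by simp
      qed (auto simp: Suc)
      moreover have "(fps_X * (M * K (Suc j))) $ m = (M * K (Suc j)) $ k"
        by (simp add: Suc)
      ultimately show ?thesis by (simp only: fps_mult_nth M_def K_def fps_nth_Abs_fps)
    next
      case 0
      then have "{0<..<Suc m} = {}" by auto
      then show ?thesis using 0 by simp
    qed
    finally show "K j $ m = (fps_const (\<kappa> (Suc j)) * M + fps_X * M * K (Suc j)) $ m"
      by (simp add: mult.assoc)
  qed
  have M0: "M = 1 + fps_X * K 0"
  proof (rule fps_ext)
    fix n show "M $ n = (1 + fps_X * K 0) $ n"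
      by (cases n) (simp_all add: M_def K_def nc_sum_empty)
  qed
  let ?g = "fps_X * M"
  \<comment> \<open>The remainder is divisible by \<open>X^(N+1)\<close>, so \<open>N = n\<close>
    already gives the \<open>n\<close>-th coefficient exactly.\<close>
  have M: "M = 1 + (\<Sum>i=1..N. fps_const (\<kappa> i) * ?g ^ i) + fps_X * ?g ^ N * K N" for N
  proof (induction N)
    case 0
    then show ?case using M0 by simp
  next
    case (Suc N)
    have "fps_X * ?g ^ N * K N = fps_const (\<kappa> (Suc N)) * ?g ^ Suc N + fps_X * ?g ^ Suc N * K (Suc N)"
      by (subst K) (simp only: ring_distribs power_Suc mult_ac)
    then have "1 + (\<Sum>i=1..N. fps_const (\<kappa> i) * ?g ^ i) + fps_X * ?g ^ N * K N =
        1 + (\<Sum>i=1..Suc N. fps_const (\<kappa> i) * ?g ^ i) + fps_X * ?g ^ Suc N * K (Suc N)"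
      by (simp add: add.assoc)
    with Suc show ?case by (rule trans)
  qed
  have "M $ n = (1 + (W oo ?g)) $ n" for n
  proof -
    have "(fps_X * ?g ^ n * K n) $ n = (fps_X ^ Suc n * (M ^ n * K n)) $ n"
      by (simp add: power_mult_distrib mult_ac)
    also have "\<dots> = 0" by (simp only: fps_X_power_mult_nth) simp
    finally have "M $ n = 1 $ n + (\<Sum>i=1..n. \<kappa> i * (?g ^ i) $ n)"
      by (subst M[of n]) (simp add: fps_sum_nth)
    also have "(\<Sum>i=1..n. \<kappa> i * (?g ^ i) $ n) = (W oo ?g) $ n"
      unfolding fps_compose_nth by (intro sum.mono_neutral_cong_left) (auto simp: W_def)
    finally show ?thesis by simp
  qed
  then show ?thesis unfolding W_def by (simp add: fps_eq_iff)
qed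

section \<open>First-order asymptotics\<close>

text \<open>The expansion \<open>a d = a\<^sub>0 + a\<^sub>1 / d + o(1/d)\<close>.\<close>

definition jet :: "(nat \<Rightarrow> complex) \<Rightarrow> complex \<Rightarrow> complex \<Rightarrow> bool" where
  "jet a a\<^sub>0 a\<^sub>1 \<longleftrightarrow> a \<longlonglongrightarrow> a\<^sub>0 \<and> (\<lambda>d. of_nat d * (a d - a\<^sub>0)) \<longlonglongrightarrow> a\<^sub>1"

lemma jet_const [intro]: "jet (\<lambda>d. c) c 0"
  by (simp add: jet_def)

lemma jet_cong: "eventually (\<lambda>d. a d = b d) sequentially \<Longrightarrow> jet a a\<^sub>0 a\<^sub>1 \<longleftrightarrow> jet b a\<^sub>0 a\<^sub>1"
  unfolding jet_def
  by (intro conj_cong filterlim_cong) (auto elim: eventually_mono)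

lemma jet_add [intro]:
  assumes "jet a a\<^sub>0 a\<^sub>1" "jet b b\<^sub>0 b\<^sub>1"
  shows "jet (\<lambda>d. a d + b d) (a\<^sub>0 + b\<^sub>0) (a\<^sub>1 + b\<^sub>1)"
proof -
  have "(\<lambda>d. of_nat d * (a d - a\<^sub>0) + of_nat d * (b d - b\<^sub>0)) \<longlonglongrightarrow> a\<^sub>1 + b\<^sub>1"
    using assms by (auto simp: jet_def intro: tendsto_add)
  then show ?thesis
    using assms by (auto simp: jet_def algebra_simps intro: tendsto_add)
qed

lemma jet_mult [intro]:
  assumes "jet a a\<^sub>0 a\<^sub>1" "jet b b\<^sub>0 b\<^sub>1"
  shows "jet (\<lambda>d. a d * b d) (a\<^sub>0 * b\<^sub>0) (a\<^sub>0 * b\<^sub>1 + a\<^sub>1 * b\<^sub>0)"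
proof -
  have "(\<lambda>d. a\<^sub>0 * (of_nat d * (b d - b\<^sub>0)) + (of_nat d * (a d - a\<^sub>0)) * b d)
      \<longlonglongrightarrow> a\<^sub>0 * b\<^sub>1 + a\<^sub>1 * b\<^sub>0"
    using assms by (auto simp: jet_def intro!: tendsto_add tendsto_mult)
  then show ?thesis
    using assms by (auto simp: jet_def algebra_simps intro: tendsto_mult)
qed

lemma jet_sum [intro]:
  "(\<And>i. i \<in> A \<Longrightarrow> jet (\<lambda>d. a d i) (b i) (c i)) \<Longrightarrow>
    jet (\<lambda>d. \<Sum>i\<in>A. a d i) (\<Sum>i\<in>A. b i) (\<Sum>i\<in>A. c i)"
  by (induction A rule: infinite_finite_induct) auto

text \<open>A factor \<open>1/d\<close> moves the limit into the first-order slot. Thus the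
  derivation in \<open>twisted_power\<close> enters the correction through limits alone.\<close>

lemma jet_scaled:
  assumes "jet a a\<^sub>0 a\<^sub>1"
  shows "jet (\<lambda>d. 1 / of_nat d * a d) 0 a\<^sub>0"
proof -
  have a: "a \<longlonglongrightarrow> a\<^sub>0" using assms by (simp add: jet_def)
  have "(\<lambda>d. 1 / of_nat d * a d) \<longlonglongrightarrow> 0 * a\<^sub>0"
    by (intro tendsto_mult a lim_1_over_n)
  moreover have "eventually (\<lambda>d. a d = of_nat d * (1 / of_nat d * a d - 0)) sequentially"
    using eventually_gt_at_top[of 0] by eventually_elim simp
  ultimately show ?thesis
    unfolding jet_def using Lim_transform_eventually[OF a] by simp
qed

section \<open>Expansions of power series, coefficient by coefficient\<close>

text \<open>The bound \<open>K\<close> is there because the expansions are established by induction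
  on the order of the coefficient.\<close>

definition fps_jet :: "nat \<Rightarrow> (nat \<Rightarrow> complex fps) \<Rightarrow> complex fps \<Rightarrow> complex fps \<Rightarrow> bool" where
  "fps_jet K F f\<^sub>0 f\<^sub>1 \<longleftrightarrow> (\<forall>j\<le>K. jet (\<lambda>d. F d $ j) (f\<^sub>0 $ j) (f\<^sub>1 $ j))"

lemma fps_jet_add:
  "fps_jet K F f\<^sub>0 f\<^sub>1 \<Longrightarrow> fps_jet K G g\<^sub>0 g\<^sub>1 \<Longrightarrow> fps_jet K (\<lambda>d. F d + G d) (f\<^sub>0 + g\<^sub>0) (f\<^sub>1 + g\<^sub>1)"
  by (auto simp: fps_jet_def)

lemma fps_jet_mult:
  assumes "fps_jet K F f\<^sub>0 f\<^sub>1" "fps_jet K G g\<^sub>0 g\<^sub>1"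
  shows "fps_jet K (\<lambda>d. F d * G d) (f\<^sub>0 * g\<^sub>0) (f\<^sub>0 * g\<^sub>1 + f\<^sub>1 * g\<^sub>0)"
  unfolding fps_jet_def
proof (intro allI impI)
  fix j assume "j \<le> K"
  then have "jet (\<lambda>d. \<Sum>i=0..j. F d $ i * G d $ (j - i)) (\<Sum>i=0..j. f\<^sub>0 $ i * g\<^sub>0 $ (j - i))
      (\<Sum>i=0..j. f\<^sub>0 $ i * g\<^sub>1 $ (j - i) + f\<^sub>1 $ i * g\<^sub>0 $ (j - i))"
    using assms by (intro jet_sum jet_mult) (auto simp: fps_jet_def)
  then show "jet (\<lambda>d. (F d * G d) $ j) ((f\<^sub>0 * g\<^sub>0) $ j) ((f\<^sub>0 * g\<^sub>1 + f\<^sub>1 * g\<^sub>0) $ j)"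
    by (simp add: fps_mult_nth sum.distrib)
qed

lemma fps_jet_deriv_inv_scaled:
  assumes "fps_jet K F f\<^sub>0 f\<^sub>1"
  shows "fps_jet K (\<lambda>d. fps_const (1 / of_nat d) * fps_deriv_inv (F d)) 0 (fps_deriv_inv f\<^sub>0)"
  unfolding fps_jet_def
proof (intro allI impI)
  fix j assume "j \<le> K"
  then have "jet (\<lambda>d. F d $ (j - 1)) (f\<^sub>0 $ (j - 1)) (f\<^sub>1 $ (j - 1))"
    using assms by (auto simp: fps_jet_def)
  from jet_scaled[OF jet_mult[OF jet_const[of "- of_nat (j - 1)"] this]]
  show "jet (\<lambda>d. (fps_const (1 / of_nat d) * fps_deriv_inv (F d)) $ j) (0 $ j) (fps_deriv_inv f\<^sub>0 $ j)"
    by (simp add: fps_deriv_inv_nth)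
qed

lemma fps_deriv_inv_power:
  "fps_deriv_inv (f ^ n) = of_nat n * f ^ (n - 1) * fps_deriv_inv f"
  by (simp add: fps_deriv_inv_def fps_deriv_power fps_of_nat mult_ac)

text \<open>To first order the derivation acts in just one of the \<open>n\<close> factors. Acting
  after \<open>m\<close> factors it gives \<open>m f\<^sub>0^(n-2)\<close> times the derivative of
  \<open>f\<^sub>0\<close>, and the \<open>m < n\<close> add up to \<open>n choose 2\<close>. Where
  \<open>n - 1\<close> or \<open>n - 2\<close> is truncated, its coefficient is zero.\<close>

lemma fps_jet_twisted_power:
  assumes "fps_jet K F f\<^sub>0 f\<^sub>1"
  shows "fps_jet K (\<lambda>d. twisted_power (1 / of_nat d) (F d) n) (f\<^sub>0 ^ n)
    (of_nat n * (f\<^sub>0 ^ (n - 1) * f\<^sub>1) + of_nat (n choose 2) * (f\<^sub>0 ^ (n - 2) * fps_deriv_inv f\<^sub>0))"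
proof (induction n)
  case 0
  then show ?case by (auto simp: fps_jet_def numeral_2_eq_2)
next
  case (Suc n)
  let ?q = "\<lambda>n. of_nat n * (f\<^sub>0 ^ (n - 1) * f\<^sub>1) + of_nat (n choose 2) * (f\<^sub>0 ^ (n - 2) * fps_deriv_inv f\<^sub>0)"
  have 1: "f\<^sub>0 * (of_nat n * (f\<^sub>0 ^ (n - 1) * f\<^sub>1)) = of_nat n * (f\<^sub>0 ^ n * f\<^sub>1)"
    by (cases n) (simp_all add: mult_ac)
  have 2: "f\<^sub>0 * (of_nat (n choose 2) * (f\<^sub>0 ^ (n - 2) * fps_deriv_inv f\<^sub>0)) =
      of_nat (n choose 2) * (f\<^sub>0 ^ (n - 1) * fps_deriv_inv f\<^sub>0)"
  proof (cases "n < 2")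
    case False
    then have "f\<^sub>0 ^ (n - 1) = f\<^sub>0 * f\<^sub>0 ^ (n - 2)"
      by (metis One_nat_def Suc_diff_Suc diff_Suc_1 not_less numeral_2_eq_2 power_Suc Suc_le_lessD)
    then show ?thesis by (simp only: mult_ac)
  qed (simp add: binomial_eq_0)
  have 3: "fps_deriv_inv (f\<^sub>0 ^ n) = of_nat n * (f\<^sub>0 ^ (n - 1) * fps_deriv_inv f\<^sub>0)"
    by (simp only: fps_deriv_inv_power mult.assoc)
  have 4: "(of_nat (Suc n choose 2) :: complex fps) = of_nat n + of_nat (n choose 2)"
    by (simp add: numeral_2_eq_2)
  have 5: "Suc n - 1 = n" "Suc n - 2 = n - 1" by auto
  have "f\<^sub>0 * ?q n + f\<^sub>1 * f\<^sub>0 ^ n + fps_deriv_inv (f\<^sub>0 ^ n) = ?q (Suc n)"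
    unfolding 3 4 5 distrib_left 1 2 by (simp add: algebra_simps)
  moreover have "fps_jet K (\<lambda>d. twisted_power (1 / of_nat d) (F d) (Suc n)) (f\<^sub>0 * f\<^sub>0 ^ n + 0)
      ((f\<^sub>0 * ?q n + f\<^sub>1 * f\<^sub>0 ^ n) + fps_deriv_inv (f\<^sub>0 ^ n))"
    unfolding twisted_power.simps
    by (intro fps_jet_add fps_jet_mult assms Suc fps_jet_deriv_inv_scaled[OF Suc])
  ultimately show ?case by simp
qed

text \<open>The power \<open>f ^ m\<close> starts at order \<open>m\<close>, so one bound
  \<open>N\<close> serves all coefficients that enter the convolution.\<close>

lemma fps_compose_mult_nth:
  fixes A f h :: "complex fps"
  assumes "f $ 0 = 0" "j \<le> N"
  shows "((A oo f) * h) $ j = (\<Sum>m\<le>N. A $ m * (f ^ m * h) $ j)"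
proof -
  have "(A oo f) $ i = (\<Sum>m\<le>N. A $ m * (f ^ m) $ i)" if "i \<le> j" for i
    unfolding fps_compose_nth
    using that assms startsby_zero_power_prefix[OF assms(1)]
    by (intro sum.mono_neutral_left) auto
  then have "((A oo f) * h) $ j = (\<Sum>i=0..j. (\<Sum>m\<le>N. A $ m * (f ^ m) $ i) * h $ (j - i))"
    unfolding fps_mult_nth by (intro sum.cong) auto
  also have "\<dots> = (\<Sum>m\<le>N. A $ m * (f ^ m * h) $ j)"
    unfolding fps_mult_nth sum_distrib_right sum_distrib_left
    by (subst sum.swap) (simp add: mult.assoc)
  finally show ?thesis .
qed

text \<open>Since \<open>F\<close> is \<open>X\<close> times the moment series, the moment equation
  expresses its coefficient of order \<open>K + 1\<close> through those up to \<open>K\<close>. The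
  leading factor \<open>X\<close> in the equations for \<open>f\<^sub>0\<close> and
  \<open>f\<^sub>1\<close> has the same effect, so the same induction identifies the limits with the
  coefficients of these series.\<close>

lemma root_moment_jet:
  fixes p :: "nat \<Rightarrow> complex poly" and \<kappa> :: "nat \<Rightarrow> complex"
  defines "W \<equiv> Abs_fps (\<lambda>n. if n = 0 then 0 else \<kappa> n)"
  assumes p: "\<And>d. d \<ge> 1 \<Longrightarrow> degree (p d) = d \<and> lead_coeff (p d) = 1"
    and \<kappa>: "\<And>d n. 1 \<le> n \<Longrightarrow> n \<le> d \<Longrightarrow> finite_free_cumulant (p d) n = \<kappa> n"
    and f\<^sub>0: "f\<^sub>0 = fps_X * (1 + (W oo f\<^sub>0))"
    and f\<^sub>1: "f\<^sub>1 = fps_X * ((fps_deriv W oo f\<^sub>0) * f\<^sub>1 +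
      fps_const (1 / 2) * ((fps_deriv (fps_deriv W) oo f\<^sub>0) * fps_deriv_inv f\<^sub>0))"
  shows "jet (\<lambda>d. root_moment (p d) k) (f\<^sub>0 $ Suc k) (f\<^sub>1 $ Suc k)"
proof -
  define F where "F = (\<lambda>d. fps_X * Abs_fps (root_moment (p d)))"
  have f0: "f\<^sub>0 $ 0 = 0" "f\<^sub>1 $ 0 = 0" by (subst f\<^sub>0, simp) (subst f\<^sub>1, simp)
  let ?q = "\<lambda>n. of_nat n * (f\<^sub>0 ^ (n - 1) * f\<^sub>1) + of_nat (n choose 2) * (f\<^sub>0 ^ (n - 2) * fps_deriv_inv f\<^sub>0)"
  have of_nat_nth: "(of_nat n * h) $ j = of_nat n * h $ j" for n j and h :: "complex fps"
    by (simp flip: fps_of_nat)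
  \<comment> \<open>The common bound \<open>j + 2\<close> becomes \<open>j + 1\<close> and
    \<open>j\<close> after the index shifts by one and two below, which is still enough for
    coefficient \<open>j\<close>.\<close>
  have W0: "(\<Sum>n=1..j + 2. \<kappa> n * (f\<^sub>0 ^ n) $ j) = (W oo f\<^sub>0) $ j" for j
  proof -
    have "(W oo f\<^sub>0) $ j = (\<Sum>n\<le>j + 2. W $ n * (f\<^sub>0 ^ n) $ j)"
      using fps_compose_mult_nth[OF f0(1), of j "j + 2" W 1] by simp
    also have "\<dots> = (\<Sum>n=1..j + 2. \<kappa> n * (f\<^sub>0 ^ n) $ j)"
      by (intro sum.mono_neutral_cong_right) (auto simp: W_def)
    finally show ?thesis by simp
  qed
  have W1: "(\<Sum>n=1..j + 2. \<kappa> n * (of_nat n * (f\<^sub>0 ^ (n - 1) * f\<^sub>1)) $ j) =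
      ((fps_deriv W oo f\<^sub>0) * f\<^sub>1) $ j" for j
    unfolding fps_compose_mult_nth[OF f0(1) le_add1[of j 1]]
    by (rule sum.reindex_bij_witness[of _ Suc "\<lambda>n. n - 1"]) (auto simp: W_def fps_of_nat[symmetric] simp del: fps_of_nat of_nat_Suc)
  have W2: "(\<Sum>n=1..j + 2. \<kappa> n * (of_nat (n choose 2) * (f\<^sub>0 ^ (n - 2) * fps_deriv_inv f\<^sub>0)) $ j) =
      1 / 2 * ((fps_deriv (fps_deriv W) oo f\<^sub>0) * fps_deriv_inv f\<^sub>0) $ j" for j
  proof -
    let ?g = "\<lambda>n. \<kappa> n * (of_nat (n choose 2) * (f\<^sub>0 ^ (n - 2) * fps_deriv_inv f\<^sub>0)) $ j"
    \<comment> \<open>The origin of the factor \<open>1 / 2\<close>: the numbers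
      \<open>(m + 1) (m + 2)\<close> are those produced by \<open>W''\<close>.\<close>
    have choose: "(of_nat ((m + 2) choose 2) :: complex) = 1 / 2 * (of_nat (m + 1) * of_nat (m + 2))" for m
      by (induction m) (simp_all add: numeral_2_eq_2 field_simps)
    have "(\<Sum>n=1..j + 2. ?g n) = (\<Sum>n=2..j + 2. ?g n)"
    proof (rule sum.mono_neutral_right)
      show "\<forall>n\<in>{1..j + 2} - {2..j + 2}. ?g n = 0"
        by (auto simp: of_nat_nth intro!: binomial_eq_0)
    qed auto
    also have "\<dots> = (\<Sum>m\<le>j. ?g (m + 2))"
    proof (rule sum.reindex_bij_witness[of _ "\<lambda>m. m + 2" "\<lambda>n. n - 2"])
      fix n assume "n \<in> {2..j + 2}"
      then have "n - 2 + 2 = n" by (intro le_add_diff_inverse2) simp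
      then show "?g (n - 2 + 2) = ?g n" by (simp only:)
    qed auto
    also have "\<dots> = (\<Sum>m\<le>j. 1 / 2 * (fps_deriv (fps_deriv W) $ m * (f\<^sub>0 ^ m * fps_deriv_inv f\<^sub>0) $ j))"
      unfolding of_nat_nth choose by (intro sum.cong) (simp_all add: W_def mult_ac)
    also have "\<dots> = 1 / 2 * ((fps_deriv (fps_deriv W) oo f\<^sub>0) * fps_deriv_inv f\<^sub>0) $ j"
      unfolding fps_compose_mult_nth[OF f0(1) order.refl[of j]] by (rule sum_distrib_left[symmetric])
    finally show ?thesis .
  qed
  have "fps_jet K F f\<^sub>0 f\<^sub>1" for K
  proof (induction K)
    case 0
    then show ?case by (auto simp: fps_jet_def F_def f0)
  next
    case (Suc K)
    \<comment> \<open>For \<open>d \<ge> K + 2\<close> all retained cumulants are prescribed, and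
      the terms with larger \<open>n\<close> vanish at order \<open>K\<close>.\<close>
    have ev: "eventually (\<lambda>d. F d $ Suc K =
      (if K = 0 then 1 else 0) + (\<Sum>n=1..K + 2. \<kappa> n * twisted_power (1 / of_nat d) (F d) n $ K)) sequentially"
      using eventually_ge_at_top[of "K + 2"]
    proof eventually_elim
      case (elim d)
      have "F d $ Suc K = (if K = 0 then 1 else 0) +
          (\<Sum>n=1..d. finite_free_cumulant (p d) n * twisted_power (1 / of_nat d) (F d) n $ K)"
        using finite_free_moment_equation[OF conjunct1[OF p] conjunct2[OF p], of d K] elim
        by (simp add: F_def)
      also have "(\<Sum>n=1..d. finite_free_cumulant (p d) n * twisted_power (1 / of_nat d) (F d) n $ K) =
          (\<Sum>n=1..K + 2. \<kappa> n * twisted_power (1 / of_nat d) (F d) n $ K)"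
        using elim twisted_power_nth_eq_0[of "F d" K] \<kappa>
        by (intro sum.mono_neutral_cong_right) (auto simp: F_def)
      finally show ?case .
    qed
    have J: "jet (\<lambda>d. twisted_power (1 / of_nat d) (F d) n $ K) ((f\<^sub>0 ^ n) $ K) (?q n $ K)" for n
      using fps_jet_twisted_power[OF Suc.IH, of n] unfolding fps_jet_def by blast
    have "jet (\<lambda>d. (if K = 0 then 1 else 0) + (\<Sum>n=1..K + 2. \<kappa> n * twisted_power (1 / of_nat d) (F d) n $ K))
      ((if K = 0 then 1 else 0) + (\<Sum>n=1..K + 2. \<kappa> n * (f\<^sub>0 ^ n) $ K))
      (0 + (\<Sum>n=1..K + 2. \<kappa> n * ?q n $ K + 0 * (f\<^sub>0 ^ n) $ K))"
      by (rule jet_add[OF jet_const jet_sum[OF jet_mult[OF jet_const J]]])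
    moreover have "(if K = 0 then 1 else 0) + (\<Sum>n=1..K + 2. \<kappa> n * (f\<^sub>0 ^ n) $ K) = f\<^sub>0 $ Suc K"
      unfolding W0 using arg_cong[OF f\<^sub>0, of "\<lambda>h. h $ Suc K"] by simp
    moreover have "0 + (\<Sum>n=1..K + 2. \<kappa> n * ?q n $ K + 0 * (f\<^sub>0 ^ n) $ K) = f\<^sub>1 $ Suc K"
    proof -
      have "(\<Sum>n=1..K + 2. \<kappa> n * ?q n $ K) =
          (\<Sum>n=1..K + 2. \<kappa> n * (of_nat n * (f\<^sub>0 ^ (n - 1) * f\<^sub>1)) $ K) +
          (\<Sum>n=1..K + 2. \<kappa> n * (of_nat (n choose 2) * (f\<^sub>0 ^ (n - 2) * fps_deriv_inv f\<^sub>0)) $ K)"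
        by (simp only: fps_add_nth distrib_left sum.distrib)
      also have "\<dots> = f\<^sub>1 $ Suc K"
        unfolding W1 W2 using arg_cong[OF f\<^sub>1, of "\<lambda>h. h $ Suc K"] by simp
      finally show ?thesis by simp
    qed
    ultimately have "jet (\<lambda>d. F d $ Suc K) (f\<^sub>0 $ Suc K) (f\<^sub>1 $ Suc K)"
      using jet_cong[OF ev] by simp
    with Suc show ?case by (auto simp: fps_jet_def le_Suc_eq)
  qed
  then have "jet (\<lambda>d. F d $ Suc k) (f\<^sub>0 $ Suc k) (f\<^sub>1 $ Suc k)" unfolding fps_jet_def by blast
  then show ?thesis by (simp add: F_def)
qed

section \<open>Signed measures and their moments\<close>

text \<open>A pair \<open>(c, x)\<close> stands for an atom of weight \<open>c\<close> at
  \<open>x\<close>; lists are concatenated to add such measures.\<close>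

definition atom_moment :: "(real \<times> real) list \<Rightarrow> nat \<Rightarrow> real" where
  "atom_moment L i = (\<Sum>(c, x)\<leftarrow>L. c * x ^ i)"

definition atom_abs_moment :: "(real \<times> real) list \<Rightarrow> nat \<Rightarrow> real" where
  "atom_abs_moment L i = (\<Sum>(c, x)\<leftarrow>L. \<bar>c * x ^ i\<bar>)"

lemma atom_moment_append: "atom_moment (L @ L') i = atom_moment L i + atom_moment L' i"
  by (simp add: atom_moment_def)

lemma atom_moment_sum_nth: "atom_moment L i = (\<Sum>j<length L. fst (L ! j) * snd (L ! j) ^ i)"
  by (simp add: atom_moment_def sum_list_sum_nth case_prod_unfold atLeast0LessThan)

lemma atom_abs_moment_sum_nth:
  "atom_abs_moment L i = (\<Sum>j<length L. \<bar>fst (L ! j) * snd (L ! j) ^ i\<bar>)"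
  by (simp add: atom_abs_moment_def sum_list_sum_nth case_prod_unfold atLeast0LessThan)

text \<open>Finite differences: each convolution with \<open>\<delta>\<^sub>1 - \<delta>\<^sub>0\<close> kills one more moment.\<close>

lemma ex_atoms_unit_moment: "\<exists>L. \<forall>i\<le>k. atom_moment L i = (if i = k then 1 else 0)"
proof (induction k)
  case 0
  show ?case by (intro exI[of _ "[(1, 0)]"]) (simp add: atom_moment_def)
next
  case (Suc k)
  then obtain L where L: "atom_moment L i = (if i = k then 1 else 0)" if "i \<le> k" for i by blast
  \<comment> \<open>The divisor \<open>k + 1\<close> is \<open>Suc k choose k\<close>, the
    coefficient with which the old \<open>k\<close>-th moment enters the new one of order
    \<open>Suc k\<close>.\<close>
  let ?L = "map (\<lambda>(c, x). (c / (k + 1), x + 1)) L @ map (\<lambda>(c, x). (- c / (k + 1), x)) L"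
  have eq: "atom_moment ?L i = (\<Sum>l<i. (i choose l) * atom_moment L l) / (k + 1)" for i
  proof -
    have "(\<Sum>(c, x)\<leftarrow>L. c / (k + 1) * (x + 1) ^ i) + (\<Sum>(c, x)\<leftarrow>L. - c / (k + 1) * x ^ i) =
        (\<Sum>l<i. (i choose l) * (\<Sum>(c, x)\<leftarrow>L. c * x ^ l)) / (k + 1)"
    proof (induction L)
      case (Cons y L)
      obtain c x where y: "y = (c, x)" by fastforce
      have "(x + 1) ^ i = (\<Sum>l<i. (i choose l) * x ^ l) + x ^ i"
        by (simp add: binomial_ring lessThan_Suc_atMost[symmetric])
      then have "c / (k + 1) * (x + 1) ^ i + - c / (k + 1) * x ^ i = c * (\<Sum>l<i. (i choose l) * x ^ l) / (k + 1)"
        by (simp add: algebra_simps)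
      then have "c / (k + 1) * (x + 1) ^ i + - c / (k + 1) * x ^ i = (\<Sum>l<i. (i choose l) * (c * x ^ l)) / (k + 1)"
        by (simp add: sum_distrib_left mult.left_commute)
      then show ?case
        using Cons by (simp add: y distrib_left sum.distrib add_divide_distrib)
    qed simp
    then show ?thesis
      by (simp add: atom_moment_def o_def case_prod_unfold)
  qed
  show ?case
  proof (intro exI[of _ ?L] allI impI)
    fix i assume i: "i \<le> Suc k"
    have "(\<Sum>l<i. (i choose l) * atom_moment L l) = (\<Sum>l<i. if l = k then real (i choose k) else 0)"
      using i by (intro sum.cong) (auto simp: L)
    also have "\<dots> = (if i = Suc k then real (k + 1) else 0)"
      using i by (auto simp: sum.delta)
    finally show "atom_moment ?L i = (if i = Suc k then 1 else 0)"
      unfolding eq by auto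
  qed
qed

text \<open>Dilation by a large \<open>t\<close> makes the moments of order below \<open>k\<close> negligible against the one of
  order \<open>k\<close>.\<close>

lemma ex_atoms_moment:
  "\<exists>L. (\<forall>i<k. atom_moment L i = 0 \<and> atom_abs_moment L i \<le> (1 / 2) ^ k) \<and> atom_moment L k = r"
proof -
  obtain L where L: "atom_moment L i = (if i = k then 1 else 0)" if "i \<le> k" for i
    using ex_atoms_unit_moment by blast
  define A where "A = (\<Sum>i<k. atom_abs_moment L i)"
  have nonneg: "atom_abs_moment L i \<ge> 0" for i
    by (auto simp: atom_abs_moment_sum_nth intro: sum_nonneg)
  \<comment> \<open>Dilation by \<open>t\<close>, with weights divided by \<open>t ^ k\<close>,
    multiplies order \<open>i < k\<close> by \<open>t ^ i / t ^ k \<le> 1 / t\<close>. It remains to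
    make \<open>\<bar>r\<bar> * A / t\<close> at most \<open>(1 / 2) ^ k\<close>.\<close>
  define t where "t = max 1 (2 ^ k * \<bar>r\<bar> * A)"
  have t: "t \<ge> 1" "2 ^ k * \<bar>r\<bar> * A \<le> t" by (auto simp: t_def)
  let ?L = "map (\<lambda>(c, x). (r * c / t ^ k, t * x)) L"
  have "(\<Sum>(c, x)\<leftarrow>L. r * c / t ^ k * (t * x) ^ i) = r * t ^ i / t ^ k * (\<Sum>(c, x)\<leftarrow>L. c * x ^ i)" for i
    by (induction L) (auto simp: power_mult_distrib algebra_simps)
  then have m: "atom_moment ?L i = r * t ^ i / t ^ k * atom_moment L i" for i
    by (simp add: atom_moment_def o_def case_prod_unfold)
  have "(\<Sum>(c, x)\<leftarrow>L. \<bar>r * c / t ^ k * (t * x) ^ i\<bar>) = \<bar>r\<bar> * t ^ i / t ^ k * (\<Sum>(c, x)\<leftarrow>L. \<bar>c * x ^ i\<bar>)" for i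
    using t by (induction L) (auto simp: power_mult_distrib algebra_simps abs_mult)
  then have a: "atom_abs_moment ?L i = \<bar>r\<bar> * t ^ i / t ^ k * atom_abs_moment L i" for i
    by (simp add: atom_abs_moment_def o_def case_prod_unfold)
  have "atom_abs_moment ?L i \<le> (1 / 2) ^ k" if i: "i < k" for i
  proof -
    have "t ^ i * t \<le> t ^ k"
      using power_increasing[of "Suc i" k t] t i by (simp add: mult.commute)
    then have "t ^ i / t ^ k \<le> 1 / t"
      using t by (simp add: field_simps)
    moreover have "atom_abs_moment L i \<le> A"
      unfolding A_def using nonneg i by (intro member_le_sum) auto
    ultimately have "\<bar>r\<bar> * (t ^ i / t ^ k) * atom_abs_moment L i \<le> \<bar>r\<bar> * (1 / t) * A"
      using t nonneg by (intro mult_mono mult_left_mono) auto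
    also have "\<dots> \<le> (1 / 2) ^ k" using t by (simp add: field_simps power_divide)
    finally show ?thesis by (simp add: a)
  qed
  moreover have "atom_moment ?L i = 0" if "i < k" for i using that by (simp add: m L)
  moreover have "atom_moment ?L k = r" using t by (simp add: m L)
  ultimately show ?thesis by blast
qed

text \<open>Batch \<open>k\<close> corrects the \<open>k\<close>-th moment left by the earlier
  batches. Later batches have zero \<open>k\<close>-th moment and do not disturb it.\<close>

lemma ex_atoms_sequence:
  fixes m :: "nat \<Rightarrow> real"
  shows "\<exists>T. (\<forall>k. \<forall>i<k. atom_moment (T k) i = 0 \<and> atom_abs_moment (T k) i \<le> (1 / 2) ^ k) \<and>
    (\<forall>i. (\<Sum>k\<le>i. atom_moment (T k) i) = m i)"
proof -
  let ?small = "\<lambda>k L. \<forall>i<k. atom_moment L i = 0 \<and> atom_abs_moment L i \<le> (1 / 2) ^ k"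
  \<comment> \<open>The correction depends on everything chosen before, so dependent choice is
    applied to the concatenation \<open>S k\<close> of the batches below \<open>k\<close>.\<close>
  have "\<exists>S. \<forall>k. (k = 0 \<longrightarrow> S k = []) \<and> (\<exists>L. S (Suc k) = S k @ L \<and> ?small k L \<and> atom_moment (S (Suc k)) k = m k)"
  proof (rule dependent_nat_choice)
    fix S :: "(real \<times> real) list" and k :: nat
    obtain L where "?small k L" "atom_moment L k = m k - atom_moment S k"
      using ex_atoms_moment by blast
    then show "\<exists>S'. (Suc k = 0 \<longrightarrow> S' = []) \<and> (\<exists>L. S' = S @ L \<and> ?small k L \<and> atom_moment S' k = m k)"
      by (intro exI[of _ "S @ L"]) (auto simp: atom_moment_append)
  qed simp
  then obtain S where S: "\<And>k. (k = 0 \<longrightarrow> S k = []) \<and>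
      (\<exists>L. S (Suc k) = S k @ L \<and> ?small k L \<and> atom_moment (S (Suc k)) k = m k)" by blast
  then have "\<forall>k. \<exists>L. S (Suc k) = S k @ L \<and> ?small k L \<and> atom_moment (S (Suc k)) k = m k" by blast
  then obtain T where T: "\<And>k. S (Suc k) = S k @ T k" "\<And>k. ?small k (T k)"
    "\<And>k. atom_moment (S (Suc k)) k = m k" by metis
  have "atom_moment (S n) i = (\<Sum>k<n. atom_moment (T k) i)" for n i
  proof (induction n)
    case 0
    then show ?case using S[of 0] by (simp add: atom_moment_def)
  qed (simp add: T(1) atom_moment_append)
  then have "(\<Sum>k\<le>i. atom_moment (T k) i) = m i" for i
    using T(3)[of i] by (simp add: lessThan_Suc_atMost)
  with T(2) show ?thesis by blast
qed

text \<open>Atoms are indexed by \<open>I\<close> and not by position, since positions may coincide;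
  the push-forward along \<open>x\<close> adds up their weights.\<close>

lemma discrete_measure:
  fixes w x :: "'a \<Rightarrow> real"
  assumes w: "\<And>p. p \<in> I \<Longrightarrow> w p \<ge> 0" and s: "\<And>i::nat. Infinite_Set_Sum.abs_summable_on (\<lambda>p. w p * x p ^ i) I"
  shows "\<exists>P. finite_measure P \<and> sets P = sets borel \<and>
    (\<forall>i. integrable P (\<lambda>y. y ^ i) \<and> (\<integral>y. y ^ i \<partial>P) = infsetsum (\<lambda>p. w p * x p ^ i) I)"
proof -
  let ?D = "density (count_space I) (\<lambda>p. ennreal (w p))"
  let ?P = "distr ?D borel x"
  have x: "x \<in> measurable ?D borel" by simp
  have int: "integrable ?P (\<lambda>y. y ^ i)" for i :: nat
  proof -
    have "integrable ?D (\<lambda>p. x p ^ i)"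
      using s[of i] w by (subst integrable_real_density) (auto simp: abs_summable_on_def AE_count_space)
    then show ?thesis by (subst integrable_distr_eq[OF x]) auto
  qed
  moreover have "(\<integral>y. y ^ i \<partial>?P) = infsetsum (\<lambda>p. w p * x p ^ i) I" for i :: nat
  proof -
    have "(\<integral>y. y ^ i \<partial>?P) = (\<integral>p. x p ^ i \<partial>?D)"
      by (subst integral_distr[OF x]) auto
    also have "\<dots> = infsetsum (\<lambda>p. w p * x p ^ i) I"
      using w by (subst integral_real_density) (auto simp: infsetsum_def AE_count_space)
    finally show ?thesis .
  qed
  moreover have "finite_measure ?P"
  proof (rule finite_measureI)
    have "integrable ?P (\<lambda>y. 1 :: real)" using int[of 0] by simp
    then show "emeasure ?P (space ?P) \<noteq> \<infinity>" by (auto simp: integrable_iff_bounded)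
  qed
  ultimately show ?thesis by (intro exI[of _ ?P]) auto
qed

text \<open>Boas' theorem; the atoms of order \<open>k\<close> are moved so far out that they fix the \<open>k\<close>-th moment
  at a summable cost.\<close>

theorem ex_signed_measure_moments:
  fixes m :: "nat \<Rightarrow> real"
  shows "\<exists>\<sigma>. signed_measure \<sigma> \<and> (\<forall>n. signed_moment \<sigma> n = m n)"
proof -
  obtain T where T: "\<And>k i. i < k \<Longrightarrow> atom_moment (T k) i = 0"
    "\<And>k i. i < k \<Longrightarrow> atom_abs_moment (T k) i \<le> (1 / 2) ^ k"
    "\<And>i. (\<Sum>k\<le>i. atom_moment (T k) i) = m i"
    using ex_atoms_sequence[of m] by blast
  define I where "I = Sigma (UNIV :: nat set) (\<lambda>k. {..<length (T k)})"
  define c where "c = (\<lambda>(k, j). fst (T k ! j))"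
  define x where "x = (\<lambda>(k, j). snd (T k ! j))"
  \<comment> \<open>For fixed \<open>i\<close> only the finitely many batches
    \<open>k \<le> i\<close> escape the bound \<open>(1 / 2) ^ k\<close>.\<close>
  have sum: "Infinite_Set_Sum.abs_summable_on (\<lambda>p. c p * x p ^ i) I" for i
  proof -
    have "summable (\<lambda>k. norm (atom_abs_moment (T k) i))"
    proof (rule summable_comparison_test)
      show "\<exists>N. \<forall>n\<ge>N. norm (norm (atom_abs_moment (T n) i)) \<le> (1 / 2) ^ n"
      proof (intro exI[of _ "Suc i"] allI impI)
        fix n assume "n \<ge> Suc i"
        moreover have "atom_abs_moment (T n) i \<ge> 0"
          by (auto simp: atom_abs_moment_sum_nth intro: sum_nonneg)
        ultimately show "norm (norm (atom_abs_moment (T n) i)) \<le> (1 / 2) ^ n"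
          using T(2)[of i n] by simp
      qed
      show "summable (\<lambda>n. (1 / 2 :: real) ^ n)" by (rule summable_geometric) simp
    qed
    then have "Infinite_Set_Sum.abs_summable_on (\<lambda>k. atom_abs_moment (T k) i) UNIV"
      by (simp add: abs_summable_on_nat_iff')
    then have "Infinite_Set_Sum.abs_summable_on (\<lambda>(k, j). fst (T k ! j) * snd (T k ! j) ^ i) I"
      unfolding I_def
      by (subst abs_summable_on_Sigma_iff) (auto simp: atom_abs_moment_sum_nth)
    then show ?thesis by (simp add: c_def x_def case_prod_unfold)
  qed
  \<comment> \<open>The signs \<open>s\<close> select the positive and the negative part of the
    weights; both are dominated by the absolute values.\<close>
  have part: "Infinite_Set_Sum.abs_summable_on (\<lambda>p. max 0 (s * c p) * x p ^ i) I"
    if s: "s = 1 \<or> s = -1" for s i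
    by (rule abs_summable_on_comparison_test[OF sum[of i]])
      (use s in \<open>auto simp: abs_mult max_def intro!: mult_right_mono\<close>)
  have "\<exists>P. finite_measure P \<and> sets P = sets borel \<and>
    (\<forall>i. integrable P (\<lambda>y. y ^ i) \<and> (\<integral>y. y ^ i \<partial>P) = infsetsum (\<lambda>p. max 0 (s * c p) * x p ^ i) I)"
    if s: "s = 1 \<or> s = -1" for s
    using part[OF s] by (intro discrete_measure) simp_all
  from this[of 1] this[of "-1"] obtain P N where PN:
    "finite_measure P" "sets P = sets borel" "finite_measure N" "sets N = sets borel"
    "\<And>i::nat. integrable P (\<lambda>y. y ^ i)" "\<And>i::nat. integrable N (\<lambda>y. y ^ i)"
    "\<And>i. (\<integral>y. y ^ i \<partial>P) = infsetsum (\<lambda>p. max 0 (c p) * x p ^ i) I"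
    "\<And>i. (\<integral>y. y ^ i \<partial>N) = infsetsum (\<lambda>p. max 0 (- c p) * x p ^ i) I" by auto
  define \<sigma> where "\<sigma> = (\<lambda>A. measure P A - measure N A)"
  have \<sigma>: "is_difference_of \<sigma> P N" using PN by (auto simp: is_difference_of_def \<sigma>_def)
  have "signed_moment \<sigma> n = m n" for n
  proof -
    have sm: "Infinite_Set_Sum.abs_summable_on (\<lambda>p. max 0 (c p) * x p ^ n) I" "Infinite_Set_Sum.abs_summable_on (\<lambda>p. max 0 (- c p) * x p ^ n) I"
      using part[of 1 n] part[of "-1" n] by simp_all
    have "signed_moment \<sigma> n = infsetsum (\<lambda>p. max 0 (c p) * x p ^ n) I - infsetsum (\<lambda>p. max 0 (- c p) * x p ^ n) I"
      by (simp add: signed_moment_eq[OF \<sigma>] PN)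
    also have "\<dots> = infsetsum (\<lambda>p. max 0 (c p) * x p ^ n - max 0 (- c p) * x p ^ n) I"
      by (rule infsetsum_diff[OF sm, symmetric])
    also have "\<dots> = infsetsum (\<lambda>p. c p * x p ^ n) I"
      by (intro infsetsum_cong) (auto simp: max_def)
    also have "\<dots> = infsetsum (\<lambda>k. infsetsum (\<lambda>j. fst (T k ! j) * snd (T k ! j) ^ n) {..<length (T k)}) UNIV"
      using sum[of n] unfolding I_def by (subst infsetsum_Sigma) (auto simp: c_def x_def)
    also have "\<dots> = infsetsum (\<lambda>k. atom_moment (T k) n) UNIV"
      by (simp add: atom_moment_sum_nth)
    also have "\<dots> = infsetsum (\<lambda>k. atom_moment (T k) n) {..n}"
      by (intro infsetsum_cong_neutral) (auto simp: T(1))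
    also have "\<dots> = m n" by (simp add: T(3))
    finally show ?thesis .
  qed
  then show ?thesis using \<sigma> by (auto simp: signed_measure_def)
qed

section \<open>Determinacy of compactly supported signed measures\<close>

text \<open>A given decomposition may carry mass far out that cancels in the difference. Restricting
  both parts to an interval around the support leaves the difference unchanged.\<close>

lemma compactly_supported_decomposition:
  assumes "signed_measure \<sigma>" "compactly_supported \<sigma>"
  shows "\<exists>R P N. is_difference_of \<sigma> P N \<and> (AE x in P. \<bar>x\<bar> \<le> R) \<and> (AE x in N. \<bar>x\<bar> \<le> R)"
proof -
  obtain P N where PN: "is_difference_of \<sigma> P N" using assms(1) by (auto simp: signed_measure_def)
  obtain K where K: "compact K" "\<And>A. A \<in> sets borel \<Longrightarrow> A \<inter> K = {} \<Longrightarrow> \<sigma> A = 0"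
    using assms(2) by (auto simp: compactly_supported_def)
  obtain R where R: "\<And>x. x \<in> K \<Longrightarrow> \<bar>x\<bar> \<le> R"
    using compact_imp_bounded[OF K(1)] by (auto simp: bounded_iff)
  let ?I = "{-R..R}"
  let ?r = "\<lambda>Q. density Q (indicator ?I)"
  have r: "finite_measure (?r Q) \<and> (\<forall>n::nat. integrable (?r Q) (\<lambda>x. x ^ n)) \<and> (AE x in ?r Q. \<bar>x\<bar> \<le> R) \<and>
      (\<forall>A\<in>sets borel. measure (?r Q) A = measure Q (A \<inter> ?I))"
    if Q: "finite_measure Q" "sets Q = sets borel" "\<And>n::nat. integrable Q (\<lambda>x. x ^ n)" for Q :: "real measure"
  proof -
    have sp: "space Q = UNIV" using sets_eq_imp_space_eq[OF Q(2)] by simp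
    have I: "?I \<in> sets Q" using Q(2) by simp
    have em: "emeasure (?r Q) A = emeasure Q (A \<inter> ?I)" if "A \<in> sets borel" for A
      using that Q(2) I by (subst emeasure_density) (auto simp: nn_integral_indicator[symmetric] indicator_inter_arith mult.commute simp del: nn_integral_indicator)
    have "finite_measure (?r Q)"
    proof (rule finite_measureI)
      show "emeasure (?r Q) (space (?r Q)) \<noteq> \<infinity>"
        using em[of UNIV] finite_measure.emeasure_finite[OF Q(1)] by (simp add: sp)
    qed
    moreover have "integrable (?r Q) (\<lambda>x. x ^ n)" for n :: nat
    proof -
      have "integrable Q (\<lambda>x. indicator ?I x *\<^sub>R x ^ n)"
        using Q(3)[of n] I by (rule integrable_mult_indicator[rotated])
      moreover have "?r Q = density Q (\<lambda>x. ennreal (indicator ?I x))"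
        by (intro arg_cong2[where f = density] ext refl) (auto split: split_indicator)
      moreover have "(\<lambda>x. x ^ n) \<in> borel_measurable Q"
        using Q(3)[of n] by (rule borel_measurable_integrable)
      moreover have "(indicator ?I :: real \<Rightarrow> real) \<in> borel_measurable Q" using I by simp
      ultimately show ?thesis by (simp add: integrable_density)
    qed
    moreover have "AE x in ?r Q. \<bar>x\<bar> \<le> R"
      using I by (subst AE_density) (auto split: split_indicator)
    ultimately show ?thesis using em by (simp add: measure_def)
  qed
  note d = PN[unfolded is_difference_of_def]
  have rP: "finite_measure (?r P)" "\<And>n::nat. integrable (?r P) (\<lambda>x. x ^ n)" "AE x in ?r P. \<bar>x\<bar> \<le> R"
      "\<And>A. A \<in> sets borel \<Longrightarrow> measure (?r P) A = measure P (A \<inter> ?I)"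
    using r[of P] d by auto
  have rN: "finite_measure (?r N)" "\<And>n::nat. integrable (?r N) (\<lambda>x. x ^ n)" "AE x in ?r N. \<bar>x\<bar> \<le> R"
      "\<And>A. A \<in> sets borel \<Longrightarrow> measure (?r N) A = measure N (A \<inter> ?I)"
    using r[of N] d by auto
  have "\<sigma> A = measure (?r P) A - measure (?r N) A" for A
  proof (cases "A \<in> sets borel")
    case True
    have "\<sigma> (A - ?I) = 0"
    proof (rule K(2))
      show "A - ?I \<in> sets borel" using True by auto
      show "(A - ?I) \<inter> K = {}" using R by (auto simp: abs_le_iff) (metis minus_le_iff)
    qed
    moreover have "measure Q A = measure Q (A \<inter> ?I) + measure Q (A - ?I)"
      if "finite_measure Q" "sets Q = sets borel" for Q :: "real measure"
    proof -
      have "A = (A \<inter> ?I) \<union> (A - ?I)" "(A \<inter> ?I) \<inter> (A - ?I) = {}" by auto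
      then show ?thesis
        using finite_measure.finite_measure_Union[of Q "A \<inter> ?I" "A - ?I"] that True by simp
    qed
    ultimately show ?thesis
      using d rP(4)[OF True] rN(4)[OF True] by auto
  next
    case False
    then show ?thesis using d by (simp add: measure_notin_sets)
  qed
  then have "is_difference_of \<sigma> (?r P) (?r N)"
    using d rP rN by (auto simp: is_difference_of_def)
  then show ?thesis using rP(3) rN(3) by blast
qed

text \<open>Weierstrass approximation extends equality from monomials to continuous functions, a
  limit of continuous steps extends it to half-lines, and a Dynkin argument reaches all Borel
  sets.\<close>

lemma bounded_support_difference_zero:
  fixes P N P' N' :: "real measure"
  assumes fin: "finite_measure P" "finite_measure N" "finite_measure P'" "finite_measure N'"
    and s: "sets P = sets borel" "sets N = sets borel" "sets P' = sets borel" "sets N' = sets borel"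
    and b: "AE x in P. \<bar>x\<bar> \<le> R" "AE x in N. \<bar>x\<bar> \<le> R" "AE x in P'. \<bar>x\<bar> \<le> R" "AE x in N'. \<bar>x\<bar> \<le> R"
    and m: "\<And>n. (\<integral>x. x ^ n \<partial>P) - (\<integral>x. x ^ n \<partial>N) = (\<integral>x. x ^ n \<partial>P') - (\<integral>x. x ^ n \<partial>N')"
    and A: "A \<in> sets borel"
  shows "measure P A - measure N A = measure P' A - measure N' A"
proof -
  define D where "D = (\<lambda>f. (\<integral>x. f x \<partial>P) - (\<integral>x. f x \<partial>N) - (\<integral>x. f x \<partial>P') + (\<integral>x. f x \<partial>N') :: real)"
  let ?Qs = "{P, N, P', N'}"
  have Q: "finite_measure Q" "sets Q = sets borel" "AE x in Q. \<bar>x\<bar> \<le> R" if "Q \<in> ?Qs" for Q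
    using that fin s b by auto
  have int: "integrable Q f" if "Q \<in> ?Qs" "continuous_on UNIV f" for Q and f :: "real \<Rightarrow> real"
  proof -
    have "compact (f ` {-R..R})"
      using that(2) by (intro compact_continuous_image) (auto intro: continuous_on_subset)
    then have "bounded (f ` {-R..R})" by (rule compact_imp_bounded)
    then obtain B where "\<forall>y\<in>f ` {-R..R}. norm y \<le> B" unfolding bounded_iff by blast
    then have B: "\<bar>f x\<bar> \<le> B" if "x \<in> {-R..R}" for x using that by auto
    have "AE x in Q. norm (f x) \<le> B"
      using Q(3)[OF that(1)] by eventually_elim (use B in \<open>auto simp: abs_le_iff\<close>)
    moreover have "f \<in> borel_measurable Q"
      using borel_measurable_continuous_onI[OF that(2)] Q(2)[OF that(1)] by (simp cong: measurable_cong_sets)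
    ultimately show ?thesis
      using finite_measure.integrable_const_bound[OF Q(1)[OF that(1)]] by blast
  qed
  have cont0: "D f = 0" if f: "continuous_on UNIV f" for f
  proof -
    define M where "M = measure P UNIV + measure N UNIV + measure P' UNIV + measure N' UNIV"
    have M: "M \<ge> 0" by (simp add: M_def)
    \<comment> \<open>\<open>D\<close> vanishes on the approximating polynomial, so only the uniform
      error times the total mass of the four measures survives.\<close>
    have bound: "\<bar>D f\<bar> \<le> e * M" if e: "e > 0" for e
    proof -
      obtain g where g: "real_polynomial_function g" "\<And>x. x \<in> {-R..R} \<Longrightarrow> \<bar>f x - g x\<bar> < e"
        using Stone_Weierstrass_real_polynomial_function[of "{-R..R}" f e] e f
        by (auto intro: continuous_on_subset)
      then obtain a n where gs: "g = (\<lambda>x. \<Sum>i\<le>n. a i * x ^ i)"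
        using real_polynomial_function_iff_sum[of g] by blast
      have gc: "continuous_on UNIV g" unfolding gs by (intro continuous_intros)
      have gQ: "(\<integral>x. g x \<partial>Q) = (\<Sum>i\<le>n. a i * (\<integral>x. x ^ i \<partial>Q))" if "Q \<in> ?Qs" for Q
      proof -
        have "integrable Q (\<lambda>x. x ^ i)" for i :: nat
          by (rule int[OF that]) (intro continuous_intros)
        then show ?thesis
          unfolding gs by (subst Bochner_Integration.integral_sum) auto
      qed
      have "D g = (\<Sum>i\<le>n. a i * ((\<integral>x. x ^ i \<partial>P) - (\<integral>x. x ^ i \<partial>N) - (\<integral>x. x ^ i \<partial>P') + (\<integral>x. x ^ i \<partial>N')))"
        unfolding D_def by (simp add: gQ sum_subtractf sum.distrib algebra_simps)
      then have Dg: "D g = 0" using m by (simp add: algebra_simps)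
      have diff: "\<bar>(\<integral>x. f x \<partial>Q) - (\<integral>x. g x \<partial>Q)\<bar> \<le> e * measure Q UNIV" if "Q \<in> ?Qs" for Q
      proof -
        have sp: "space Q = UNIV" using sets_eq_imp_space_eq[OF Q(2)[OF that]] by simp
        have i: "integrable Q (\<lambda>x. f x - g x)"
          using int[OF that f] int[OF that gc] by simp
        have "(\<integral>x. f x \<partial>Q) - (\<integral>x. g x \<partial>Q) = (\<integral>x. f x - g x \<partial>Q)"
          using int[OF that f] int[OF that gc] by simp
        also have "\<bar>\<dots>\<bar> \<le> (\<integral>x. \<bar>f x - g x\<bar> \<partial>Q)"
          using integral_norm_bound[of Q "\<lambda>x. f x - g x"] by simp
        also have "\<dots> \<le> (\<integral>x. e \<partial>Q)"
        proof (rule integral_mono_AE)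
          show "integrable Q (\<lambda>x. \<bar>f x - g x\<bar>)" using i by simp
          show "integrable Q (\<lambda>x. e)" using finite_measure.integrable_const[OF Q(1)[OF that]] .
          show "AE x in Q. \<bar>f x - g x\<bar> \<le> e"
            using Q(3)[OF that] by eventually_elim (rule less_imp_le[OF g(2)], auto)
        qed
        also have "\<dots> = e * measure Q UNIV" using sp by simp
        finally show ?thesis .
      qed
      have "D f = D f - D g" by (simp add: Dg)
      also have "\<bar>\<dots>\<bar> \<le> e * M"
        using diff[of P] diff[of N] diff[of P'] diff[of N']
        unfolding D_def M_def distrib_left by simp
      finally show ?thesis .
    qed
    have "\<bar>D f\<bar> \<le> 0 + e" if "e > 0" for e
    proof -
      have "\<bar>D f\<bar> \<le> e / (M + 1) * M" using bound[of "e / (M + 1)"] that M by simp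
      also have "\<dots> \<le> e" using that M by (simp add: field_simps)
      finally show ?thesis by simp
    qed
    then have "\<bar>D f\<bar> \<le> 0" by (rule field_le_epsilon)
    then show ?thesis by simp
  qed
  have atMost: "D (indicator {..a}) = 0" for a
  proof -
    \<comment> \<open>\<open>cts_step\<close> is 1 up to its first argument and falls linearly to 0
      at the second, so these functions converge pointwise to the indicator of the closed
      half-line.\<close>
    define f where "f = (\<lambda>n::nat. cts_step a (a + 1 / Suc n))"
    have fc: "continuous_on UNIV (f n)" for n
      unfolding f_def by (intro uniformly_continuous_imp_continuous cts_step_uniformly_continuous) simp
    have lim: "(\<lambda>n. f n x) \<longlonglongrightarrow> indicator {..a} x" for x
    proof (cases "x \<le> a")
      case True
      then show ?thesis by (simp add: f_def cts_step_def)
    next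
      case False
      have "eventually (\<lambda>n. 1 / Suc n < x - a) sequentially"
        using order_tendstoD(2)[OF LIMSEQ_inverse_real_of_nat, of "x - a"] False
        by (simp add: inverse_eq_divide)
      then have "eventually (\<lambda>n. f n x = 0) sequentially"
        by eventually_elim (use False in \<open>auto simp: f_def cts_step_def\<close>)
      then show ?thesis using False by (simp add: tendsto_eventually)
    qed
    have "(\<lambda>n. \<integral>x. f n x \<partial>Q) \<longlonglongrightarrow> (\<integral>x. indicator {..a} x \<partial>Q)" if "Q \<in> ?Qs" for Q
    proof (rule integral_dominated_convergence[where w = "\<lambda>_. 1"])
      show "indicator {..a} \<in> borel_measurable Q"
        using Q(2)[OF that] by (simp cong: measurable_cong_sets)
      show "f n \<in> borel_measurable Q" for n using int[OF that fc] by (rule borel_measurable_integrable)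
      show "integrable Q (\<lambda>_. 1 :: real)" using finite_measure.integrable_const[OF Q(1)[OF that]] .
      show "AE x in Q. norm (f n x) \<le> 1" for n
      proof -
        have "norm (cts_step u v x) \<le> 1" if "u < v" for u v x
          using that by (auto simp: cts_step_def divide_simps)
        then show ?thesis by (simp add: f_def)
      qed
    qed (use lim in auto)
    then have "(\<lambda>n. D (f n)) \<longlonglongrightarrow> D (indicator {..a})"
      unfolding D_def by (intro tendsto_add tendsto_diff) auto
    moreover have "(\<lambda>n. D (f n)) = (\<lambda>n. 0)" using cont0[OF fc] by simp
    ultimately show ?thesis using LIMSEQ_unique tendsto_const by metis
  qed
  define d where "d = (\<lambda>A. measure P A - measure N A - measure P' A + measure N' A)"
  have dD: "d A = D (indicator A)" for A
    using s by (simp add: d_def D_def sets_eq_imp_space_eq[OF s(1)] sets_eq_imp_space_eq[OF s(2)]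
      sets_eq_imp_space_eq[OF s(3)] sets_eq_imp_space_eq[OF s(4)])
  have UNIV0: "d UNIV = 0" using cont0[of "\<lambda>_. 1"] unfolding dD by (simp add: indicator_def)
  have G: "sets borel = sigma_sets UNIV (range (\<lambda>a::real. {..a}))"
    using borel_eq_atMost[where 'a = real] by (metis sets_measure_of subset_UNIV Pow_UNIV)
  have "Int_stable (range (\<lambda>a::real. {..a}))" by (auto simp: Int_stable_def)
  moreover have "range (\<lambda>a::real. {..a}) \<subseteq> Pow UNIV" by simp
  ultimately have "d A = 0"
    using A unfolding G
  proof (induction A rule: sigma_sets_induct_disjoint)
    case (basic A)
    then show ?case using atMost by (auto simp: dD)
  next
    case empty
    then show ?case by (simp add: d_def)
  next
    case (compl A)
    then have B: "A \<in> sets borel" unfolding G by simp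
    have "measure Q (UNIV - A) = measure Q UNIV - measure Q A" if "Q \<in> ?Qs" for Q
      using finite_measure.finite_measure_compl[OF Q(1)[OF that], of A] Q(2)[OF that] B
        sets_eq_imp_space_eq[OF Q(2)[OF that]] by simp
    then show ?case using compl UNIV0 by (simp add: d_def)
  next
    case (union A)
    then have B: "range A \<subseteq> sets borel" unfolding G by auto
    have "(\<lambda>i. measure Q (A i)) sums measure Q (\<Union>i. A i)" if "Q \<in> ?Qs" for Q
      using finite_measure.finite_measure_UNION[OF Q(1)[OF that], of A] Q(2)[OF that] B union(1) by simp
    then have "(\<lambda>i. d (A i)) sums d (\<Union>i. A i)"
      unfolding d_def by (intro sums_add sums_diff) auto
    then show ?case using union(3) by (simp add: sums_iff)
  qed
  then show ?thesis by (simp add: d_def)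
qed

lemma compactly_supported_moments_unique:
  assumes "signed_measure \<sigma>" "compactly_supported \<sigma>" "signed_measure \<tau>" "compactly_supported \<tau>"
    and "\<And>n. signed_moment \<sigma> n = signed_moment \<tau> n"
  shows "\<sigma> = \<tau>"
proof
  fix A
  obtain R P N where \<sigma>: "is_difference_of \<sigma> P N" "AE x in P. \<bar>x\<bar> \<le> R" "AE x in N. \<bar>x\<bar> \<le> R"
    using compactly_supported_decomposition[OF assms(1,2)] by blast
  obtain R' P' N' where \<tau>: "is_difference_of \<tau> P' N'" "AE x in P'. \<bar>x\<bar> \<le> R'" "AE x in N'. \<bar>x\<bar> \<le> R'"
    using compactly_supported_decomposition[OF assms(3,4)] by blast
  note d = \<sigma>(1)[unfolded is_difference_of_def] \<tau>(1)[unfolded is_difference_of_def]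
  show "\<sigma> A = \<tau> A"
  proof (cases "A \<in> sets borel")
    case True
    have ae: "AE x in Q. \<bar>x\<bar> \<le> max R R'" if "(AE x in Q. \<bar>x\<bar> \<le> R) \<or> (AE x in Q. \<bar>x\<bar> \<le> R')" for Q :: "real measure"
      using that by (auto elim!: eventually_mono)
    have "measure P A - measure N A = measure P' A - measure N' A"
    proof (rule bounded_support_difference_zero[where R = "max R R'"])
      show "(\<integral>x. x ^ n \<partial>P) - (\<integral>x. x ^ n \<partial>N) = (\<integral>x. x ^ n \<partial>P') - (\<integral>x. x ^ n \<partial>N')" for n
        using assms(5)[of n] by (simp add: signed_moment_eq[OF \<sigma>(1)] signed_moment_eq[OF \<tau>(1)])
    qed (use d True \<sigma> \<tau> ae in auto)
    then show ?thesis using d by auto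
  next
    case False
    then show ?thesis using d by (simp add: measure_notin_sets)
  qed
qed

section \<open>Linear combinations of signed measures\<close>

lemma ex_sum_measure:
  fixes P Q :: "real measure"
  assumes fin: "finite_measure P" "finite_measure Q" and s: "sets P = sets borel" "sets Q = sets borel"
    and int: "\<And>n::nat. integrable P (\<lambda>x. x ^ n)" "\<And>n::nat. integrable Q (\<lambda>x. x ^ n)"
  shows "\<exists>S. finite_measure S \<and> sets S = sets borel \<and> (\<forall>A. measure S A = measure P A + measure Q A) \<and>
    (\<forall>n::nat. integrable S (\<lambda>x. x ^ n) \<and> (\<integral>x. x ^ n \<partial>S) = (\<integral>x. x ^ n \<partial>P) + (\<integral>x. x ^ n \<partial>Q))"
proof -
  define S where "S = measure_of UNIV (sets borel) (\<lambda>A. emeasure P A + emeasure Q A)"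
  have sS: "sets S = sets borel" and spS: "space S = UNIV"
    unfolding S_def by (simp_all add: sets.sigma_sets_eq[of borel, simplified])
  have em: "emeasure S A = emeasure P A + emeasure Q A" if "A \<in> sets borel" for A
    unfolding S_def
  proof (rule emeasure_measure_of_sigma)
    show "sigma_algebra UNIV (sets (borel :: real measure))"
      using sets.sigma_algebra_axioms[of "borel :: real measure"] by simp
    show "positive (sets borel) (\<lambda>A. emeasure P A + emeasure Q A)" by (simp add: positive_def)
    show "countably_additive (sets borel) (\<lambda>A. emeasure P A + emeasure Q A)"
    proof (rule countably_additiveI)
      fix A :: "nat \<Rightarrow> real set" assume A: "range A \<subseteq> sets borel" "disjoint_family A"
      show "(\<Sum>i. emeasure P (A i) + emeasure Q (A i)) =
          emeasure P (\<Union>i. A i) + emeasure Q (\<Union>i. A i)"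
        using A s by (subst suminf_add[symmetric]) (auto simp: suminf_emeasure)
    qed
  qed (use that in simp)
  have finS: "finite_measure S"
  proof (rule finite_measureI)
    show "emeasure S (space S) \<noteq> \<infinity>"
      using em[of UNIV] finite_measure.emeasure_finite[OF fin(1)] finite_measure.emeasure_finite[OF fin(2)]
      by (simp add: spS)
  qed
  have me: "measure S A = measure P A + measure Q A" for A
  proof (cases "A \<in> sets borel")
    case True
    then show ?thesis
      using em[OF True] finite_measure.emeasure_finite[OF fin(1), of A] finite_measure.emeasure_finite[OF fin(2), of A]
      by (simp add: measure_def enn2real_plus top.not_eq_extremum)
  next
    case False
    then show ?thesis using s sS by (simp add: measure_notin_sets)
  qed
  let ?Z = "null_measure borel :: real measure"
  have finZ: "finite_measure ?Z" by (intro finite_measureI) simp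
  \<comment> \<open>Additivity of the integral is the comparison of the decompositions
    \<open>S - Q\<close> and \<open>P - 0\<close> of one set function.\<close>
  have nn: "(\<integral>\<^sup>+x. f x \<partial>S) = (\<integral>\<^sup>+x. f x \<partial>P) + (\<integral>\<^sup>+x. f x \<partial>Q)" if "f \<in> borel_measurable borel" for f
  proof -
    have "(\<integral>\<^sup>+x. f x \<partial>S) + (\<integral>\<^sup>+x. f x \<partial>?Z) = (\<integral>\<^sup>+x. f x \<partial>P) + (\<integral>\<^sup>+x. f x \<partial>Q)"
      by (rule difference_nn_integral)
        (use s sS fin finS finZ me that in \<open>auto simp: measure_def[of ?Z]\<close>)
    moreover have "(\<integral>\<^sup>+x. f x \<partial>?Z) = 0" by (rule nn_integral_null_measure)
    ultimately show ?thesis by simp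
  qed
  have meas: "(\<lambda>x::real. ennreal (x ^ n)) \<in> borel_measurable borel"
    "(\<lambda>x::real. ennreal (- (x ^ n))) \<in> borel_measurable borel" for n by measurable
  have finite: "(\<integral>\<^sup>+x. ennreal (x ^ n) \<partial>R) < \<infinity>" "(\<integral>\<^sup>+x. ennreal (- (x ^ n)) \<partial>R) < \<infinity>"
    if "integrable R (\<lambda>x. x ^ n)" for R :: "real measure" and n
    using that by (auto simp: real_integrable_def top.not_eq_extremum)
  have iS: "integrable S (\<lambda>x. x ^ n)" for n :: nat
    unfolding real_integrable_def nn[OF meas(1)] nn[OF meas(2)]
    using finite[OF int(1)[of n]] finite[OF int(2)[of n]] sS
    by (auto simp: ennreal_add_eq_top cong: measurable_cong_sets)
  have "(\<integral>x. x ^ n \<partial>S) = (\<integral>x. x ^ n \<partial>P) + (\<integral>x. x ^ n \<partial>Q)" for n :: nat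
    unfolding real_lebesgue_integral_def[OF iS] real_lebesgue_integral_def[OF int(1)]
      real_lebesgue_integral_def[OF int(2)] nn[OF meas(1)] nn[OF meas(2)]
    using finite[OF int(1)[of n]] finite[OF int(2)[of n]] by (simp add: enn2real_plus)
  with finS sS me iS show ?thesis by blast
qed

lemma ex_half_measure:
  fixes P :: "real measure"
  assumes fin: "finite_measure P" and s: "sets P = sets borel"
    and int: "\<And>n::nat. integrable P (\<lambda>x. x ^ n)"
  shows "\<exists>S. finite_measure S \<and> sets S = sets borel \<and> (\<forall>A. measure S A = 1 / 2 * measure P A) \<and>
    (\<forall>n::nat. integrable S (\<lambda>x. x ^ n) \<and> (\<integral>x. x ^ n \<partial>S) = 1 / 2 * (\<integral>x. x ^ n \<partial>P))"
proof -
  let ?S = "density P (\<lambda>_. ennreal (1 / 2))"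
  have em: "emeasure ?S A = ennreal (1 / 2) * emeasure P A" if "A \<in> sets P" for A
    using that by (rule emeasure_density_const)
  have "finite_measure ?S"
  proof (rule finite_measureI)
    show "emeasure ?S (space ?S) \<noteq> \<infinity>"
      using em[of "space P"] finite_measure.emeasure_finite[OF fin, of "space P"]
      by (simp add: ennreal_mult_eq_top_iff)
  qed
  moreover have "measure ?S A = 1 / 2 * measure P A" for A
  proof (cases "A \<in> sets P")
    case True
    have "enn2real (ennreal (1 / 2)) = 1 / 2" by (rule enn2real_ennreal) simp
    then show ?thesis unfolding measure_def em[OF True] by (simp only: enn2real_mult)
  qed (simp add: measure_notin_sets)
  moreover have "integrable ?S (\<lambda>x. x ^ n)" for n :: nat
    using int[of n] by (subst integrable_real_density) auto
  moreover have "(\<integral>x. x ^ n \<partial>?S) = 1 / 2 * (\<integral>x. x ^ n \<partial>P)" for n :: nat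
    using int[of n] by (subst integral_real_density) auto
  ultimately show ?thesis using s by (intro exI[of _ ?S]) simp
qed

text \<open>The four parts are regrouped so that only sums of positive measures occur: half of
  \<open>P + N'\<close> minus half of \<open>N + P'\<close>.\<close>

lemma signed_measure_half_difference:
  assumes "signed_measure \<sigma>" "signed_measure \<tau>"
  defines "\<rho> \<equiv> \<lambda>A. 1 / 2 * (\<sigma> A - \<tau> A)"
  shows "signed_measure \<rho>" "signed_moment \<rho> n = 1 / 2 * (signed_moment \<sigma> n - signed_moment \<tau> n)"
proof -
  obtain P N P' N' where D: "is_difference_of \<sigma> P N" "is_difference_of \<tau> P' N'"
    using assms by (auto simp: signed_measure_def)
  note d = D(1)[unfolded is_difference_of_def] D(2)[unfolded is_difference_of_def]
  obtain S where S: "finite_measure S" "sets S = sets borel" "\<And>A. measure S A = measure P A + measure N' A"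
    "\<And>n::nat. integrable S (\<lambda>x. x ^ n)" "\<And>n::nat. (\<integral>x. x ^ n \<partial>S) = (\<integral>x. x ^ n \<partial>P) + (\<integral>x. x ^ n \<partial>N')"
    using ex_sum_measure[of P N'] d by auto
  obtain T where T: "finite_measure T" "sets T = sets borel" "\<And>A. measure T A = measure N A + measure P' A"
    "\<And>n::nat. integrable T (\<lambda>x. x ^ n)" "\<And>n::nat. (\<integral>x. x ^ n \<partial>T) = (\<integral>x. x ^ n \<partial>N) + (\<integral>x. x ^ n \<partial>P')"
    using ex_sum_measure[of N P'] d by auto
  obtain S' where S': "finite_measure S'" "sets S' = sets borel" "\<And>A. measure S' A = 1 / 2 * measure S A"
    "\<And>n::nat. integrable S' (\<lambda>x. x ^ n)" "\<And>n::nat. (\<integral>x. x ^ n \<partial>S') = 1 / 2 * (\<integral>x. x ^ n \<partial>S)"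
    using ex_half_measure[OF S(1,2,4)] by auto
  obtain T' where T': "finite_measure T'" "sets T' = sets borel" "\<And>A. measure T' A = 1 / 2 * measure T A"
    "\<And>n::nat. integrable T' (\<lambda>x. x ^ n)" "\<And>n::nat. (\<integral>x. x ^ n \<partial>T') = 1 / 2 * (\<integral>x. x ^ n \<partial>T)"
    using ex_half_measure[OF T(1,2,4)] by auto
  have \<sigma>\<tau>: "\<sigma> A = measure P A - measure N A" "\<tau> A = measure P' A - measure N' A" for A
    using d by simp_all
  have "\<rho> = (\<lambda>A. measure S' A - measure T' A)"
    unfolding \<rho>_def \<sigma>\<tau> S'(3) T'(3) S(3) T(3)
    by (intro ext) (simp add: diff_divide_distrib add_divide_distrib)
  then have \<rho>: "is_difference_of \<rho> S' T'"
    unfolding is_difference_of_def using S'(1,2,4) T'(1,2,4) by blast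
  then show "signed_measure \<rho>" by (auto simp: signed_measure_def)
  show "signed_moment \<rho> n = 1 / 2 * (signed_moment \<sigma> n - signed_moment \<tau> n)"
    unfolding signed_moment_eq[OF \<rho>] signed_moment_eq[OF D(1)] signed_moment_eq[OF D(2)]
    by (simp add: S'(5) T'(5) S(5) T(5) field_simps)
qed

lemma compactly_supported_half_difference:
  assumes "compactly_supported \<sigma>" "compactly_supported \<tau>"
  shows "compactly_supported (\<lambda>A. 1 / 2 * (\<sigma> A - \<tau> A))"
proof -
  obtain K L where K: "compact K" "\<forall>A\<in>sets borel. A \<inter> K = {} \<longrightarrow> \<sigma> A = 0"
    and L: "compact L" "\<forall>A\<in>sets borel. A \<inter> L = {} \<longrightarrow> \<tau> A = 0"
    using assms unfolding compactly_supported_def by blast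
  have "\<sigma> A = 0 \<and> \<tau> A = 0" if "A \<in> sets borel" "A \<inter> (K \<union> L) = {}" for A
    using K(2) L(2) that by (simp add: Int_Un_distrib)
  then show ?thesis
    unfolding compactly_supported_def using compact_Un[OF K(1) L(1)] by (intro exI[of _ "K \<union> L"]) simp
qed

section \<open>Expansions at infinity\<close>

text \<open>The dictionary between functions near infinity and series in \<open>X = 1/z\<close>;
  under it \<open>deriv\<close> corresponds to \<open>fps_deriv_inv\<close>.\<close>

definition expands_at_infinity :: "(complex \<Rightarrow> complex) \<Rightarrow> complex fps \<Rightarrow> bool" where
  "expands_at_infinity G f \<longleftrightarrow>
    fps_conv_radius f > 0 \<and> (\<forall>\<^sub>F z in at_infinity. G z = eval_fps f (inverse z))"

lemma eventually_inverse_conv_radius: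
  fixes f :: "complex fps"
  assumes "fps_conv_radius f > 0"
  shows "\<forall>\<^sub>F z in at_infinity. ereal (norm (inverse (z :: complex))) < fps_conv_radius f"
proof -
  have "\<forall>\<^sub>F w in at (0 :: complex). w \<in> eball 0 (fps_conv_radius f)"
    using assms by (intro eventually_at_in_open') (auto simp: zero_ereal_def)
  then show ?thesis by (simp add: at_to_infinity eventually_filtermap)
qed

lemma eventually_nonzero_at_infinity: "\<forall>\<^sub>F z in at_infinity. (z :: complex) \<noteq> 0"
  unfolding eventually_at_infinity by (intro exI[of _ 1]) auto

lemma expands_mult:
  assumes "expands_at_infinity G f" "expands_at_infinity H h"
  shows "expands_at_infinity (\<lambda>z. G z * H z) (f * h)"
proof -
  have "fps_conv_radius (f * h) > 0"
    using assms fps_conv_radius_mult[of f h]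
    by (auto simp: expands_at_infinity_def intro: less_le_trans[rotated])
  moreover have "\<forall>\<^sub>F z in at_infinity. G z * H z = eval_fps (f * h) (inverse z)"
    using assms[unfolded expands_at_infinity_def, THEN conjunct2]
      eventually_inverse_conv_radius[OF assms(1)[unfolded expands_at_infinity_def, THEN conjunct1]]
      eventually_inverse_conv_radius[OF assms(2)[unfolded expands_at_infinity_def, THEN conjunct1]]
    by eventually_elim (simp add: eval_fps_mult)
  ultimately show ?thesis by (simp add: expands_at_infinity_def)
qed

lemma expands_add:
  assumes "expands_at_infinity G f" "expands_at_infinity H h"
  shows "expands_at_infinity (\<lambda>z. G z + H z) (f + h)"
proof -
  have "fps_conv_radius (f + h) > 0"
    using assms fps_conv_radius_add[of f h]
    by (auto simp: expands_at_infinity_def intro: less_le_trans[rotated])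
  moreover have "\<forall>\<^sub>F z in at_infinity. G z + H z = eval_fps (f + h) (inverse z)"
    using assms[unfolded expands_at_infinity_def, THEN conjunct2]
      eventually_inverse_conv_radius[OF assms(1)[unfolded expands_at_infinity_def, THEN conjunct1]]
      eventually_inverse_conv_radius[OF assms(2)[unfolded expands_at_infinity_def, THEN conjunct1]]
    by eventually_elim (simp add: eval_fps_add)
  ultimately show ?thesis by (simp add: expands_at_infinity_def)
qed

lemma expands_uminus:
  assumes "expands_at_infinity G f"
  shows "expands_at_infinity (\<lambda>z. - G z) (- f)"
proof -
  have "\<forall>\<^sub>F z in at_infinity. - G z = eval_fps (- f) (inverse z)"
    using assms[unfolded expands_at_infinity_def, THEN conjunct2]
      eventually_inverse_conv_radius[OF assms[unfolded expands_at_infinity_def, THEN conjunct1]]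
    by eventually_elim (simp add: eval_fps_minus)
  then show ?thesis using assms by (simp add: expands_at_infinity_def)
qed

lemma expands_fps_X: "expands_at_infinity inverse fps_X"
  by (simp add: expands_at_infinity_def)

lemma expands_unique:
  assumes "expands_at_infinity G f" "expands_at_infinity H h" "\<forall>\<^sub>F z in at_infinity. G z = H z"
  shows "f = h"
proof -
  \<comment> \<open>The hypothesis says nothing at \<open>w = 0\<close>. After multiplication by
    \<open>X\<close> both sides vanish there, and equality extends to a full neighbourhood.\<close>
  note e = expands_mult[OF expands_fps_X assms(1)] expands_mult[OF expands_fps_X assms(2)]
  have "\<forall>\<^sub>F z in at_infinity. eval_fps (fps_X * f) (inverse z) = eval_fps (fps_X * h) (inverse z)"
    using e[unfolded expands_at_infinity_def, THEN conjunct2] assms(3) by eventually_elim metis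
  then have "\<forall>\<^sub>F w in at 0. eval_fps (fps_X * f) w = eval_fps (fps_X * h) w"
    by (simp add: at_to_infinity eventually_filtermap)
  then have "\<forall>\<^sub>F w in nhds 0. eval_fps (fps_X * f) w = eval_fps (fps_X * h) w"
    by (rule eventually_nhds_conv_at[THEN iffD2, OF conjI]) (simp add: eval_fps_at_0)
  then have "fps_X * f = fps_X * h"
    using e by (intro eval_fps_eqD) (auto simp: expands_at_infinity_def)
  then show ?thesis by simp
qed

text \<open>Cauchy transforms vanish at infinity themselves; the factor \<open>fps_X ^ k\<close>
  isolates that zero, and the rest is nonzero near it by continuity.\<close>

lemma expands_nonzero:
  assumes "expands_at_infinity G (fps_X ^ k * f)" "f $ 0 \<noteq> 0" "fps_conv_radius f > 0"
  shows "\<forall>\<^sub>F z in at_infinity. G z \<noteq> 0"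
proof -
  have "isCont (eval_fps f) 0"
    using assms(3) by (intro continuous_eval_fps) (simp add: zero_ereal_def)
  then have "\<forall>\<^sub>F w in at 0. eval_fps f w \<noteq> 0"
    using tendsto_imp_eventually_ne[of "eval_fps f" "f $ 0" "at 0" 0] assms(2)
    by (simp add: isCont_def eval_fps_at_0)
  then have ev: "\<forall>\<^sub>F z in at_infinity. eval_fps f (inverse z) \<noteq> 0"
    by (simp add: at_to_infinity eventually_filtermap)
  show ?thesis
    using assms(1)[unfolded expands_at_infinity_def, THEN conjunct2] ev
      eventually_inverse_conv_radius[OF assms(3)] eventually_nonzero_at_infinity
    by eventually_elim (simp add: eval_fps_mult)
qed

lemma expands_deriv:
  assumes "expands_at_infinity G f"
  shows "expands_at_infinity (deriv G) (fps_deriv_inv f)"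
proof -
  have r: "fps_conv_radius f > 0" using assms by (simp add: expands_at_infinity_def)
  then have r': "fps_conv_radius (fps_deriv f) > 0"
    using fps_conv_radius_deriv[of f] by (rule less_le_trans)
  have "fps_conv_radius (fps_deriv_inv f) > 0"
    unfolding fps_deriv_inv_def fps_conv_radius_uminus
    using fps_conv_radius_mult[of "fps_X ^ 2" "fps_deriv f"] r'
    by (auto intro: less_le_trans[rotated])
  moreover have "\<forall>\<^sub>F z in at_infinity. deriv G z = eval_fps (fps_deriv_inv f) (inverse z)"
  proof -
    have "\<forall>\<^sub>F z in at_infinity. G z = eval_fps f (inverse z) \<and> ereal (norm (inverse z)) < fps_conv_radius f \<and>
        ereal (norm (inverse z)) < fps_conv_radius (fps_deriv f)"
      using assms eventually_inverse_conv_radius[OF r] eventually_inverse_conv_radius[OF r']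
      by (auto simp: expands_at_infinity_def eventually_conj_iff)
    \<comment> \<open>Differentiation at \<open>z\<close> needs the expansion on a neighbourhood of
      \<open>z\<close>, so the eventual statement is turned into a bound, and \<open>z\<close> is
      kept at distance 1 from it.\<close>
    then obtain B where B: "\<And>z. norm z \<ge> B \<Longrightarrow> G z = eval_fps f (inverse z) \<and>
        ereal (norm (inverse z)) < fps_conv_radius f \<and> ereal (norm (inverse z)) < fps_conv_radius (fps_deriv f)"
      unfolding eventually_at_infinity by blast
    have "deriv G z = eval_fps (fps_deriv_inv f) (inverse z)" if z: "norm z \<ge> max 0 B + 1" for z
    proof -
      have z0: "z \<noteq> 0" "norm z \<ge> B" "norm z > max 0 B" using z by auto
      have "open (norm -` {max 0 B<..} :: complex set)"
        by (intro open_vimage continuous_intros)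
      then have "\<forall>\<^sub>F y in nhds z. y \<in> norm -` {max 0 B<..}"
        using z0 by (intro eventually_nhds_in_open) auto
      then have "\<forall>\<^sub>F y in nhds z. G y = eval_fps f (inverse y)"
        by (rule eventually_mono) (use B in auto)
      then have "deriv G z = deriv (\<lambda>y. eval_fps f (inverse y)) z"
        by (rule deriv_cong_ev) simp
      also have "\<dots> = eval_fps (fps_deriv f) (inverse z) * - (inverse z * inverse z)"
      proof (rule DERIV_imp_deriv)
        have "(inverse has_field_derivative - (inverse z * inverse z)) (at z)"
          using DERIV_inverse[OF z0(1), of UNIV] by (simp add: power2_eq_square)
        then show "((\<lambda>y. eval_fps f (inverse y)) has_field_derivative
            eval_fps (fps_deriv f) (inverse z) * - (inverse z * inverse z)) (at z)"
          using B[OF z0(2)] by (intro DERIV_chain2[OF has_field_derivative_eval_fps]) auto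
      qed
      also have "\<dots> = eval_fps (fps_deriv_inv f) (inverse z)"
      proof -
        have "ereal (norm (inverse z)) < fps_conv_radius (fps_X ^ 2 * fps_deriv f)"
          by (rule less_le_trans[OF _ fps_conv_radius_mult]) (use B[OF z0(2)] in simp)
        then have "eval_fps (fps_deriv_inv f) (inverse z) = - eval_fps (fps_X ^ 2 * fps_deriv f) (inverse z)"
          unfolding fps_deriv_inv_def by (rule eval_fps_minus)
        also have "eval_fps (fps_X ^ 2 * fps_deriv f) (inverse z) =
            inverse z ^ 2 * eval_fps (fps_deriv f) (inverse z)"
          using B[OF z0(2)] by (subst eval_fps_mult) simp_all
        finally show ?thesis by (simp add: power2_eq_square)
      qed
      finally show ?thesis .
    qed
    then show ?thesis unfolding eventually_at_infinity by blast
  qed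
  ultimately show ?thesis by (simp add: expands_at_infinity_def)
qed

lemma sums_at_infinity:
  fixes f :: "complex fps"
  assumes "fps_conv_radius f > 0"
  shows "\<forall>\<^sub>F z in at_infinity. (\<lambda>n. f $ n / z ^ n) sums eval_fps f (inverse z)"
  using eventually_inverse_conv_radius[OF assms]
proof eventually_elim
  case (elim z)
  have "(\<lambda>n. f $ n * inverse z ^ n) sums eval_fps f (inverse z)"
    using elim by (rule sums_eval_fps)
  then show ?case by (simp add: power_inverse divide_inverse)
qed

definition moment_fps :: "(real set \<Rightarrow> real) \<Rightarrow> complex fps" where
  "moment_fps \<sigma> = Abs_fps (\<lambda>n. of_real (signed_moment \<sigma> n))"

lemma expands_cauchy_transform:
  assumes "fps_conv_radius (moment_fps \<sigma>) > 0"
  shows "expands_at_infinity (cauchy_transform \<sigma>) (fps_X * moment_fps \<sigma>)"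
    and "\<forall>\<^sub>F z in at_infinity. summable (\<lambda>n. of_real (signed_moment \<sigma> n) / z ^ (n + 1) :: complex)"
proof -
  have r: "fps_conv_radius (fps_X * moment_fps \<sigma>) > 0"
    using fps_conv_radius_mult[of fps_X "moment_fps \<sigma>"] assms by (auto intro: less_le_trans[rotated])
  have "\<forall>\<^sub>F z in at_infinity. (\<lambda>n. of_real (signed_moment \<sigma> n) / z ^ (n + 1)) sums
      eval_fps (fps_X * moment_fps \<sigma>) (inverse z)"
    using sums_at_infinity[OF r]
  proof eventually_elim
    case (elim z)
    then show ?case
      using sums_Suc_iff[of "\<lambda>n. (fps_X * moment_fps \<sigma>) $ n / z ^ n"] by (simp add: moment_fps_def)
  qed
  then show "expands_at_infinity (cauchy_transform \<sigma>) (fps_X * moment_fps \<sigma>)"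
    "\<forall>\<^sub>F z in at_infinity. summable (\<lambda>n. of_real (signed_moment \<sigma> n) / z ^ (n + 1) :: complex)"
    using r by (auto simp: expands_at_infinity_def cauchy_transform_def sums_iff elim: eventually_mono)
qed

text \<open>A single nonzero point of convergence forces a positive radius, so the summability in
  \<open>is_inverse_markov\<close> is enough to work with power series.\<close>

lemma moment_fps_conv_radius:
  assumes "\<forall>\<^sub>F z in at_infinity. summable (\<lambda>n. of_real (signed_moment \<sigma> n) / z ^ (n + 1) :: complex)"
  shows "fps_conv_radius (moment_fps \<sigma>) > 0"
proof -
  obtain z :: complex where z: "summable (\<lambda>n. of_real (signed_moment \<sigma> n) / z ^ (n + 1))" "z \<noteq> 0"
    using eventually_happens[OF eventually_conj[OF assms eventually_nonzero_at_infinity]]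
    by (auto simp: trivial_limit_at_infinity)
  have "summable (\<lambda>n. z * (of_real (signed_moment \<sigma> n) / z ^ (n + 1)))"
    using z(1) by (rule summable_mult)
  then have "summable (\<lambda>n. moment_fps \<sigma> $ n * inverse z ^ n)"
    using z(2) by (simp add: moment_fps_def field_simps)
  then have "ereal (norm (inverse z)) \<le> fps_conv_radius (moment_fps \<sigma>)"
    unfolding fps_conv_radius_def by (rule conv_radius_geI)
  moreover have "0 < ereal (norm (inverse z))" using z(2) by simp
  ultimately show ?thesis by (rule less_le_trans[rotated])
qed

section \<open>The inverse Markov transform\<close>

text \<open>The series are complex, but only a real sequence can be realized as moments of a signed
  measure.\<close>

definition real_fps :: "complex fps \<Rightarrow> bool" where
  "real_fps f \<longleftrightarrow> (\<forall>n. f $ n \<in> \<real>)"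

lemma real_fps_inverse:
  assumes "real_fps f" "f $ 0 \<noteq> 0"
  shows "real_fps (inverse f)"
proof -
  have "inverse f $ n \<in> \<real>" for n
  proof (induction n rule: less_induct)
    case (less n)
    have "(inverse f * f) $ n = (\<Sum>i\<in>{0..n} - {n}. inverse f $ i * f $ (n - i)) + inverse f $ n * f $ 0"
      unfolding fps_mult_nth by (simp add: sum.remove[of _ n])
    moreover have "inverse f * f = 1" using assms(2) by (rule inverse_mult_eq_1)
    ultimately have "inverse f $ n = (1 $ n - (\<Sum>i\<in>{0..n} - {n}. inverse f $ i * f $ (n - i))) / f $ 0"
      using assms(2) by (simp add: field_simps)
    also have "\<dots> \<in> \<real>"
      using assms(1) less by (auto simp: real_fps_def intro!: Reals_divide Reals_diff sum_in_Reals Reals_mult)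
    finally show ?case .
  qed
  then show ?thesis by (simp add: real_fps_def)
qed

lemma real_fps_mult: "real_fps f \<Longrightarrow> real_fps g \<Longrightarrow> real_fps (f * g)"
  by (auto simp: real_fps_def fps_mult_nth intro!: sum_in_Reals Reals_mult)

text \<open>If \<open>G\<close> expands as \<open>X M\<close>, its derivative expands as
  \<open>- X^2 (M + X M')\<close>; hence \<open>- G' / G\<close> expands as \<open>X\<close> times
  this series.\<close>

definition markov_fps :: "complex fps \<Rightarrow> complex fps" where
  "markov_fps M = (M + fps_X * fps_deriv M) * inverse M"

lemma markov_fps_mult:
  assumes "M $ 0 = 1"
  shows "(fps_X * markov_fps M) * (fps_X * M) = - fps_deriv_inv (fps_X * M)"
proof -
  have "inverse M * M = 1" using assms by (intro inverse_mult_eq_1) simp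
  then have "(fps_X * markov_fps M) * (fps_X * M) = fps_X ^ 2 * (M + fps_X * fps_deriv M)"
    by (simp add: markov_fps_def power2_eq_square mult_ac)
  then show ?thesis by (simp add: fps_deriv_inv_def algebra_simps)
qed

text \<open>Mass 1 is preserved, which allows the transform to be iterated.\<close>

lemma markov_fps_0: "M $ 0 = 1 \<Longrightarrow> markov_fps M $ 0 = 1"
  by (simp add: markov_fps_def)

lemma markov_fps_conv_radius:
  assumes "M $ 0 = 1" "fps_conv_radius M > 0"
  shows "fps_conv_radius (markov_fps M) > 0"
proof -
  have "fps_conv_radius (fps_deriv M) > 0" using assms(2) fps_conv_radius_deriv[of M] by (rule less_le_trans)
  then have "fps_conv_radius (fps_X * fps_deriv M) > 0"
    using fps_conv_radius_mult[of fps_X "fps_deriv M"] by (auto intro: less_le_trans[rotated])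
  then have "fps_conv_radius (M + fps_X * fps_deriv M) > 0"
    using fps_conv_radius_add[of M "fps_X * fps_deriv M"] assms(2) by (auto intro: less_le_trans[rotated])
  moreover have "fps_conv_radius (inverse M) > 0"
    using assms by (intro fps_conv_radius_inverse_pos) auto
  ultimately show ?thesis
    unfolding markov_fps_def
    using fps_conv_radius_mult[of "M + fps_X * fps_deriv M" "inverse M"] by (auto intro: less_le_trans[rotated])
qed

lemma real_fps_markov: "real_fps M \<Longrightarrow> M $ 0 = 1 \<Longrightarrow> real_fps (markov_fps M)"
  unfolding markov_fps_def
  by (intro real_fps_mult real_fps_inverse)
    (auto simp: real_fps_def fps_X_mult_nth simp del: of_nat_Suc intro!: Reals_add Reals_mult)

text \<open>The required moments are the real coefficients of \<open>markov_fps\<close>, realized by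
  Boas' theorem; their positive radius of convergence gives back the functional identity.\<close>

lemma ex_inverse_markov:
  assumes \<sigma>: "signed_measure \<sigma>" and r: "fps_conv_radius (moment_fps \<sigma>) > 0" and m0: "moment_fps \<sigma> $ 0 = 1"
  shows "\<exists>\<tau>. is_inverse_markov \<sigma> \<tau>"
proof -
  let ?M = "moment_fps \<sigma>" and ?N = "markov_fps (moment_fps \<sigma>)"
  have "real_fps ?M" by (simp add: real_fps_def moment_fps_def)
  then have N: "real_fps ?N" using real_fps_markov m0 by blast
  obtain \<tau> where \<tau>: "signed_measure \<tau>" "\<And>n. signed_moment \<tau> n = Re (?N $ n)"
    using ex_signed_measure_moments[of "\<lambda>n. Re (?N $ n)"] by blast
  have m\<tau>: "moment_fps \<tau> = ?N"
    using N by (auto simp: fps_eq_iff moment_fps_def \<tau>(2) real_fps_def)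
  have r\<tau>: "fps_conv_radius (moment_fps \<tau>) > 0"
    unfolding m\<tau> by (rule markov_fps_conv_radius[OF m0 r])
  note e\<sigma> = expands_cauchy_transform[OF r] and e\<tau> = expands_cauchy_transform[OF r\<tau>]
  have "fps_X * moment_fps \<tau> * (fps_X * ?M) = - fps_deriv_inv (fps_X * ?M)"
    unfolding m\<tau> by (rule markov_fps_mult[OF m0])
  then have eq: "\<forall>\<^sub>F z in at_infinity. cauchy_transform \<tau> z * cauchy_transform \<sigma> z = - deriv (cauchy_transform \<sigma>) z"
    using expands_mult[OF e\<tau>(1) e\<sigma>(1)] expands_uminus[OF expands_deriv[OF e\<sigma>(1)]]
    by (auto simp: expands_at_infinity_def elim: eventually_elim2)
  have nz: "\<forall>\<^sub>F z in at_infinity. cauchy_transform \<sigma> z \<noteq> 0"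
    using expands_nonzero[of _ 1 ?M] e\<sigma>(1) r m0 by simp
  have "\<forall>\<^sub>F z in at_infinity.
        summable (\<lambda>n. of_real (signed_moment \<sigma> n) / z ^ (n + 1)) \<and>
        summable (\<lambda>n. of_real (signed_moment \<tau> n) / z ^ (n + 1)) \<and>
        cauchy_transform \<sigma> z \<noteq> 0 \<and>
        cauchy_transform \<tau> z = - deriv (cauchy_transform \<sigma>) z / cauchy_transform \<sigma> z"
    using eq nz e\<sigma>(2) e\<tau>(2) by eventually_elim (simp add: field_simps)
  then show ?thesis using \<sigma> \<tau>(1) by (auto simp: is_inverse_markov_def)
qed

text \<open>Uniqueness of expansions turns the relation between functions into one between series.
  So all admissible \<open>\<tau>\<close> share their moments, even where \<open>\<tau>\<close>
  itself is not determined.\<close>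

lemma inverse_markov_moment_fps:
  assumes M: "is_inverse_markov \<sigma> \<tau>" and m0: "moment_fps \<sigma> $ 0 = 1"
  shows "fps_conv_radius (moment_fps \<sigma>) > 0" "moment_fps \<tau> = markov_fps (moment_fps \<sigma>)"
proof -
  have ev: "\<forall>\<^sub>F z in at_infinity.
        summable (\<lambda>n. of_real (signed_moment \<sigma> n) / z ^ (n + 1) :: complex) \<and>
        summable (\<lambda>n. of_real (signed_moment \<tau> n) / z ^ (n + 1) :: complex) \<and>
        cauchy_transform \<sigma> z \<noteq> 0 \<and>
        cauchy_transform \<tau> z = - deriv (cauchy_transform \<sigma>) z / cauchy_transform \<sigma> z"
    using M by (simp add: is_inverse_markov_def)
  show r: "fps_conv_radius (moment_fps \<sigma>) > 0"
    by (rule moment_fps_conv_radius) (use ev in \<open>auto elim: eventually_mono\<close>)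
  have r\<tau>: "fps_conv_radius (moment_fps \<tau>) > 0"
    by (rule moment_fps_conv_radius) (use ev in \<open>auto elim: eventually_mono\<close>)
  note e\<sigma> = expands_cauchy_transform(1)[OF r] and e\<tau> = expands_cauchy_transform(1)[OF r\<tau>]
  have eq: "\<forall>\<^sub>F z in at_infinity. cauchy_transform \<tau> z * cauchy_transform \<sigma> z = - deriv (cauchy_transform \<sigma>) z"
    using ev by eventually_elim (simp add: field_simps)
  have "fps_X * moment_fps \<tau> * (fps_X * moment_fps \<sigma>) = - fps_deriv_inv (fps_X * moment_fps \<sigma>)"
    by (rule expands_unique[OF expands_mult[OF e\<tau> e\<sigma>] expands_uminus[OF expands_deriv[OF e\<sigma>]] eq])
  also have "\<dots> = (fps_X * markov_fps (moment_fps \<sigma>)) * (fps_X * moment_fps \<sigma>)"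
    by (rule markov_fps_mult[OF m0, symmetric])
  finally have "fps_X * moment_fps \<tau> = fps_X * markov_fps (moment_fps \<sigma>)"
    using m0 by (subst (asm) mult_right_cancel) auto
  then show "moment_fps \<tau> = markov_fps (moment_fps \<sigma>)" by simp
qed

section \<open>The linear equation for the first-order correction\<close>

text \<open>Differentiating \<open>g = X (1 + W(g))\<close> gives \<open>n (1 - X W'(g)) = X\<close> for \<open>n = - Dg / g\<close>; a second
  differentiation expresses \<open>n - r\<close>, where \<open>r = - Dn / n\<close>, through \<open>W''(g) Dg\<close>.\<close>

lemma infinitesimal_fps_equation:
  fixes g n r W :: "complex fps"
  assumes g: "g = fps_X * (1 + (W oo g))" and g0: "g \<noteq> 0" and n0: "n \<noteq> 0"
    and n: "n * g = - fps_deriv_inv g" and r: "r * n = - fps_deriv_inv n"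
  defines "f \<equiv> fps_const (1 / 2) * (n - r)"
  shows "f = fps_X * ((fps_deriv W oo g) * f +
    fps_const (1 / 2) * ((fps_deriv (fps_deriv W) oo g) * fps_deriv_inv g))"
proof -
  define W1 where "W1 = fps_deriv W oo g"
  define W2 where "W2 = fps_deriv (fps_deriv W) oo g"
  define D where "D = fps_deriv_inv g"
  have gnth: "g $ 0 = 0" by (subst g) simp
  have DX: "fps_deriv_inv fps_X = - (fps_X * fps_X)" by (simp add: fps_deriv_inv_def power2_eq_square)
  have D_add: "fps_deriv_inv (a + b) = fps_deriv_inv a + fps_deriv_inv b"
    and D_diff: "fps_deriv_inv (a - b) = fps_deriv_inv a - fps_deriv_inv b" for a b
    by (simp_all add: fps_deriv_inv_def algebra_simps)
  have D1: "fps_deriv_inv 1 = 0" by (simp add: fps_deriv_inv_def)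
  have "D = fps_deriv_inv fps_X * (1 + (W oo g)) + fps_X * (W1 * D)"
    unfolding D_def W1_def
    by (subst g) (simp add: fps_deriv_inv_mult D_add D1 fps_deriv_inv_compose[OF gnth])
  also have "fps_deriv_inv fps_X * (1 + (W oo g)) = - (fps_X * (fps_X * (1 + (W oo g))))"
    by (simp add: DX mult.assoc)
  also have "fps_X * (1 + (W oo g)) = g" using g by simp
  finally have "D * (1 - fps_X * W1) = - (fps_X * g)" by (simp add: algebra_simps)
  then have "(n * (1 - fps_X * W1)) * g = fps_X * g"
    using n by (simp add: D_def algebra_simps)
  then have n1: "n * (1 - fps_X * W1) = fps_X" using g0 by simp
  \<comment> \<open>The second differentiation, applied to the identity \<open>n1\<close>.\<close>
  have "fps_deriv_inv n * (1 - fps_X * W1) + n * (fps_X * fps_X * W1 - fps_X * (W2 * D)) = - (fps_X * fps_X)"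
  proof -
    have "fps_deriv_inv (n * (1 - fps_X * W1)) =
        fps_deriv_inv n * (1 - fps_X * W1) + n * (fps_X * fps_X * W1 - fps_X * (W2 * D))"
      unfolding fps_deriv_inv_mult D_diff D1 DX W1_def W2_def D_def fps_deriv_inv_compose[OF gnth]
      by (simp add: algebra_simps)
    then show ?thesis by (simp only: n1 DX)
  qed
  moreover have "fps_deriv_inv n = - (r * n)" using r by simp
  ultimately have "fps_X * r = fps_X * (fps_X + n * (fps_X * W1 - W2 * D))"
    using n1 by algebra
  then have r1: "r = fps_X + n * (fps_X * W1 - W2 * D)" by simp
  have "n - r = n * (1 - fps_X * W1) - fps_X + n * (W2 * D)"
    unfolding r1 by (simp add: algebra_simps)
  then have "n - r = n * (W2 * D)" by (simp add: n1)
  \<comment> \<open>The factor \<open>1 - X W'(g)\<close> cancels \<open>n\<close> on the right by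
    \<open>n1\<close>, which leaves an equation linear in \<open>n - r\<close>.\<close>
  then have "(n - r) * (1 - fps_X * W1) = n * (1 - fps_X * W1) * (W2 * D)" by (simp add: mult_ac)
  then have "(n - r) * (1 - fps_X * W1) = fps_X * (W2 * D)" by (simp only: n1)
  then have "n - r = fps_X * (W1 * (n - r) + W2 * D)" by (simp add: algebra_simps)
  then have "f = fps_const (1 / 2) * (fps_X * (W1 * (n - r) + W2 * D))" unfolding f_def by simp
  also have "\<dots> = fps_X * (W1 * f + fps_const (1 / 2) * (W2 * D))"
    unfolding f_def by (simp add: algebra_simps)
  finally show ?thesis by (simp only: W1_def W2_def D_def)
qed

lemma compactly_supported_prob_moments:
  assumes "prob_space \<mu>" "sets \<mu> = sets borel" "compactly_supported (measure \<mu>)"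
  shows "\<And>n::nat. integrable \<mu> (\<lambda>x. x ^ n)" "signed_measure (measure \<mu>)"
    "\<And>n. signed_moment (measure \<mu>) n = (\<integral>x. x ^ n \<partial>\<mu>)"
    "fps_conv_radius (moment_fps (measure \<mu>)) > 0" "moment_fps (measure \<mu>) $ 0 = 1"
proof -
  interpret prob_space \<mu> by fact
  have sp: "space \<mu> = UNIV" using sets_eq_imp_space_eq[OF assms(2)] by simp
  obtain K where K: "compact K" "\<And>A. A \<in> sets borel \<Longrightarrow> A \<inter> K = {} \<Longrightarrow> measure \<mu> A = 0"
    using assms(3) by (auto simp: compactly_supported_def)
  have "bounded K" using K(1) by (rule compact_imp_bounded)
  then obtain C where "\<forall>x\<in>K. norm x \<le> C" unfolding bounded_iff by blast
  then have C: "\<And>x. x \<in> K \<Longrightarrow> \<bar>x\<bar> \<le> max 1 C" by fastforce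
  define B where "B = max 1 C"
  have "closed K" using K(1) by (rule compact_imp_closed)
  then have "UNIV - K \<in> sets borel" by (metis borel_open open_Diff open_UNIV)
  then have "UNIV - K \<in> null_sets \<mu>"
    using K(2)[of "UNIV - K"] assms(2) by (auto simp: null_sets_def emeasure_eq_measure)
  then have AE: "AE x in \<mu>. \<bar>x\<bar> \<le> B"
    by (rule AE_I') (use C in \<open>auto simp: B_def\<close>)
  have AEn: "AE x in \<mu>. norm (x ^ n) \<le> B ^ n" for n :: nat
    using AE by eventually_elim (simp add: power_abs power_mono)
  have meas: "(\<lambda>x. x ^ n) \<in> borel_measurable \<mu>" for n :: nat
    using assms(2) by (simp cong: measurable_cong_sets)
  show int: "integrable \<mu> (\<lambda>x. x ^ n)" for n :: nat
    by (rule integrable_const_bound[OF AEn meas])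
  show mom: "signed_moment (measure \<mu>) n = (\<integral>x. x ^ n \<partial>\<mu>)" for n
    by (rule signed_moment_measure[OF finite_measure_axioms assms(2) int])
  let ?Z = "null_measure borel :: real measure"
  have "integrable ?Z (\<lambda>x. x ^ k)" for k :: nat
    by (rule integrableI_bounded) (auto cong: measurable_cong_sets)
  moreover have "finite_measure ?Z" by (intro finite_measureI) simp
  ultimately have "is_difference_of (measure \<mu>) \<mu> ?Z"
    using assms(2) int finite_measure_axioms by (simp add: is_difference_of_def measure_def fun_eq_iff)
  then show "signed_measure (measure \<mu>)" by (auto simp: signed_measure_def)
  show "moment_fps (measure \<mu>) $ 0 = 1"
    using prob_space by (simp add: moment_fps_def mom sp)
  have bound: "\<bar>\<integral>x. x ^ n \<partial>\<mu>\<bar> \<le> B ^ n" for n :: nat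
  proof -
    have "\<bar>\<integral>x. x ^ n \<partial>\<mu>\<bar> \<le> (\<integral>x. norm (x ^ n) \<partial>\<mu>)" using integral_norm_bound[of \<mu> "\<lambda>x. x ^ n"] by simp
    also have "\<dots> \<le> (\<integral>x. B ^ n \<partial>\<mu>)"
      using int[of n] AEn by (intro integral_mono_AE) auto
    also have "\<dots> = B ^ n" using prob_space by simp
    finally show ?thesis .
  qed
  have "B \<ge> 1" by (simp add: B_def)
  \<comment> \<open>The moments are bounded by \<open>B ^ n\<close>, so the point
    \<open>1 / (2 * B)\<close> gives a geometric majorant; the maximum with 1 in \<open>B\<close>
    keeps the point well defined.\<close>
  have "summable (\<lambda>n. moment_fps (measure \<mu>) $ n * of_real (1 / (2 * B)) ^ n)"
  proof (rule summable_comparison_test)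
    show "summable (\<lambda>n. (1 / 2 :: real) ^ n)" by (rule summable_geometric) simp
    have "norm (moment_fps (measure \<mu>) $ n * of_real (1 / (2 * B)) ^ n) \<le> (1 / 2) ^ n" for n
    proof -
      have "norm (moment_fps (measure \<mu>) $ n * of_real (1 / (2 * B)) ^ n) =
          \<bar>\<integral>x. x ^ n \<partial>\<mu>\<bar> * (1 / (2 * B)) ^ n"
        using \<open>B \<ge> 1\<close> by (simp add: moment_fps_def mom norm_mult norm_power norm_divide)
      also have "\<dots> \<le> B ^ n * (1 / (2 * B)) ^ n"
        using bound[of n] \<open>B \<ge> 1\<close> by (intro mult_right_mono) auto
      also have "\<dots> = (1 / 2) ^ n" using \<open>B \<ge> 1\<close> by (simp add: power_mult_distrib[symmetric])
      finally show ?thesis .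
    qed
    then show "\<exists>N. \<forall>n\<ge>N. norm (moment_fps (measure \<mu>) $ n * of_real (1 / (2 * B)) ^ n) \<le> (1 / 2) ^ n"
      by blast
  qed
  then have "ereal (norm (of_real (1 / (2 * B)) :: complex)) \<le> fps_conv_radius (moment_fps (measure \<mu>))"
    unfolding fps_conv_radius_def by (rule conv_radius_geI)
  moreover have "0 < ereal (norm (of_real (1 / (2 * B)) :: complex))" using \<open>B \<ge> 1\<close> by simp
  ultimately show "fps_conv_radius (moment_fps (measure \<mu>)) > 0" by (rule less_le_trans[rotated])
qed

lemma free_cumulant_series:
  assumes "free_cumulants \<mu> \<kappa>" "prob_space \<mu>"
  defines "M \<equiv> Abs_fps (\<lambda>n. of_real (\<integral>x. x ^ n \<partial>\<mu>)) :: complex fps"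
  shows "M = 1 + (Abs_fps (\<lambda>n. if n = 0 then 0 else of_real (\<kappa> n)) oo (fps_X * M))"
proof -
  have "M = Abs_fps (\<lambda>n. nc_sum (\<lambda>n. of_real (\<kappa> n)) 0 0 n)"
  proof (rule fps_ext)
    fix n
    show "M $ n = Abs_fps (\<lambda>n. nc_sum (\<lambda>n. of_real (\<kappa> n)) 0 0 n) $ n"
    proof (cases "n = 0")
      \<comment> \<open>\<open>free_cumulants\<close> concerns \<open>n \<ge> 1\<close>; the zeroth
        moment comes from the total mass.\<close>
      case True
      then show ?thesis by (simp add: M_def nc_sum_empty prob_space.prob_space[OF assms(2)])
    next
      case False
      have "{1..<1 + n} = {1..n}" by auto
      then have "nc_sum (\<lambda>n. of_real (\<kappa> n)) 0 1 (1 + n) =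
          of_real (\<Sum>\<pi> | partition_on {1..n} \<pi> \<and> noncrossing \<pi>. \<Prod>V\<in>\<pi>. \<kappa> (card V))"
        unfolding nc_sum_def nc_partitions_def by simp
      also have "\<dots> = M $ n"
        using assms(1) False by (simp add: free_cumulants_def M_def)
      finally show ?thesis using nc_sum_shift[of _ 0 1 n] by simp
    qed
  qed
  then show ?thesis using free_moment_series by metis
qed

theorem theorem1p6:
  fixes \<mu> :: "real measure" and \<kappa> :: "nat \<Rightarrow> real" and p :: "nat \<Rightarrow> complex poly"
  assumes "prob_space \<mu>" and "sets \<mu> = sets borel"
    and "compactly_supported (measure \<mu>)"
    and "free_cumulants \<mu> \<kappa>"
    and "\<And>d. d \<ge> 1 \<Longrightarrow> degree (p d) = d \<and> lead_coeff (p d) = 1"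
    and "\<And>d n. 1 \<le> n \<Longrightarrow> n \<le> d \<Longrightarrow> finite_free_cumulant (p d) n = of_real (\<kappa> n)"
  shows
    "(\<exists>\<mu>'. infinitesimal_distribution p \<mu> \<mu>') \<and>
     (let G = cauchy_transform (measure \<mu>) in
       \<forall>\<^sub>F z in at_infinity.
         summable (inf_cauchy_term p z) \<and> G z \<noteq> 0 \<and> deriv G z \<noteq> 0 \<and>
         inf_cauchy_transform p z = deriv (deriv G) z / (2 * deriv G z) - deriv G z / G z) \<and>
     (\<exists>\<nu>. is_inverse_markov (measure \<mu>) \<nu>) \<and>
     (\<forall>\<nu>. is_inverse_markov (measure \<mu>) \<nu> \<longrightarrow> (\<exists>\<rho>. is_inverse_markov \<nu> \<rho>)) \<and>
     (\<forall>\<nu> \<rho>. is_inverse_markov (measure \<mu>) \<nu> \<and> is_inverse_markov \<nu> \<rho> \<longrightarrow>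
        infinitesimal_distribution p \<mu> (\<lambda>A. 1 / 2 * (\<nu> A - \<rho> A)) \<and>
        (\<forall>\<mu>'. infinitesimal_distribution p \<mu> \<mu>' \<longrightarrow>
           (\<forall>n. signed_moment \<mu>' n = 1 / 2 * (signed_moment \<nu> n - signed_moment \<rho> n)) \<and>
           (compactly_supported \<mu>' \<and> compactly_supported \<nu> \<and> compactly_supported \<rho> \<longrightarrow>
              \<mu>' = (\<lambda>A. 1 / 2 * (\<nu> A - \<rho> A)))))"
proof -
  define G where "G = cauchy_transform (measure \<mu>)"
  define M where "M = moment_fps (measure \<mu>)"
  define N where "N = markov_fps M"
  define R where "R = markov_fps N"
  define W where "W = Abs_fps (\<lambda>n. if n = 0 then 0 else complex_of_real (\<kappa> n))"
  let ?g = "fps_X * M" and ?n = "fps_X * N" and ?r = "fps_X * R"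
  define f where "f = fps_const (1 / 2) * (?n - ?r)"
  note \<mu> = compactly_supported_prob_moments[OF assms(1-3)]
  have M: "M $ 0 = 1" "fps_conv_radius M > 0" using \<mu>(4,5) by (simp_all add: M_def)
  have N: "N $ 0 = 1" "fps_conv_radius N > 0"
    unfolding N_def by (intro markov_fps_0 markov_fps_conv_radius M)+
  have R: "R $ 0 = 1" "fps_conv_radius R > 0"
    unfolding R_def by (intro markov_fps_0 markov_fps_conv_radius N)+
  have eqs: "?n * ?g = - fps_deriv_inv ?g" "?r * ?n = - fps_deriv_inv ?n"
    unfolding N_def R_def using markov_fps_mult[OF M(1)] markov_fps_mult[OF N(1)[unfolded N_def]] by simp_all
  have Mmom: "M = Abs_fps (\<lambda>n. of_real (\<integral>x. x ^ n \<partial>\<mu>))"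
    by (simp add: M_def moment_fps_def \<mu>(3))
  have "M = 1 + (W oo ?g)"
    using free_cumulant_series[OF assms(4,1)] unfolding W_def Mmom .
  then have g: "?g = fps_X * (1 + (W oo ?g))" by simp
  have "?g \<noteq> 0" "?n \<noteq> 0" using M(1) N(1) by auto
  then have f: "f = fps_X * ((fps_deriv W oo ?g) * f +
      fps_const (1 / 2) * ((fps_deriv (fps_deriv W) oo ?g) * fps_deriv_inv ?g))"
    unfolding f_def by (intro infinitesimal_fps_equation g eqs)
  have jet: "jet (\<lambda>d. root_moment (p d) k) (?g $ Suc k) (f $ Suc k)" for k
    by (rule root_moment_jet[of p "\<lambda>n. of_real (\<kappa> n)" ?g f, folded W_def, OF assms(5,6) g f])
  have lim: "(\<lambda>d. root_moment (p d) n) \<longlonglongrightarrow> of_real (\<integral>x. x ^ n \<partial>\<mu>)"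
    "(\<lambda>d. of_nat d * (root_moment (p d) n - of_real (\<integral>x. x ^ n \<partial>\<mu>))) \<longlonglongrightarrow> f $ Suc n" for n
    using jet[of n] by (simp_all add: jet_def Mmom)
  \<comment> \<open>With all limits known, this is a condition on the moments of
    \<open>\<mu>'\<close> alone.\<close>
  have inf_iff: "infinitesimal_distribution p \<mu> \<mu>' \<longleftrightarrow>
      signed_measure \<mu>' \<and> (\<forall>n. of_real (signed_moment \<mu>' n) = f $ Suc n)" for \<mu>'
  proof -
    have "(\<lambda>d. of_nat d * (root_moment (p d) n - of_real (\<integral>x. x ^ n \<partial>\<mu>))) \<longlonglongrightarrow>
        of_real (signed_moment \<mu>' n) \<longleftrightarrow> of_real (signed_moment \<mu>' n) = f $ Suc n" for n
    proof
      assume "(\<lambda>d. of_nat d * (root_moment (p d) n - of_real (\<integral>x. x ^ n \<partial>\<mu>))) \<longlonglongrightarrow>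
        of_real (signed_moment \<mu>' n)"
      then show "of_real (signed_moment \<mu>' n) = f $ Suc n" using lim(2) by (rule LIMSEQ_unique)
    next
      assume eq: "of_real (signed_moment \<mu>' n) = f $ Suc n"
      show "(\<lambda>d. of_nat d * (root_moment (p d) n - of_real (\<integral>x. x ^ n \<partial>\<mu>))) \<longlonglongrightarrow>
        of_real (signed_moment \<mu>' n)"
        unfolding eq by (rule lim(2))
    qed
    then show ?thesis by (simp only: infinitesimal_distribution_def \<mu>(1) lim(1) simp_thms)
  qed
  have fps_of: "moment_fps \<nu> = N" if "is_inverse_markov (measure \<mu>) \<nu>" for \<nu>
    using inverse_markov_moment_fps(2)[OF that] M(1) by (simp add: M_def N_def)
  have fps_of2: "moment_fps \<rho> = R" if "is_inverse_markov (measure \<mu>) \<nu>" "is_inverse_markov \<nu> \<rho>" for \<nu> \<rho>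
    using inverse_markov_moment_fps(2)[OF that(2)] fps_of[OF that(1)] N(1) by (simp add: R_def)
  have f_moment: "f $ Suc n = of_real (1 / 2 * (signed_moment \<nu> n - signed_moment \<rho> n))"
    if "moment_fps \<nu> = N" "moment_fps \<rho> = R" for \<nu> \<rho> n
    by (simp add: f_def that[symmetric] moment_fps_def)
  have ex\<nu>: "\<exists>\<nu>. is_inverse_markov (measure \<mu>) \<nu>"
    using ex_inverse_markov[OF \<mu>(2,4,5)] .
  have ex\<rho>: "\<exists>\<rho>. is_inverse_markov \<nu> \<rho>" if "is_inverse_markov (measure \<mu>) \<nu>" for \<nu>
    using ex_inverse_markov[of \<nu>] that N unfolding fps_of[OF that] by (simp add: is_inverse_markov_def)
  have half: "infinitesimal_distribution p \<mu> (\<lambda>A. 1 / 2 * (\<nu> A - \<rho> A))"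
    if "is_inverse_markov (measure \<mu>) \<nu>" "is_inverse_markov \<nu> \<rho>" for \<nu> \<rho>
  proof -
    have s: "signed_measure \<nu>" "signed_measure \<rho>" using that by (simp_all add: is_inverse_markov_def)
    show ?thesis
      unfolding inf_iff signed_measure_half_difference(2)[OF s] f_moment[OF fps_of[OF that(1)] fps_of2[OF that]]
      using signed_measure_half_difference(1)[OF s] by simp
  qed
  have moments: "signed_moment \<mu>' n = 1 / 2 * (signed_moment \<nu> n - signed_moment \<rho> n)"
    if "infinitesimal_distribution p \<mu> \<mu>'" "is_inverse_markov (measure \<mu>) \<nu>" "is_inverse_markov \<nu> \<rho>" for \<mu>' \<nu> \<rho> n
  proof -
    have "of_real (signed_moment \<mu>' n) = f $ Suc n" using that(1) by (simp add: inf_iff)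
    then show ?thesis
      unfolding f_moment[OF fps_of[OF that(2)] fps_of2[OF that(2,3)]] of_real_eq_iff .
  qed
  have unique: "\<mu>' = (\<lambda>A. 1 / 2 * (\<nu> A - \<rho> A))"
    if "infinitesimal_distribution p \<mu> \<mu>'" "is_inverse_markov (measure \<mu>) \<nu>" "is_inverse_markov \<nu> \<rho>"
      "compactly_supported \<mu>'" "compactly_supported \<nu>" "compactly_supported \<rho>" for \<mu>' \<nu> \<rho>
  proof -
    have s: "signed_measure \<nu>" "signed_measure \<rho>" using that by (simp_all add: is_inverse_markov_def)
    show ?thesis
    proof (rule compactly_supported_moments_unique)
      show "signed_measure \<mu>'" using that(1) by (simp add: infinitesimal_distribution_def)
      show "signed_moment \<mu>' n = signed_moment (\<lambda>A. 1 / 2 * (\<nu> A - \<rho> A)) n" for n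
        unfolding signed_measure_half_difference(2)[OF s] by (rule moments[OF that(1-3)])
    qed (intro that signed_measure_half_difference(1)[OF s] compactly_supported_half_difference)+
  qed
  have transform: "\<forall>\<^sub>F z in at_infinity.
      summable (inf_cauchy_term p z) \<and> G z \<noteq> 0 \<and> deriv G z \<noteq> 0 \<and>
      inf_cauchy_transform p z = deriv (deriv G) z / (2 * deriv G z) - deriv G z / G z"
  proof -
    have inf: "inf_moment p n = f $ Suc n" for n
      unfolding inf_moment_def limI[OF lim(1)] by (rule limI[OF lim(2)])
    have X: "fps_conv_radius (fps_X * h) > 0" if "fps_conv_radius h > 0" for h :: "complex fps"
      using fps_conv_radius_mult[of fps_X h] that by (auto intro: less_le_trans[rotated])
    have eG: "expands_at_infinity G ?g"
      unfolding G_def M_def by (rule expands_cauchy_transform[OF \<mu>(4)])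
    \<comment> \<open>\<open>H\<close> and \<open>K\<close> come from the series and not from chosen
      measures, so the formula for the transform does not depend on any choice of
      \<open>\<nu>\<close> and \<open>\<rho>\<close>.\<close>
    define H where "H = (\<lambda>z. eval_fps ?n (inverse z))"
    define K where "K = (\<lambda>z. eval_fps ?r (inverse z))"
    have eH: "expands_at_infinity H ?n" and eK: "expands_at_infinity K ?r"
      using X[OF N(2)] X[OF R(2)] by (simp_all add: expands_at_infinity_def H_def K_def)
    have diff: "fps_conv_radius (?n - ?r) > 0"
      using fps_conv_radius_diff[of ?n ?r] X[OF N(2)] X[OF R(2)] by (auto intro: less_le_trans[rotated])
    then have f_rad: "fps_conv_radius f > 0"
      unfolding f_def using fps_conv_radius_mult[of "fps_const (1 / 2)" "?n - ?r"]
      by (auto intro: less_le_trans[rotated])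
    \<comment> \<open>The transform starts with \<open>z^(-2)\<close>. The skipped coefficients
      vanish: both series carry a factor \<open>X\<close>, and \<open>N\<close> and \<open>R\<close>
      have equal constant term.\<close>
    have f01: "f $ 0 = 0" "f $ Suc 0 = 0" using N(1) R(1) by (simp_all add: f_def)
    have ev_sums: "\<forall>\<^sub>F z in at_infinity. inf_cauchy_term p z sums eval_fps f (inverse z)"
      using sums_at_infinity[OF f_rad]
    proof eventually_elim
      case (elim z)
      then have "(\<lambda>n. f $ (n + 2) / z ^ (n + 2)) sums (eval_fps f (inverse z) - (\<Sum>n<2. f $ n / z ^ n))"
        by (rule sums_split_initial_segment)
      then show ?case by (simp add: inf_cauchy_term_def[abs_def] inf f01 numeral_2_eq_2)
    qed
    have ev_f: "\<forall>\<^sub>F z in at_infinity. eval_fps f (inverse z) = (H z - K z) / 2"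
      using eventually_inverse_conv_radius[OF X[OF N(2)]] eventually_inverse_conv_radius[OF X[OF R(2)]]
        eventually_inverse_conv_radius[OF diff]
      by eventually_elim (simp add: f_def H_def K_def eval_fps_mult eval_fps_diff)
    have e2: "expands_at_infinity (\<lambda>z. H z * G z) (?n * ?g)" "expands_at_infinity (\<lambda>z. K z * H z) (?r * ?n)"
      by (intro expands_mult eG eH eK)+
    have D2: "fps_deriv_inv (fps_deriv_inv ?g) = - (fps_deriv_inv ?n * ?g + ?n * fps_deriv_inv ?g)"
    proof -
      have "fps_deriv_inv (- h) = - fps_deriv_inv h" for h by (simp add: fps_deriv_inv_def)
      then have "fps_deriv_inv ?n * ?g + ?n * fps_deriv_inv ?g = - fps_deriv_inv (fps_deriv_inv ?g)"
        using arg_cong[OF eqs(1), of fps_deriv_inv] by (simp only: fps_deriv_inv_mult[of ?n ?g])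
      then show ?thesis by (simp only: minus_minus)
    qed
    have ev1: "\<forall>\<^sub>F z in at_infinity. H z * G z = - deriv G z"
      using e2(1) expands_uminus[OF expands_deriv[OF eG]] unfolding eqs(1)
      by (auto simp: expands_at_infinity_def elim: eventually_elim2)
    have ev2: "\<forall>\<^sub>F z in at_infinity. K z * H z = - deriv H z"
      using e2(2) expands_uminus[OF expands_deriv[OF eH]] unfolding eqs(2)
      by (auto simp: expands_at_infinity_def elim: eventually_elim2)
    have ev3: "\<forall>\<^sub>F z in at_infinity. deriv (deriv G) z = - (deriv H z * G z + H z * deriv G z)"
    proof -
      have "expands_at_infinity (\<lambda>z. - (deriv H z * G z + H z * deriv G z))
          (- (fps_deriv_inv ?n * ?g + ?n * fps_deriv_inv ?g))"
        by (intro expands_uminus expands_add expands_mult expands_deriv eG eH)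
      then show ?thesis
        using expands_deriv[OF expands_deriv[OF eG]] unfolding D2
        by (auto simp only: expands_at_infinity_def elim: eventually_elim2)
    qed
    have nzG: "\<forall>\<^sub>F z in at_infinity. G z \<noteq> 0"
      using expands_nonzero[of G 1 M] eG M by simp
    have nzH: "\<forall>\<^sub>F z in at_infinity. H z \<noteq> 0"
      using expands_nonzero[of H 1 N] eH N by simp
    show ?thesis
      using ev_sums ev_f ev1 ev2 ev3 nzG nzH
    proof eventually_elim
      case (elim z)
      have G': "deriv G z = - (H z * G z)" and H': "deriv H z = - (K z * H z)"
        using elim by simp_all
      \<comment> \<open>From \<open>G' = - H G\<close> and \<open>H' = - K H\<close> one gets
        \<open>G'' = (H + K) H G\<close>. The first quotient is thus \<open>- (H + K) / 2\<close>
        and the second is \<open>- H\<close>.\<close>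
      have formula: "deriv (deriv G) z / (2 * deriv G z) - deriv G z / G z = (H z - K z) / 2"
        using elim(5,6,7) unfolding G' H' by (simp add: field_simps)
      have "summable (inf_cauchy_term p z)" using elim(1) by (rule sums_summable)
      moreover have "inf_cauchy_transform p z = (H z - K z) / 2"
        unfolding inf_cauchy_transform_def elim(2)[symmetric] using elim(1) by (rule sums_unique[symmetric])
      moreover have "deriv G z \<noteq> 0" using elim(6,7) by (simp add: G')
      ultimately show ?case using elim(6) unfolding formula by blast
    qed
  qed
  \<comment> \<open>No separate construction of \<open>\<mu>'\<close>: it is the half difference of
    measures supplied by Boas' theorem.\<close>
  obtain \<nu> \<rho> where "is_inverse_markov (measure \<mu>) \<nu>" "is_inverse_markov \<nu> \<rho>" using ex\<nu> ex\<rho> by blast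
  then have ex\<mu>': "\<exists>\<mu>'. infinitesimal_distribution p \<mu> \<mu>'" using half by blast
  show ?thesis
    unfolding Let_def
  proof (intro conjI allI impI)
    show "\<exists>\<mu>'. infinitesimal_distribution p \<mu> \<mu>'" by (rule ex\<mu>')
    show "\<exists>\<nu>. is_inverse_markov (measure \<mu>) \<nu>" by (rule ex\<nu>)
    show "\<forall>\<^sub>F z in at_infinity. summable (inf_cauchy_term p z) \<and> cauchy_transform (measure \<mu>) z \<noteq> 0 \<and>
        deriv (cauchy_transform (measure \<mu>)) z \<noteq> 0 \<and>
        inf_cauchy_transform p z =
          deriv (deriv (cauchy_transform (measure \<mu>))) z / (2 * deriv (cauchy_transform (measure \<mu>)) z) -
          deriv (cauchy_transform (measure \<mu>)) z / cauchy_transform (measure \<mu>) z"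
      using transform unfolding G_def .
    fix \<nu> assume \<nu>: "is_inverse_markov (measure \<mu>) \<nu>"
    show "\<exists>\<rho>. is_inverse_markov \<nu> \<rho>" using ex\<rho>[OF \<nu>] .
  next
    fix \<nu> \<rho> assume "is_inverse_markov (measure \<mu>) \<nu> \<and> is_inverse_markov \<nu> \<rho>"
    then have \<nu>\<rho>: "is_inverse_markov (measure \<mu>) \<nu>" "is_inverse_markov \<nu> \<rho>" by simp_all
    show "infinitesimal_distribution p \<mu> (\<lambda>A. 1 / 2 * (\<nu> A - \<rho> A))" using half[OF \<nu>\<rho>] .
    fix \<mu>' assume \<mu>': "infinitesimal_distribution p \<mu> \<mu>'"
    show "signed_moment \<mu>' n = 1 / 2 * (signed_moment \<nu> n - signed_moment \<rho> n)" for n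
      using moments[OF \<mu>' \<nu>\<rho>] .
    assume "compactly_supported \<mu>' \<and> compactly_supported \<nu> \<and> compactly_supported \<rho>"
    then show "\<mu>' = (\<lambda>A. 1 / 2 * (\<nu> A - \<rho> A))" using unique[OF \<mu>' \<nu>\<rho>] by simp
  qed
qed

end
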